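(* Let $F$ be a cyclic cubic field with conductor $m$ and let $q$ be a (positive) square-free divisor of $m$. Then there is a unique ideal $Q$ of $\mathcal{O}_F$ with $\mathrm{N}(Q)=q$. Moreover, $Q$ is well-rounded if and only if one of the following holds: - $3\nmid m$ and $\frac{m}{4}\le q^2\le 4m$; or - $3\mid m$, $3\mid q$ and $\frac{m}{4}\le q^2\le 4m$.
   Context: A cyclic cubic field is a Galois extension $F/\mathbb{Q}$ of degree $3$; its conductor $m$ is the least positive integer with $F\subseteq\mathbb{Q}(\zeta_m)$. (Known: $m$ is a product of distinct elements of $\{9\}\cup\{q \text{ prime}: q\equiv 1 \bmod 3\}$.) All ideals are nonzero integral ideals of the ring of integers $\mathcal{O}_F$. An ideal is identified with the lattice in $\mathbb{R}^3$ that is its image under $x\mapsto (x,\sigma(x),\sigma^2(x))$, where $\sigma$ generates $\mathrm{Gal}(F/\mathbb{Q})$; thus $\|x\|^2=x^2+\sigma(x)^2+\sigma^2(x)^2$. A full rank lattice $L\subset\mathbb{R}^n$ is well-rounded (WR) if its set of nonzero vectors of minimal Euclidean norm contains $n$ linearly independent vectors. *)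

theory Defs
  imports
    "HOL-Analysis.Analysis"
    "HOL-Algebra.Algebra"
    "HOL-Algebra.Algebraic_Closure_Type"
    "HOL-Computational_Algebra.Squarefree"
begin

section \<open>Number fields as subfields of the complex numbers\<close>

abbreviation CC :: "complex ring"
  where "CC \<equiv> ring_of_type_algebra"

definition galois_group :: "complex set \<Rightarrow> complex set \<Rightarrow> (complex \<Rightarrow> complex) set"
  \<comment> \<open>The field automorphisms of \<open>F\<close> over \<open>K\<close>. As in \<open>BijGroup\<close>, they are taken to be
      extensional (\<open>undefined\<close> outside \<open>F\<close>), so that each automorphism is counted once.\<close>
  where "galois_group K F =
    {\<sigma> \<in> Bij F. \<sigma> \<in> ring_iso (CC\<lparr>carrier := F\<rparr>) (CC\<lparr>carrier := F\<rparr>) \<and> (\<forall>x\<in>K. \<sigma> x = x)}"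

definition galois_extension :: "complex set \<Rightarrow> complex set \<Rightarrow> bool"
  \<comment> \<open>A finite extension with as many automorphisms as its degree.\<close>
  where "galois_extension K F \<longleftrightarrow>
    subfield K CC \<and> subfield F CC \<and> K \<subseteq> F \<and>
    (\<exists>n. ring.dimension CC n K F \<and> card (galois_group K F) = n)"

definition cyclic_cubic_field :: "complex set \<Rightarrow> bool"
  where "cyclic_cubic_field F \<longleftrightarrow> galois_extension \<rat> F \<and> ring.dimension CC 3 \<rat> F"

definition galois_generator :: "complex set \<Rightarrow> (complex \<Rightarrow> complex) \<Rightarrow> bool"
  where "galois_generator F \<sigma> \<longleftrightarrow>
    \<sigma> \<in> galois_group \<rat> F \<and> generate (BijGroup F) {\<sigma>} = galois_group \<rat> F"

definition cyclotomic_field :: "nat \<Rightarrow> complex set"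
  where "cyclotomic_field n = generate_field CC {cis (2 * pi / real n)}"

definition is_conductor :: "complex set \<Rightarrow> nat \<Rightarrow> bool"
  where "is_conductor F m \<longleftrightarrow>
    m > 0 \<and> F \<subseteq> cyclotomic_field m \<and> (\<forall>n>0. F \<subseteq> cyclotomic_field n \<longrightarrow> m \<le> n)"


section \<open>Ideals of the ring of integers\<close>

definition ring_of_integers :: "complex set \<Rightarrow> complex ring"
  where "ring_of_integers F = CC\<lparr>carrier := {x \<in> F. algebraic_int x}\<rparr>"

definition nonzero_ideal :: "complex set \<Rightarrow> complex set \<Rightarrow> bool"
  where "nonzero_ideal F I \<longleftrightarrow> ideal I (ring_of_integers F) \<and> I \<noteq> {0}"

definition ideal_norm :: "complex set \<Rightarrow> complex set \<Rightarrow> nat"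
  where "ideal_norm F I = card (carrier (ring_of_integers F Quot I))"


section \<open>Well-rounded lattices\<close>

definition full_rank_lattice :: "'a::euclidean_space set \<Rightarrow> bool"
  where "full_rank_lattice L \<longleftrightarrow>
    (\<exists>B. independent B \<and> card B = DIM('a) \<and>
         L = {\<Sum>b\<in>B. of_int (c b) *\<^sub>R b | c :: 'a \<Rightarrow> int. True})"

definition minimal_vectors :: "'a::euclidean_space set \<Rightarrow> 'a set"
  where "minimal_vectors L = {v \<in> L. v \<noteq> 0 \<and> (\<forall>w\<in>L. w \<noteq> 0 \<longrightarrow> norm v \<le> norm w)}"

definition well_rounded :: "'a::euclidean_space set \<Rightarrow> bool"
  where "well_rounded L \<longleftrightarrow>
    full_rank_lattice L \<and>
    (\<exists>B \<subseteq> minimal_vectors L. independent B \<and> card B = DIM('a))"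

definition field_embedding :: "(complex \<Rightarrow> complex) \<Rightarrow> complex \<Rightarrow> real ^ 3"
  \<comment> \<open>A cyclic cubic subfield of the complex numbers is contained in the reals (its degree is
      odd), so \<open>Re\<close> only changes the type here.\<close>
  where "field_embedding \<sigma> x = vector [Re x, Re (\<sigma> x), Re (\<sigma> (\<sigma> x))]"

end

theory Submission
  imports
    Defs
    "Jordan_Normal_Form.Char_Poly"
    "HOL-Number_Theory.Residues"
begin

text \<open>
  Let \<open>\<O>\<close> be the ring of integers of a cyclic cubic field \<open>F\<close> of conductor \<open>m\<close>, let \<open>\<sigma>\<close> generate
  the Galois group and let \<open>T\<close> be the trace. One integer, together with an alternative between two cases,
  determines \<open>\<O>\<close> as a lattice with an action of \<open>\<sigma>\<close>. The lattice \<open>L\<close> of integers of trace zero is a module over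
  \<open>\<int>[\<sigma>]/(1 + \<sigma> + \<sigma>\<^sup>2)\<close>, which is the ring of Eisenstein integers; rounding shows that a shortest
  vector \<open>l\<close> generates it (\<open>trace_zero_generator_exists\<close>). Hence \<open>L\<close> is hexagonal, \<open>T(l\<^sup>2) = 2e\<close> for an
  integer \<open>e\<close>, and the trace form takes values in \<open>e\<int>\<close> on \<open>L\<close>. Either \<open>T(\<O>) = 3\<int>\<close>, and then
  \<open>\<O> = \<int> \<oplus> L\<close> (the case called \<open>wild\<close>), or there is an integer \<open>\<eta>\<close> of trace 1 with
  \<open>3\<eta> = 1 \<plusminus> (l - \<sigma> l)\<close>, and \<open>\<O> = \<int>[\<sigma>]\<eta>\<close> (\<open>tame_generator\<close>).

  The arithmetic core is \<open>conductor_eq\<close>: \<open>m = 3e\<close> in the wild case and \<open>m = e\<close> in the tame case.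
  It is proved one prime \<open>p\<close> at a time. If \<open>p\<close> divides \<open>m\<close>, then by minimality of \<open>m\<close> some
  automorphism of the field of \<open>m\<close>-th roots of unity that fixes all \<open>m/p\<close>-th roots of unity moves \<open>F\<close>.
  It acts trivially on \<open>\<O>\<close> modulo \<open>1 - \<zeta>\<close> for a root of unity \<open>\<zeta>\<close> of \<open>p\<close>-power order (\<open>inertia\<close>),
  which forces \<open>p\<close> to divide \<open>e\<close>; that it has order 3 on \<open>F\<close> bounds the exponent of \<open>p\<close> in \<open>m\<close>. If conversely \<open>p \<noteq> 3\<close> divides \<open>e\<close>,
  then \<open>l\<^sup>3 \<in> p\<O>\<close> although \<open>l \<notin> p\<O>\<close>; the Frobenius congruence \<open>g(\<zeta>)\<^sup>p \<equiv> g(\<zeta>\<^sup>p)\<close> modulo \<open>p\<close> excludes this when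
  \<open>p\<close> does not divide \<open>m\<close> (\<open>unramified_cube\<close>). The exponent of \<open>p\<close> in \<open>e\<close> is bounded because otherwise
  \<open>l/p\<close> would be an integer.

  Because the trace form on \<open>L\<close> vanishes modulo \<open>e\<close>, the map \<open>x \<mapsto> T(x)/3\<close> modulo \<open>q\<close> is a ring
  homomorphism \<open>\<O> \<rightarrow> \<int>/q\<close> when 3 does not divide \<open>q\<close>; at the prime 3 the norm takes its place. Its kernel
  \<open>Q\<close> is an ideal of norm \<open>q\<close>. Elements \<open>x\<close> of \<open>Q\<close> satisfy \<open>x\<^sup>3 \<in> q\<O>\<close>, so \<open>Q\<close> lies in every ideal of
  square-free norm \<open>q\<close>, and is the only one.

  Finally \<open>Q = \<int>[\<sigma>]v\<close> with \<open>T(v) = q\<close> and \<open>T(v\<^sup>2) = (q\<^sup>2 + 2m)/3\<close>, unless 3 divides \<open>m\<close> but not \<open>q\<close>. In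
  coordinates \<open>i, j, k\<close> the squared length is
  \<open>(q\<^sup>2 (i+j+k)\<^sup>2 + m ((i-j)\<^sup>2 + (j-k)\<^sup>2 + (k-i)\<^sup>2))/3\<close>. Three candidates compete for the minimum: the
  conjugates of \<open>v\<close> with \<open>(q\<^sup>2 + 2m)/3\<close>, the vectors of trace zero with \<open>2m\<close>, and the rational number \<open>q\<close>
  with \<open>3q\<^sup>2\<close>. Only the first contains a basis, and it attains the minimum exactly when
  \<open>m/4 \<le> q\<^sup>2 \<le> 4m\<close>. In the exceptional case \<open>Q = q\<int> \<oplus> L\<close> is an orthogonal sum, which is well-rounded
  only if \<open>3q\<^sup>2 = 2e\<close>; this is impossible because \<open>m\<close> is odd.
\<close>

hide_const (open) Polynomials.degree Polynomials.lead_coeff up_ring.coeff up_ring.monom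
  Divisibility.prime Module.smult
no_notation scalar_prod (infix "\<bullet>" 70)

section \<open>Algebraic integers\<close>

text \<open>The characteristic polynomial of an integer matrix is monic with integer coefficients.\<close>

lemma algebraic_int_eigenvalue:
  fixes v :: "nat \<Rightarrow> complex" and C :: "nat \<Rightarrow> nat \<Rightarrow> int"
  assumes nz: "\<exists>i<n. v i \<noteq> 0"
    and eq: "\<And>i. i < n \<Longrightarrow> x * v i = (\<Sum>j<n. of_int (C i j) * v j)"
  shows "algebraic_int x"
proof -
  define A where "A = mat n n (\<lambda>(i,j). C i j)"
  define M :: "complex mat" where "M = map_mat of_int A"
  define w where "w = Matrix.vec n v"
  have A: "A \<in> carrier_mat n n" and M: "M \<in> carrier_mat n n"
    by (auto simp: A_def M_def)
  have "M *\<^sub>v w = x \<cdot>\<^sub>v w"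
  proof (rule eq_vecI)
    fix i assume "i < dim_vec (x \<cdot>\<^sub>v w)"
    hence i: "i < n" by (simp add: w_def)
    have "vec_index (M *\<^sub>v w) i = (\<Sum>j<n. of_int (C i j) * v j)"
      using i by (simp add: M_def A_def w_def scalar_prod_def atLeast0LessThan)
    also have "\<dots> = x * v i" using eq[OF i] by simp
    finally show "vec_index (M *\<^sub>v w) i = vec_index (x \<cdot>\<^sub>v w) i" using i by (simp add: w_def)
  qed (simp add: M_def A_def w_def)
  moreover have "w \<noteq> 0\<^sub>v n"
  proof
    assume "w = 0\<^sub>v n"
    then have "\<And>i. i < n \<Longrightarrow> vec_index w i = 0" by simp
    with nz show False by (auto simp: w_def)
  qed
  ultimately have "eigenvalue M x"
    unfolding eigenvalue_def eigenvector_def using M by (intro exI[of _ w]) (auto simp: w_def)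
  hence root: "poly (char_poly M) x = 0"
    using eigenvalue_root_char_poly[OF M] by blast
  have "char_poly M = map_poly of_int (char_poly A)"
    unfolding M_def by (rule of_int_hom.char_poly_hom[OF A])
  moreover have "lead_coeff (char_poly A) = 1"
    using degree_monic_char_poly[OF A] by simp
  ultimately show ?thesis
    unfolding algebraic_int_altdef_ipoly using root by metis
qed

text \<open>An algebraic integer is a number that maps some nonzero finitely generated additive
  group of numbers into itself. The group is not tied to one number, which is what makes sums
  and products accessible.\<close>

definition int_span :: "'i set \<Rightarrow> ('i \<Rightarrow> complex) \<Rightarrow> complex set"
  where "int_span I v = {\<Sum>i\<in>I. of_int (c i) * v i | c :: 'i \<Rightarrow> int. True}"

lemma int_span_add: "x \<in> int_span I v \<Longrightarrow> y \<in> int_span I v \<Longrightarrow> x + y \<in> int_span I v"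
proof -
  assume "x \<in> int_span I v" "y \<in> int_span I v"
  then obtain c d :: "_ \<Rightarrow> int" where
    "x = (\<Sum>i\<in>I. of_int (c i) * v i)" "y = (\<Sum>i\<in>I. of_int (d i) * v i)"
    by (auto simp: int_span_def)
  hence "x + y = (\<Sum>i\<in>I. of_int (c i + d i) * v i)"
    by (simp add: sum.distrib algebra_simps)
  thus ?thesis unfolding int_span_def by (intro CollectI exI conjI TrueI)
qed

lemma int_span_smult: "x \<in> int_span I v \<Longrightarrow> of_int k * x \<in> int_span I v"
proof -
  assume "x \<in> int_span I v"
  then obtain c :: "_ \<Rightarrow> int" where "x = (\<Sum>i\<in>I. of_int (c i) * v i)"
    by (auto simp: int_span_def)
  hence "of_int k * x = (\<Sum>i\<in>I. of_int (k * c i) * v i)"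
    by (simp add: sum_distrib_left algebra_simps)
  thus ?thesis unfolding int_span_def by (intro CollectI exI conjI TrueI)
qed

lemma int_span_0: "0 \<in> int_span I v"
  unfolding int_span_def by (rule CollectI, rule exI[of _ "\<lambda>_. 0"]) simp

lemma int_span_base: "finite I \<Longrightarrow> i \<in> I \<Longrightarrow> v i \<in> int_span I v"
proof -
  assume "finite I" "i \<in> I"
  hence "v i = (\<Sum>j\<in>I. of_int (if j = i then 1 else 0) * v j)"
    by (simp add: if_distrib[of of_int] if_distrib[of "\<lambda>x. x * _"] sum.delta cong: if_cong)
  thus ?thesis unfolding int_span_def by (intro CollectI exI conjI TrueI)
qed

lemma int_span_sum:
  "(\<And>i. i \<in> A \<Longrightarrow> f i \<in> int_span I v) \<Longrightarrow> (\<Sum>i\<in>A. f i) \<in> int_span I v"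
  by (induction A rule: infinite_finite_induct) (auto intro: int_span_add int_span_0)

lemma int_span_mult_closed:
  assumes "\<And>i. i \<in> I \<Longrightarrow> x * v i \<in> int_span I v" and "y \<in> int_span I v"
  shows "x * y \<in> int_span I v"
proof -
  obtain c :: "_ \<Rightarrow> int" where c: "y = (\<Sum>i\<in>I. of_int (c i) * v i)"
    using assms(2) by (auto simp: int_span_def)
  have "x * y = (\<Sum>i\<in>I. of_int (c i) * (x * v i))"
    by (simp add: c sum_distrib_left algebra_simps)
  also have "\<dots> \<in> int_span I v"
    by (intro int_span_sum int_span_smult assms(1))
  finally show ?thesis .
qed

lemma algebraic_int_if_stable:
  assumes "finite I" "\<exists>i\<in>I. v i \<noteq> 0" and st: "\<And>i. i \<in> I \<Longrightarrow> x * v i \<in> int_span I v"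
  shows "algebraic_int x"
proof -
  obtain h where h: "bij_betw h {0..<card I} I"
    using ex_bij_betw_nat_finite[OF assms(1)] by blast
  have "\<forall>i\<in>I. \<exists>c :: _ \<Rightarrow> int. x * v i = (\<Sum>j\<in>I. of_int (c j) * v j)"
    using st by (auto simp: int_span_def)
  then obtain C :: "_ \<Rightarrow> _ \<Rightarrow> int" where
    C: "\<And>i. i \<in> I \<Longrightarrow> x * v i = (\<Sum>j\<in>I. of_int (C i j) * v j)" by metis
  show ?thesis
  proof (rule algebraic_int_eigenvalue[of "card I" "v \<circ> h"])
    obtain i where "i \<in> I" "v i \<noteq> 0" using assms(2) by blast
    then obtain k where "k < card I" "h k = i"
      using h unfolding bij_betw_def by (metis atLeastLessThan_iff imageE)
    thus "\<exists>i<card I. (v \<circ> h) i \<noteq> 0" using \<open>v i \<noteq> 0\<close> by auto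
  next
    fix k assume "k < card I"
    hence "h k \<in> I" using h by (auto simp: bij_betw_def)
    hence "x * v (h k) = (\<Sum>j\<in>I. of_int (C (h k) j) * v j)" by (rule C)
    also have "\<dots> = (\<Sum>j<card I. of_int (C (h k) (h j)) * v (h j))"
      using sum.reindex_bij_betw[OF h, of "\<lambda>j. of_int (C (h k) j) * v j"]
      by (simp add: atLeast0LessThan)
    finally show "x * (v \<circ> h) k = (\<Sum>j<card I. of_int (C (h k) (h j)) * (v \<circ> h) j)" by simp
  qed
qed

lemma algebraic_int_power_reduction:
  fixes x :: complex
  assumes "algebraic_int x"
  obtains n c where "n > 0" "x ^ n = (\<Sum>i<n. of_int (c i :: int) * x ^ i)"
proof -
  obtain p where p: "poly (map_poly of_int p) x = 0" "lead_coeff p = (1::int)"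
    using assms by (auto simp: algebraic_int_altdef_ipoly)
  define n where "n = degree p"
  have "degree (map_poly of_int p :: complex poly) = n"
    by (simp add: n_def)
  hence "(\<Sum>i\<le>n. of_int (coeff p i) * x ^ i) = 0"
    using p(1) by (simp add: poly_altdef coeff_map_poly)
  hence eq: "x ^ n = - (\<Sum>i<n. of_int (coeff p i) * x ^ i)"
    using p(2) by (simp add: lessThan_Suc_atMost[symmetric] n_def add_eq_0_iff)
  have "n > 0"
  proof (rule ccontr)
    assume "\<not> n > 0" thus False using eq by simp
  qed
  moreover have "x ^ n = (\<Sum>i<n. of_int (- coeff p i) * x ^ i)"
    using eq by (simp add: sum_negf)
  ultimately show ?thesis by (rule that)
qed

text \<open>The products of powers of \<open>x\<close> and \<open>y\<close> with exponents below the degrees span a group that both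
  numbers map into itself.\<close>

lemma algebraic_int_common_module:
  assumes "algebraic_int x" "algebraic_int y"
  obtains I :: "(nat \<times> nat) set" and v where "finite I" "\<exists>i\<in>I. v i \<noteq> 0"
    "\<And>z. z \<in> int_span I v \<Longrightarrow> x * z \<in> int_span I v"
    "\<And>z. z \<in> int_span I v \<Longrightarrow> y * z \<in> int_span I v"
proof -
  obtain a c where a: "a > 0" "x ^ a = (\<Sum>i<a. of_int (c i :: int) * x ^ i)"
    by (rule algebraic_int_power_reduction[OF assms(1)])
  obtain b d where b: "b > 0" "y ^ b = (\<Sum>i<b. of_int (d i :: int) * y ^ i)"
    by (rule algebraic_int_power_reduction[OF assms(2)])
  define I where "I = {..<a} \<times> {..<b}"
  define v where "v = (\<lambda>(i,j). x ^ i * y ^ j)"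
  have fin: "finite I" by (simp add: I_def)
  have base: "x ^ i * y ^ j \<in> int_span I v" if "i < a" "j < b" for i j
    using int_span_base[OF fin, of "(i,j)" v] that by (auto simp: I_def v_def)
  show ?thesis
  proof (rule that[of I v])
    show "\<exists>i\<in>I. v i \<noteq> 0" using a b by (intro bexI[of _ "(0,0)"]) (auto simp: I_def v_def)
    show "x * z \<in> int_span I v" if "z \<in> int_span I v" for z
    proof (rule int_span_mult_closed[OF _ that])
      fix k assume "k \<in> I"
      then obtain i j where k: "k = (i,j)" "i < a" "j < b" by (auto simp: I_def)
      show "x * v k \<in> int_span I v"
      proof (cases "Suc i < a")
        case True
        then show ?thesis using base[of "Suc i" j] k by (simp add: v_def mult_ac)
      next
        case False
        hence "Suc i = a" using k by simp
        hence "x * v k = y ^ j * x ^ a" using k by (auto simp: v_def)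
        also have "\<dots> = (\<Sum>i<a. of_int (c i) * (x ^ i * y ^ j))"
          by (simp add: a(2) sum_distrib_left mult_ac)
        also have "\<dots> \<in> int_span I v"
          using k by (intro int_span_sum int_span_smult base) auto
        finally show ?thesis .
      qed
    qed
    show "y * z \<in> int_span I v" if "z \<in> int_span I v" for z
    proof (rule int_span_mult_closed[OF _ that])
      fix k assume "k \<in> I"
      then obtain i j where k: "k = (i,j)" "i < a" "j < b" by (auto simp: I_def)
      show "y * v k \<in> int_span I v"
      proof (cases "Suc j < b")
        case True
        then show ?thesis using base[of i "Suc j"] k by (simp add: v_def mult_ac)
      next
        case False
        hence "Suc j = b" using k by simp
        hence "y * v k = x ^ i * y ^ b" using k by (auto simp: v_def)
        also have "\<dots> = (\<Sum>j<b. of_int (d j) * (x ^ i * y ^ j))"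
          by (simp add: b(2) sum_distrib_left mult_ac)
        also have "\<dots> \<in> int_span I v"
          using k by (intro int_span_sum int_span_smult base) auto
        finally show ?thesis .
      qed
    qed
  qed (rule fin)
qed

lemma algebraic_int_add [intro]:
  fixes x y :: complex
  assumes "algebraic_int x" "algebraic_int y"
  shows "algebraic_int (x + y)"
proof -
  obtain I :: "(nat \<times> nat) set" and v where I: "finite I" "\<exists>i\<in>I. v i \<noteq> 0"
    "\<And>z. z \<in> int_span I v \<Longrightarrow> x * z \<in> int_span I v"
    "\<And>z. z \<in> int_span I v \<Longrightarrow> y * z \<in> int_span I v"
    using algebraic_int_common_module[OF assms] by blast
  show ?thesis
    by (rule algebraic_int_if_stable[OF I(1,2)])
      (auto simp: distrib_right intro!: int_span_add I int_span_base)
qed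

lemma algebraic_int_mult [intro]:
  fixes x y :: complex
  assumes "algebraic_int x" "algebraic_int y"
  shows "algebraic_int (x * y)"
proof -
  obtain I :: "(nat \<times> nat) set" and v where I: "finite I" "\<exists>i\<in>I. v i \<noteq> 0"
    "\<And>z. z \<in> int_span I v \<Longrightarrow> x * z \<in> int_span I v"
    "\<And>z. z \<in> int_span I v \<Longrightarrow> y * z \<in> int_span I v"
    using algebraic_int_common_module[OF assms] by blast
  show ?thesis
    by (rule algebraic_int_if_stable[OF I(1,2)])
      (auto simp: mult.assoc intro!: I int_span_base)
qed

lemma algebraic_int_diff [intro]:
  "algebraic_int x \<Longrightarrow> algebraic_int y \<Longrightarrow> algebraic_int (x - y :: complex)"
  using algebraic_int_add[of x "- y"] by simp

lemma algebraic_int_power [intro]: "algebraic_int x \<Longrightarrow> algebraic_int (x ^ n :: complex)"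
  by (induction n) auto

lemma algebraic_int_cubic:
  fixes x :: complex
  assumes "x ^ 3 - of_int a * x\<^sup>2 + of_int b * x - of_int c = 0"
  shows "algebraic_int x"
proof (rule algebraic_int.intros[of "[:- of_int c, of_int b, - of_int a, 1:]"])
  show "\<forall>i. coeff [:- of_int c, of_int b, - of_int a, 1:] i \<in> (\<int> :: complex set)"
    by (auto simp: coeff_pCons split: nat.splits)
  show "poly [:- of_int c, of_int b, - of_int a, 1:] x = 0"
    using assms by (simp add: algebra_simps power2_eq_square power3_eq_cube)
qed simp

text \<open>Bezout: \<open>x\<close> is an integral combination of \<open>a x\<close> and \<open>b x\<close>.\<close>

lemma algebraic_int_divide_coprime:
  fixes x :: complex
  assumes "algebraic_int (of_int a * x)" "algebraic_int (of_int b * x)" "coprime a (b::int)"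
  shows "algebraic_int x"
proof -
  obtain u v where "u * a + v * b = 1" using assms(3) bezout_int[of a b] by auto
  hence "(of_int u * of_int a + of_int v * of_int b :: complex) = 1"
    by (metis of_int_1 of_int_add of_int_mult)
  hence "x = of_int u * (of_int a * x) + of_int v * (of_int b * x)"
    by (simp add: mult.assoc[symmetric] distrib_right[symmetric])
  thus ?thesis using assms(1,2)
    by (metis algebraic_int_add algebraic_int_mult algebraic_int_of_int)
qed

lemma algebraic_int_of_int_divide_iff:
  fixes a b :: int
  assumes "b \<noteq> 0"
  shows "algebraic_int (of_int a / of_int b :: complex) \<longleftrightarrow> b dvd a"
proof
  assume "algebraic_int (of_int a / of_int b :: complex)"
  hence "(of_int a / of_int b :: complex) \<in> \<int>"
    by (rule rational_algebraic_int_is_int) simp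
  then obtain k where "(of_int a / of_int b :: complex) = of_int k" by (auto elim: Ints_cases)
  hence "(of_int a :: complex) = of_int (k * b)" using assms by (simp add: field_simps)
  thus "b dvd a" by (simp only: of_int_eq_iff) simp
next
  assume "b dvd a"
  thus "algebraic_int (of_int a / of_int b :: complex)" using assms by auto
qed

section \<open>Orders generated by one algebraic integer\<close>

definition ipoly_at :: "int poly \<Rightarrow> complex \<Rightarrow> complex"
  where "ipoly_at g z = poly (map_poly of_int g) z"

lemma ipoly_at_simps [simp]:
  "ipoly_at 0 z = 0" "ipoly_at 1 z = 1"
  "ipoly_at (g + h) z = ipoly_at g z + ipoly_at h z"
  "ipoly_at (g - h) z = ipoly_at g z - ipoly_at h z"
  "ipoly_at (- g) z = - ipoly_at g z"
  "ipoly_at (g * h) z = ipoly_at g z * ipoly_at h z"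
  "ipoly_at (Polynomial.smult c g) z = of_int c * ipoly_at g z"
  "ipoly_at (pCons c g) z = of_int c + z * ipoly_at g z"
  "ipoly_at (of_nat n) z = of_nat n"
  "ipoly_at (of_int k) z = of_int k"
  by (simp_all add: ipoly_at_def of_int_hom.map_poly_hom_add hom_distribs of_nat_poly of_int_poly)

lemma ipoly_at_power [simp]: "ipoly_at (g ^ n) z = ipoly_at g z ^ n"
  by (induction n) simp_all

lemma ipoly_at_monom [simp]: "ipoly_at (monom c n) z = of_int c * z ^ n"
  by (simp add: ipoly_at_def poly_monom)

lemma ipoly_at_pcompose [simp]: "ipoly_at (pcompose g h) z = ipoly_at g (ipoly_at h z)"
  by (induction g) (simp_all add: pcompose_pCons)

definition int_adjoin :: "complex \<Rightarrow> complex set"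
  where "int_adjoin z = range (\<lambda>g. ipoly_at g z)"

lemma int_adjoinI [intro]: "ipoly_at g z \<in> int_adjoin z"
  by (auto simp: int_adjoin_def)

lemma int_adjoin_add: "x \<in> int_adjoin z \<Longrightarrow> y \<in> int_adjoin z \<Longrightarrow> x + y \<in> int_adjoin z"
  unfolding int_adjoin_def by (auto simp flip: ipoly_at_simps(3))

lemma int_adjoin_diff: "x \<in> int_adjoin z \<Longrightarrow> y \<in> int_adjoin z \<Longrightarrow> x - y \<in> int_adjoin z"
  unfolding int_adjoin_def by (auto simp flip: ipoly_at_simps(4))

lemma int_adjoin_mult: "x \<in> int_adjoin z \<Longrightarrow> y \<in> int_adjoin z \<Longrightarrow> x * y \<in> int_adjoin z"
  unfolding int_adjoin_def by (auto simp flip: ipoly_at_simps(6))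

lemma int_adjoin_of_int: "of_int k \<in> int_adjoin z"
  using int_adjoinI[of "of_int k" z] by simp

lemma int_adjoin_of_nat: "of_nat k \<in> int_adjoin z"
  using int_adjoin_of_int[of "int k" z] by simp

lemma int_adjoin_self: "z \<in> int_adjoin z"
  using int_adjoinI[of "[:0,1:]" z] by simp

lemma int_adjoin_power: "x \<in> int_adjoin z \<Longrightarrow> x ^ n \<in> int_adjoin z"
  using int_adjoin_of_int[of 1 z] by (induction n) (auto intro: int_adjoin_mult)

lemma int_adjoin_sum: "(\<And>i. i \<in> A \<Longrightarrow> f i \<in> int_adjoin z) \<Longrightarrow> (\<Sum>i\<in>A. f i) \<in> int_adjoin z"
  using int_adjoin_of_int[of 0 z] by (induction A rule: infinite_finite_induct) (auto intro: int_adjoin_add)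

lemma int_adjoin_subset:
  assumes "w \<in> int_adjoin z"
  shows "int_adjoin w \<subseteq> int_adjoin z"
proof -
  obtain h where "w = ipoly_at h z" using assms by (auto simp: int_adjoin_def)
  hence "ipoly_at g w \<in> int_adjoin z" for g
    using int_adjoinI[of "pcompose g h" z] by simp
  thus ?thesis unfolding int_adjoin_def by auto
qed

lemma algebraic_int_int_adjoin:
  assumes "algebraic_int z" "x \<in> int_adjoin z"
  shows "algebraic_int x"
proof -
  obtain g where "x = ipoly_at g z" using assms by (auto simp: int_adjoin_def)
  moreover have "algebraic_int (ipoly_at g z)"
    by (induction g) (auto intro!: algebraic_int_add algebraic_int_mult assms)
  ultimately show ?thesis by simp
qed

text \<open>The usual divisibility of \<open>g(x) - g(y)\<close> by \<open>x - y\<close>, with control of the ring that contains the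
  quotient.\<close>

lemma ipoly_at_diff_dvd:
  assumes "x \<in> int_adjoin z" "y \<in> int_adjoin z"
  shows "\<exists>r\<in>int_adjoin z. ipoly_at g x - ipoly_at g y = (x - y) * r"
proof (induction g)
  case 0
  then show ?case using int_adjoin_of_int[of 0 z] by (intro bexI[of _ 0]) auto
next
  case (pCons a g)
  then obtain r where r: "r \<in> int_adjoin z" "ipoly_at g x - ipoly_at g y = (x - y) * r" by blast
  have "ipoly_at g x \<in> int_adjoin z"
    using int_adjoin_subset[OF assms(1)] by blast
  moreover have "x * ipoly_at g x - y * ipoly_at g y
    = (x - y) * ipoly_at g x + y * (ipoly_at g x - ipoly_at g y)"
    by (simp add: algebra_simps)
  hence "x * ipoly_at g x - y * ipoly_at g y = (x - y) * (ipoly_at g x + y * r)"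
    by (simp add: r(2) algebra_simps)
  ultimately show ?case using r(1) assms(2)
    by (intro bexI[of _ "ipoly_at g x + y * r"]) (auto intro: int_adjoin_add int_adjoin_mult)
qed

subsection \<open>The Frobenius congruence\<close>

lemma prime_power_add:
  fixes x y :: "'a :: comm_ring_1"
  assumes "prime p"
  shows "\<exists>s. (x + y) ^ p = x ^ p + y ^ p + of_nat p * s"
proof -
  define s where "s = (\<Sum>k\<in>{0<..<p}. of_nat ((p choose k) div p) * x ^ k * y ^ (p - k))"
  have p: "p > 0" using assms by (rule prime_gt_0_nat)
  have eq: "{..p} = insert 0 (insert p {0<..<p})" using p by auto
  have "(x + y) ^ p = (\<Sum>k\<le>p. of_nat (p choose k) * x ^ k * y ^ (p - k))"
    by (rule binomial_ring)
  also have "\<dots> = y ^ p + x ^ p + (\<Sum>k\<in>{0<..<p}. of_nat (p choose k) * x ^ k * y ^ (p - k))"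
    using p unfolding eq by (subst sum.insert; simp)
  also have "(\<Sum>k\<in>{0<..<p}. of_nat (p choose k) * x ^ k * y ^ (p - k)) = of_nat p * s"
    unfolding s_def sum_distrib_left
  proof (rule sum.cong)
    fix k assume "k \<in> {0<..<p}"
    hence "p dvd (p choose k)" using assms by (intro dvd_choose_prime) auto
    hence "of_nat (p choose k) = (of_nat p * of_nat ((p choose k) div p) :: 'a)"
      by (metis dvd_mult_div_cancel of_nat_mult)
    thus "of_nat (p choose k) * x ^ k * y ^ (p - k)
      = of_nat p * (of_nat ((p choose k) div p) * x ^ k * y ^ (p - k))"
      by (simp only: mult.assoc)
  qed simp
  finally show ?thesis by (auto simp: add_ac)
qed

lemma int_fermat: "prime p \<Longrightarrow> \<exists>t. (a::int) ^ p = a + of_nat p * t"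
proof (induction a rule: int_induct[of _ 0])
  case base
  then show ?case using prime_gt_0_nat[of p] by (auto intro: exI[of _ 0] simp: zero_power)
next
  case (step1 i)
  then obtain t where t: "i ^ p = i + int p * t" by auto
  obtain s where "(i + 1) ^ p = i ^ p + 1 ^ p + of_nat p * s"
    using prime_power_add[OF step1(3), of i 1] by blast
  hence "(i + 1) ^ p = (i + 1) + of_nat p * (t + s)" by (simp add: t algebra_simps)
  thus ?case by blast
next
  case (step2 i)
  then obtain t where t: "i ^ p = i + int p * t" by auto
  obtain s where "((i - 1) + 1) ^ p = (i - 1) ^ p + 1 ^ p + of_nat p * s"
    using prime_power_add[OF step2(3), of "i - 1" 1] by blast
  hence "(i - 1) ^ p = (i - 1) + of_nat p * (t - s)" by (simp add: t algebra_simps)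
  thus ?case by blast
qed

text \<open>Raising to the power \<open>p\<close> is additive modulo \<open>p\<close> and fixes integers modulo \<open>p\<close>. Working with
  polynomials instead of numbers keeps the error term in the order generated by any argument.\<close>

lemma poly_frobenius:
  fixes g :: "int poly"
  assumes "prime p"
  shows "\<exists>h. g ^ p = pcompose g (monom 1 p) + of_nat p * h"
proof (induction g)
  case 0
  then show ?case using prime_gt_0_nat[OF assms] by (auto intro: exI[of _ 0] simp: zero_power)
next
  case (pCons a g)
  then obtain h where h: "g ^ p = pcompose g (monom 1 p) + of_nat p * h" by blast
  obtain s where s: "([:a:] + monom 1 1 * g) ^ p = [:a:] ^ p + (monom 1 1 * g) ^ p + of_nat p * s"
    using prime_power_add[OF assms, of "[:a:]" "monom 1 1 * g"] by blast
  obtain t where t: "a ^ p = a + of_nat p * t" using int_fermat[OF assms] by blast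
  have 1: "pCons a g = [:a:] + monom 1 1 * g"
    by (simp add: monom_altdef)
  have 2: "[:a:] ^ p = [:a:] + of_nat p * [:t:]"
    by (simp add: t of_nat_poly poly_const_pow)
  have "pCons a g ^ p = [:a:] + of_nat p * [:t:] + monom 1 p * g ^ p + of_nat p * s"
    unfolding 1 s 2 by (simp add: power_mult_distrib monom_power)
  also have "\<dots> = pcompose (pCons a g) (monom 1 p) + of_nat p * ([:t:] + monom 1 p * h + s)"
    by (simp add: h pcompose_pCons algebra_simps)
  finally show ?case by blast
qed

lemma ipoly_at_frobenius:
  assumes "prime p"
  shows "\<exists>r\<in>int_adjoin z. ipoly_at g z ^ (p ^ f) = ipoly_at g (z ^ (p ^ f)) + of_nat p * r"
proof -
  have "\<exists>h. g ^ (p ^ f) = pcompose g (monom 1 (p ^ f)) + of_nat p * h"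
  proof (induction f)
    case 0
    have "pcompose g (monom 1 1) = g" by (simp add: monom_altdef pcompose_idR)
    then show ?case by (auto intro: exI[of _ 0])
  next
    case (Suc f)
    then obtain h where h: "g ^ (p ^ f) = pcompose g (monom 1 (p ^ f)) + of_nat p * h" by blast
    obtain h1 where h1: "(pcompose g (monom 1 (p ^ f)) + of_nat p * h) ^ p =
        (pcompose g (monom 1 (p ^ f))) ^ p + (of_nat p * h) ^ p + of_nat p * h1"
      using prime_power_add[OF assms] by blast
    obtain h2 where h2: "(pcompose g (monom 1 (p ^ f))) ^ p =
       pcompose (pcompose g (monom 1 (p ^ f))) (monom 1 p) + of_nat p * h2"
      using poly_frobenius[OF assms] by blast
    have 3: "pcompose (monom 1 (p ^ f)) (monom 1 p) = (monom 1 (p ^ Suc f) :: int poly)"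
      by (simp add: monom_altdef pcompose_hom.hom_power pcompose_pCons flip: power_mult)
    have "(of_nat p * h) ^ p = of_nat p * (of_nat p ^ (p - 1) * h ^ p)"
      using prime_gt_0_nat[OF assms]
      by (cases p) (simp_all add: power_mult_distrib mult_ac)
    hence 4: "(of_nat p * h) ^ p = of_nat p * (of_nat p ^ (p - 1) * h ^ p)" .
    have "g ^ (p ^ Suc f) = (g ^ (p ^ f)) ^ p"
      by (simp only: power_Suc2 power_mult)
    also have "\<dots> = pcompose (pcompose g (monom 1 (p ^ f))) (monom 1 p) + of_nat p * h2
        + of_nat p * (of_nat p ^ (p - 1) * h ^ p) + of_nat p * h1"
      by (simp only: h h1 h2 4)
    also have "pcompose (pcompose g (monom 1 (p ^ f))) (monom 1 p) = pcompose g (monom 1 (p ^ Suc f))"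
      by (simp only: pcompose_assoc[symmetric] 3)
    finally have "g ^ (p ^ Suc f) = pcompose g (monom 1 (p ^ Suc f))
       + of_nat p * (h2 + of_nat p ^ (p - 1) * h ^ p + h1)"
      by (simp only: distrib_left add.assoc)
    thus ?case by blast
  qed
  then obtain h where "g ^ (p ^ f) = pcompose g (monom 1 (p ^ f)) + of_nat p * h" by blast
  hence "ipoly_at (g ^ (p ^ f)) z = ipoly_at (pcompose g (monom 1 (p ^ f)) + of_nat p * h) z"
    by simp
  hence "ipoly_at g z ^ (p ^ f) = ipoly_at g (z ^ (p ^ f)) + of_nat p * ipoly_at h z"
    by simp
  thus ?thesis by (auto intro!: bexI[of _ "ipoly_at h z"])
qed

subsection \<open>Integral closedness at a prime\<close>

text \<open>If powering by arbitrarily large exponents is the identity on \<open>\<int>[z]/\<pi>\<close>, then \<open>\<int>[z]\<close> is integrally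
  closed at \<open>\<pi>\<close>. Indeed \<open>\<pi> x\<close> is congruent to \<open>(\<pi> x)\<^sup>n\<close>, and as \<open>x\<close> is integral its powers have a common
  denominator \<open>\<pi>\<^sup>d\<close>, so that \<open>(\<pi> x)\<^sup>n\<close> is divisible by \<open>\<pi>\<close> once \<open>n\<close> exceeds \<open>d\<close>.\<close>

lemma int_adjoin_integral_descent:
  assumes frob: "\<And>r B. r \<in> int_adjoin z \<Longrightarrow> \<exists>n\<ge>B. \<exists>s\<in>int_adjoin z. r - r ^ n = \<pi> * s"
    and \<pi>: "\<pi> \<in> int_adjoin z" "\<pi> \<noteq> 0"
    and x: "algebraic_int x" "\<pi> * x \<in> int_adjoin z"
  shows "x \<in> int_adjoin z"
proof -
  obtain d c where d: "d > 0" "x ^ d = (\<Sum>i<d. of_int (c i :: int) * x ^ i)"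
    by (rule algebraic_int_power_reduction[OF x(1)])
  have bounded: "\<pi> ^ d * x ^ j \<in> int_adjoin z" for j
  proof (induction j rule: less_induct)
    case (less j)
    show ?case
    proof (cases "j < d")
      case True
      hence "\<pi> ^ d * x ^ j = \<pi> ^ (d - j) * (\<pi> * x) ^ j"
        by (simp add: power_mult_distrib mult.assoc[symmetric] flip: power_add)
      thus ?thesis using \<pi>(1) x(2) by (auto intro: int_adjoin_mult int_adjoin_power)
    next
      case False
      hence "x ^ j = x ^ (j - d) * x ^ d" by (simp flip: power_add)
      also have "\<dots> = (\<Sum>i<d. of_int (c i) * x ^ (j - d + i))"
        by (simp add: d(2) sum_distrib_left power_add mult_ac)
      finally have "\<pi> ^ d * x ^ j = (\<Sum>i<d. of_int (c i) * (\<pi> ^ d * x ^ (j - d + i)))"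
        by (simp add: sum_distrib_left mult_ac)
      also have "\<dots> \<in> int_adjoin z"
      proof (rule int_adjoin_sum, rule int_adjoin_mult[OF int_adjoin_of_int less])
        show "j - d + i < j" if "i \<in> {..<d}" for i using that False by simp
      qed
      finally show ?thesis .
    qed
  qed
  obtain n s where n: "n \<ge> Suc d" "s \<in> int_adjoin z" "\<pi> * x - (\<pi> * x) ^ n = \<pi> * s"
    using frob[OF x(2)] by blast
  have "(\<pi> * x) ^ n = \<pi> ^ (Suc d + (n - Suc d)) * x ^ n"
    using n(1) by (simp add: power_mult_distrib)
  also have "\<dots> = \<pi> * (\<pi> ^ (n - Suc d) * (\<pi> ^ d * x ^ n))"
    by (simp only: power_add power_Suc mult_ac)
  finally have "\<pi> * x = \<pi> * (s + \<pi> ^ (n - Suc d) * (\<pi> ^ d * x ^ n))"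
    using n(3) by (simp add: algebra_simps)
  hence "x = s + \<pi> ^ (n - Suc d) * (\<pi> ^ d * x ^ n)" using \<pi>(2) by simp
  also have "\<dots> \<in> int_adjoin z"
    by (rule int_adjoin_add[OF n(2) int_adjoin_mult[OF int_adjoin_power[OF \<pi>(1)] bounded]])
  finally show ?thesis .
qed

text \<open>As \<open>z\<^sup>l \<equiv> 1\<close> modulo \<open>\<pi>\<close>, the power of \<open>z\<close> with exponent \<open>p\<^sup>f\<close> is congruent to \<open>z\<close> whenever
  \<open>p\<^sup>f \<equiv> 1\<close> modulo \<open>l\<close>; the Frobenius congruence carries
  this over to all of \<open>\<int>[z]\<close>. It is used with \<open>\<pi> = p\<close> when \<open>k = 0\<close> and with \<open>\<pi> = 1 - z\<^sup>l\<close> otherwise.\<close>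

lemma root_of_unity_frobenius:
  assumes p: "prime p" and cop: "coprime p l" and z: "z ^ (p ^ k * l) = 1"
    and \<pi>1: "\<exists>s\<in>int_adjoin z. of_nat p = \<pi> * s"
    and \<pi>2: "\<exists>s\<in>int_adjoin z. 1 - z ^ l = \<pi> * s"
    and r: "r \<in> int_adjoin z"
  shows "\<exists>n\<ge>B. \<exists>s\<in>int_adjoin z. r - r ^ n = \<pi> * s"
proof -
  define f where "f = B * totient l"
  obtain g where g: "r = ipoly_at g z" using r by (auto simp: int_adjoin_def)
  have "[p ^ totient l = 1] (mod l)" using cop by (rule euler_theorem)
  hence "[(p ^ totient l) ^ B = 1 ^ B] (mod l)" by (rule cong_pow)
  hence "[p ^ f = 1] (mod l)"
    unfolding f_def mult.commute[of B] power_mult by simp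
  moreover have "p ^ f \<ge> 1" using prime_gt_0_nat[OF p] by simp
  ultimately obtain t where t: "p ^ f = 1 + l * t"
    by (metis cong_to_1_nat dvdE le_add_diff_inverse)
  have l: "l > 0" using cop p by (intro gr0I) auto
  have "totient l \<ge> 1" using l by (simp add: Suc_leI)
  hence "B \<le> f" unfolding f_def by simp
  also have "f < p ^ f" using prime_gt_1_nat[OF p] by (simp add: power_gt_expt)
  finally have B: "p ^ f \<ge> B" by simp
  obtain s1 where s1: "s1 \<in> int_adjoin z" "of_nat p = \<pi> * s1" using \<pi>1 by blast
  obtain s2 where s2: "s2 \<in> int_adjoin z" "1 - z ^ l = \<pi> * s2" using \<pi>2 by blast
  obtain s3 where s3: "s3 \<in> int_adjoin z" "r ^ (p ^ f) = ipoly_at g (z ^ (p ^ f)) + of_nat p * s3"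
    using ipoly_at_frobenius[OF p, of z g f] by (auto simp: g)
  obtain s4 where s4: "s4 \<in> int_adjoin z"
    "ipoly_at g z - ipoly_at g (z ^ (p ^ f)) = (z - z ^ (p ^ f)) * s4"
    using ipoly_at_diff_dvd[OF int_adjoin_self int_adjoin_power[OF int_adjoin_self]] by blast
  have "z - z ^ (p ^ f) = z * (1 - (z ^ l) ^ t)"
    unfolding t by (simp add: algebra_simps power_mult power_add)
  also have "1 - (z ^ l) ^ t = (1 - z ^ l) * (\<Sum>i<t. (z ^ l) ^ i)"
    by (rule one_diff_power_eq)
  finally have "z - z ^ (p ^ f) = z * (\<pi> * s2 * (\<Sum>i<t. (z ^ l) ^ i))"
    by (simp only: s2(2))
  moreover have "r - r ^ (p ^ f) = (ipoly_at g z - ipoly_at g (z ^ (p ^ f))) - of_nat p * s3"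
    unfolding s3(2) by (simp add: g)
  ultimately have "r - r ^ (p ^ f) = z * (\<pi> * s2 * (\<Sum>i<t. (z ^ l) ^ i)) * s4 - \<pi> * s1 * s3"
    by (simp only: s4(2) s1(2))
  also have "\<dots> = \<pi> * (z * s2 * (\<Sum>i<t. (z ^ l) ^ i) * s4 - s1 * s3)"
    by (simp only: right_diff_distrib mult_ac)
  finally have "r - r ^ (p ^ f) = \<pi> * (z * s2 * (\<Sum>i<t. (z ^ l) ^ i) * s4 - s1 * s3)" .
  moreover have "z * s2 * (\<Sum>i<t. (z ^ l) ^ i) * s4 - s1 * s3 \<in> int_adjoin z"
    using s1(1) s2(1) s3(1) s4(1)
    by (auto intro!: int_adjoin_diff int_adjoin_mult int_adjoin_sum int_adjoin_power
        intro: int_adjoin_self)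
  ultimately show ?thesis using B by blast
qed

text \<open>Some power of \<open>\<pi>\<close> is a multiple of \<open>p\<close>, so descent along \<open>\<pi>\<close> removes every factor \<open>p\<close> from a
  denominator.\<close>

lemma prime_to_p_denominator:
  assumes desc: "\<And>x. algebraic_int x \<Longrightarrow> \<pi> * x \<in> int_adjoin z \<Longrightarrow> x \<in> int_adjoin z"
    and \<pi>: "algebraic_int \<pi>" "s \<in> int_adjoin z" "\<pi> ^ N = of_nat p * s"
    and p: "prime p"
    and x: "algebraic_int x" and D: "D > 0" "of_nat D * x \<in> int_adjoin z"
  obtains D' where "coprime D' p" "D' > 0" "of_nat D' * x \<in> int_adjoin z"
proof -
  have descp: "y \<in> int_adjoin z" if "algebraic_int y" "of_nat p * y \<in> int_adjoin z" for y
  proof -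
    have "\<pi> ^ n * y \<in> int_adjoin z \<Longrightarrow> y \<in> int_adjoin z" for n
    proof (induction n)
      case (Suc n)
      have "algebraic_int (\<pi> ^ n * y)" using \<pi>(1) that(1) by auto
      moreover have "\<pi> * (\<pi> ^ n * y) \<in> int_adjoin z" using Suc.prems by (simp add: mult.assoc)
      ultimately have "\<pi> ^ n * y \<in> int_adjoin z" by (rule desc)
      thus ?case by (rule Suc.IH)
    qed simp
    moreover have "\<pi> ^ N * y \<in> int_adjoin z"
      using int_adjoin_mult[OF \<pi>(2) that(2)] by (simp add: \<pi>(3) mult_ac)
    ultimately show ?thesis .
  qed
  have "\<exists>D'. coprime D' p \<and> D' > 0 \<and> of_nat D' * x \<in> int_adjoin z"
    using D
  proof (induction D rule: less_induct)
    case (less D)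
    show ?case
    proof (cases "p dvd D")
      case False
      thus ?thesis using less.prems p by (metis prime_imp_coprime coprime_commute)
    next
      case True
      then obtain E where E: "D = p * E" by blast
      hence "E < D" "E > 0" using less.prems(1) prime_gt_1_nat[OF p] by (auto)
      moreover have "of_nat E * x \<in> int_adjoin z"
      proof (rule descp)
        show "algebraic_int (of_nat E * x)" using x by auto
        show "of_nat p * (of_nat E * x) \<in> int_adjoin z"
          using less.prems(2) by (simp add: E mult.assoc)
      qed
      ultimately show ?thesis by (rule less.IH)
    qed
  qed
  thus ?thesis using that by blast
qed

section \<open>Cyclotomic fields\<close>

lemma ipoly_prime_factor:
  assumes "g \<noteq> 0" "ipoly_at g z = 0"
  obtains f where "prime f" "f dvd g" "ipoly_at f z = 0"
proof -
  have "g \<noteq> 0 \<longrightarrow> ipoly_at g z = 0 \<longrightarrow> (\<exists>f. prime f \<and> f dvd g \<and> ipoly_at f z = 0)"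
  proof (induction g rule: prime_divisors_induct)
    case (unit u)
    then obtain v where v: "1 = u * v" by (rule dvdE)
    have "ipoly_at 1 z = ipoly_at (u * v) z" by (rule arg_cong[OF v])
    thus ?case by auto
  next
    case (factor p x)
    thus ?case by (auto intro: dvd_mult)
  qed simp
  thus ?thesis using assms that by blast
qed

text \<open>Pseudo-division of \<open>f\<close> by a polynomial \<open>h\<close> of least degree among those vanishing at \<open>z\<close> leaves no
  remainder; the prime \<open>f\<close> then divides \<open>h\<close> or the quotient, and the second would make \<open>h\<close> constant.\<close>

lemma prime_ipoly_minimal:
  assumes f: "prime f" "ipoly_at f z = 0" and g: "ipoly_at g z = 0" "g \<noteq> 0"
  shows "degree f \<le> degree g"
proof -
  define P where "P = (\<lambda>n. \<exists>g. g \<noteq> 0 \<and> ipoly_at g z = 0 \<and> degree g = n)"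
  have "P (degree g)" using g by (auto simp: P_def)
  hence "P (LEAST n. P n)" by (rule LeastI)
  then obtain h where h: "h \<noteq> 0" "ipoly_at h z = 0" "degree h = (LEAST n. P n)"
    by (auto simp: P_def)
  have least: "degree h \<le> degree r" if "r \<noteq> 0" "ipoly_at r z = 0" for r
    unfolding h(3) using that by (intro Least_le) (auto simp: P_def)
  obtain a q where a: "a \<noteq> 0" "Polynomial.smult a f = h * q + pseudo_mod f h"
    using pseudo_mod(1)[OF h(1), of f] by blast
  have "ipoly_at (Polynomial.smult a f) z = ipoly_at (h * q + pseudo_mod f h) z" by (simp only: a)
  hence "ipoly_at (pseudo_mod f h) z = 0" using f(2) h(2) by simp
  with pseudo_mod(2)[OF h(1), of f] least[of "pseudo_mod f h"] have "pseudo_mod f h = 0"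
    by linarith
  hence eq: "Polynomial.smult a f = h * q" using a by simp
  hence "f dvd h * q" by (metis dvd_refl dvd_smult)
  hence "f dvd h \<or> f dvd q" using f(1) by (simp add: prime_dvd_mult_iff)
  moreover have "h * q \<noteq> 0" using a(1) f(1) eq by (metis not_prime_0 smult_eq_0_iff)
  hence "q \<noteq> 0" by auto
  have "degree f = degree h + degree q"
    using arg_cong[OF eq, of degree] a(1) \<open>h \<noteq> 0\<close> \<open>q \<noteq> 0\<close> by (simp add: degree_mult_eq)
  moreover have "degree h \<noteq> 0"
  proof
    assume "degree h = 0"
    then obtain c where "h = [:c:]" by (rule degree_eq_zeroE)
    thus False using h by simp
  qed
  ultimately have "degree f \<le> degree h"
    using \<open>q \<noteq> 0\<close> h(1) by (auto dest: dvd_imp_degree_le)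
  also have "\<dots> \<le> degree g" using least g by blast
  finally show ?thesis .
qed

lemma prime_ipoly_root_transfer:
  assumes f: "prime f" "ipoly_at f z = 0" "ipoly_at f w = 0" and g: "ipoly_at g z = 0"
  shows "ipoly_at g w = 0"
proof -
  have f0: "f \<noteq> 0" using f(1) by auto
  obtain a q where a: "a \<noteq> 0" "Polynomial.smult a g = f * q + pseudo_mod g f"
    using pseudo_mod(1)[OF f0, of g] by blast
  have "ipoly_at (Polynomial.smult a g) z = ipoly_at (f * q + pseudo_mod g f) z" by (simp only: a)
  hence "ipoly_at (pseudo_mod g f) z = 0" using f(2) g by simp
  with pseudo_mod(2)[OF f0, of g] prime_ipoly_minimal[OF f(1,2), of "pseudo_mod g f"]
  have "pseudo_mod g f = 0" by linarith
  hence "ipoly_at (Polynomial.smult a g) w = ipoly_at (f * q) w" using a by simp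
  thus ?thesis using f(3) a(1) by simp
qed

lemma algebraic_int_root_of_unity:
  assumes "z ^ m = 1" "m > 0"
  shows "algebraic_int (z::complex)"
  by (rule algebraic_int_root[of 1 "monom 1 m"]) (use assms in \<open>auto simp: poly_monom degree_monom_eq\<close>)

text \<open>The irreducibility of cyclotomic polynomials in the form that is needed. Split \<open>x\<^sup>m - 1 = f h\<close> with
  \<open>f\<close> prime and \<open>f(z) = 0\<close>. By the Frobenius congruence \<open>f(z\<^sup>p)\<close> is divisible by \<open>p\<close>. If it were not zero,
  then \<open>h(z\<^sup>p) = 0\<close>, and differentiating shows that \<open>p\<close> divides \<open>m\<close> in the algebraic integers.\<close>

lemma root_of_unity_prime_conjugate:
  assumes z: "z ^ m = 1" and m: "m > 0" and p: "prime p" "\<not> p dvd m" and g: "ipoly_at g z = 0"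
  shows "ipoly_at g (z ^ p) = 0"
proof -
  define u where "u = (monom 1 m - 1 :: int poly)"
  have "coeff u m = 1" using m by (simp add: u_def)
  hence u0: "u \<noteq> 0" by auto
  have "ipoly_at u z = 0" using z by (simp add: u_def)
  then obtain f where f: "prime f" "f dvd u" "ipoly_at f z = 0"
    using ipoly_prime_factor[OF u0] by blast
  obtain h where h: "u = f * h" using f(2) by (rule dvdE)
  define w where "w = z ^ p"
  have w: "w ^ m = 1" by (simp add: w_def z flip: power_mult) (simp add: power_mult mult.commute[of p] z)
  have "ipoly_at f w = 0"
  proof (rule ccontr)
    assume nz: "ipoly_at f w \<noteq> 0"
    have "ipoly_at u w = 0" using w by (simp add: u_def)
    hence hw: "ipoly_at h w = 0" using nz by (simp add: h)
    have "pderiv u = f * pderiv h + h * pderiv f" by (simp add: h pderiv_mult)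
    hence "ipoly_at (pderiv u) w = ipoly_at f w * ipoly_at (pderiv h) w" using hw by simp
    moreover have "pderiv u = monom (of_nat m) (m - 1)"
      by (simp add: u_def pderiv_diff pderiv_monom)
    ultimately have "of_nat m * w ^ (m - 1) = ipoly_at f w * ipoly_at (pderiv h) w" by simp
    hence "of_nat m * (w ^ (m - 1) * w) = ipoly_at f w * ipoly_at (pderiv h) w * w" by simp
    moreover have "w ^ (m - 1) * w = 1" using w m by (metis Suc_diff_1 power_Suc2)
    ultimately have m_eq: "of_nat m = ipoly_at f w * ipoly_at (pderiv h) w * w"
      by (simp only: mult_1_right)
    obtain r where r: "r \<in> int_adjoin z" "0 = ipoly_at f w + of_nat p * r"
      using ipoly_at_frobenius[OF p(1), of z f 1] f(3) prime_gt_0_nat[OF p(1)]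
      by (auto simp: w_def zero_power)
    have zi: "algebraic_int z" using z m by (rule algebraic_int_root_of_unity)
    have wi: "algebraic_int w" using zi by (auto simp: w_def)
    have "algebraic_int (- r * ipoly_at (pderiv h) w * w)"
      using algebraic_int_int_adjoin[OF zi r(1)] algebraic_int_int_adjoin[OF wi int_adjoinI] wi
      by (auto intro!: algebraic_int_mult)
    moreover have "ipoly_at f w = of_nat p * (- r)" using r(2) by (simp add: add_eq_0_iff)
    hence "of_int (int m) / of_int (int p) = - r * ipoly_at (pderiv h) w * w"
      using m_eq prime_gt_0_nat[OF p(1)] by (simp add: field_simps)
    ultimately have "int p dvd int m"
      using algebraic_int_of_int_divide_iff[of "int p" "int m"] prime_gt_0_nat[OF p(1)] by simp
    thus False using p(2) by simp
  qed
  thus ?thesis using prime_ipoly_root_transfer[OF f(1,3)] g by (simp add: w_def)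
qed

theorem root_of_unity_conjugate:
  assumes "z ^ m = 1" "m > 0" "coprime a m" "ipoly_at g z = 0"
  shows "ipoly_at g (z ^ a) = 0"
  using assms(1,3,4)
proof (induction a arbitrary: z rule: prime_divisors_induct)
  case zero
  hence "m = 1" by simp
  thus ?case using zero by simp
next
  case (unit u)
  thus ?case by simp
next
  case (factor p a)
  have "coprime p m" "coprime a m" using factor.prems(2) by auto
  moreover have "\<not> p dvd m"
    using \<open>coprime p m\<close> factor.hyps(1) not_prime_unit[of p] by (auto simp: coprime_absorb_left)
  moreover have "(z ^ p) ^ m = 1" using factor.prems(1) by (metis mult.commute power_mult power_one)
  ultimately have "ipoly_at g ((z ^ p) ^ a) = 0"
    using factor root_of_unity_prime_conjugate[OF factor.prems(1) assms(2) \<open>prime p\<close>] by simp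
  thus ?case by (simp add: power_mult)
qed

subsection \<open>Elements of cyclotomic fields\<close>

definition root_unity :: "nat \<Rightarrow> complex" where "root_unity n = cis (2 * pi / real n)"

lemma root_unity_power: "root_unity n ^ k = cis (2 * pi * real k / real n)"
  by (simp add: root_unity_def Complex.DeMoivre mult.commute)

lemma root_unity_power_self: "n > 0 \<Longrightarrow> root_unity n ^ n = 1"
  by (simp add: root_unity_power)

lemma root_unity_mult_power: "n > 0 \<Longrightarrow> l > 0 \<Longrightarrow> root_unity (l * n) ^ l = root_unity n"
  by (simp add: root_unity_power) (simp add: root_unity_def)

lemma root_unity_prime_neq_1:
  assumes "n > 1"
  shows "root_unity n \<noteq> 1"
proof
  assume "root_unity n = 1"
  hence "cos (2 * pi / real n) = 1" by (simp add: root_unity_def complex_eq_iff)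
  then obtain k :: int where "2 * pi / real n = real_of_int k * 2 * pi"
    using cos_one_2pi_int by auto
  hence "1 = real_of_int k * real n" using assms by (simp add: field_simps)
  hence "1 = k * int n" by (metis of_int_1 of_int_eq_iff of_int_mult of_int_of_nat_eq)
  hence "int n dvd 1" by (metis dvd_triv_right)
  thus False using assms by simp
qed

text \<open>The constant term of a prime polynomial that vanishes at \<open>x \<noteq> 0\<close> is a nonzero multiple of \<open>x\<close>.\<close>

lemma int_adjoin_inverse:
  assumes "algebraic_int x" "x \<noteq> 0"
  obtains c s where "c > (0::nat)" "s \<in> int_adjoin x" "of_nat c * inverse x = s"
proof -
  have "\<exists>g. g \<noteq> 0 \<and> ipoly_at g x = 0"
  proof -
    obtain p where p: "poly (map_poly of_int p) x = 0" "lead_coeff p = (1::int)"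
      using assms by (auto simp: algebraic_int_altdef_ipoly)
    thus ?thesis by (intro exI[of _ p]) (auto simp: ipoly_at_def)
  qed
  then obtain g0 where "g0 \<noteq> 0" "ipoly_at g0 x = 0" by blast
  then obtain f where f: "prime f" "ipoly_at f x = 0" by (rule ipoly_prime_factor)
  obtain a h where ah: "f = pCons a h" by (cases f)
  have "a \<noteq> 0"
  proof
    assume "a = 0"
    hence h: "f = pCons 0 h" by (simp add: ah)
    hence "ipoly_at h x = 0" "h \<noteq> 0" using f assms(2) by auto
    hence "degree f \<le> degree h" using prime_ipoly_minimal[OF f] by blast
    thus False using h \<open>h \<noteq> 0\<close> by simp
  qed
  have "of_int a = - ipoly_at h x * x" using f(2) by (simp add: ah add_eq_0_iff mult.commute)
  hence "of_int a * inverse x = ipoly_at (- h) x" using assms(2) by (simp add: field_simps)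
  hence 1: "of_int (sgn a) * (of_int a * inverse x) = ipoly_at (Polynomial.smult (sgn a) (- h)) x" by simp
  have "of_int (sgn a) * (of_int a * inverse x) = of_nat (nat \<bar>a\<bar>) * inverse x"
  proof -
    have "of_int (sgn a) * of_int a = (of_int \<bar>a\<bar> :: complex)"
      by (simp add: abs_sgn mult.commute)
    also have "\<dots> = of_nat (nat \<bar>a\<bar>)" by simp
    finally show ?thesis by (simp add: mult.assoc[symmetric])
  qed
  with 1 have "of_nat (nat \<bar>a\<bar>) * inverse x = ipoly_at (Polynomial.smult (sgn a) (- h)) x"
    by (simp only:)
  thus ?thesis
    using that[OF _ int_adjoinI, of "nat \<bar>a\<bar>" "Polynomial.smult (sgn a) (- h)"] \<open>a \<noteq> 0\<close> by simp
qed

lemma CC_simps [simp]: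
  "carrier CC = UNIV" "x \<otimes>\<^bsub>CC\<^esub> y = x * y" "\<one>\<^bsub>CC\<^esub> = 1" "\<zero>\<^bsub>CC\<^esub> = 0" "x \<oplus>\<^bsub>CC\<^esub> y = x + y"
  by (simp_all add: ring_of_type_algebra_def)

lemma field_CC: "field CC" by (rule field_from_type_algebra)

lemma CC_a_inv [simp]: "\<ominus>\<^bsub>CC\<^esub> x = - x"
proof -
  interpret field CC by (rule field_CC)
  show ?thesis by (rule minus_equality) auto
qed

lemma CC_m_inv [simp]: "x \<noteq> 0 \<Longrightarrow> inv\<^bsub>CC\<^esub> x = inverse x"
proof -
  assume "x \<noteq> 0"
  interpret field CC by (rule field_CC)
  show ?thesis by (rule comm_inv_char) (use \<open>x \<noteq> 0\<close> in auto)
qed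

text \<open>Every element of a cyclotomic field has a multiple in \<open>\<int>[\<zeta>]\<close>; this turns statements about the field
  into statements about integer polynomials.\<close>

lemma cyclotomic_field_denominator:
  assumes n: "n > 0" and x: "x \<in> cyclotomic_field n"
  obtains D where "D > (0::nat)" "of_nat D * x \<in> int_adjoin (root_unity n)"
proof -
  define z where "z = root_unity n"
  have zi: "algebraic_int z"
    using algebraic_int_root_of_unity[OF root_unity_power_self[OF n] n] by (simp add: z_def)
  have "x \<in> generate_field CC {z}"
    using x by (simp add: cyclotomic_field_def z_def root_unity_def)
  hence "\<exists>D>0. of_nat D * x \<in> int_adjoin z"
  proof induction
    case one
    show ?case by (intro exI[of _ 1]) (use int_adjoin_of_int[of 1 z] in auto)
  next
    case (incl h)
    thus ?case by (intro exI[of _ 1]) (auto intro: int_adjoin_self)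
  next
    case (a_inv h)
    then obtain D where D: "D > 0" "of_nat D * h \<in> int_adjoin z" by blast
    have "0 - of_nat D * h \<in> int_adjoin z"
      using int_adjoin_of_int[of 0 z] by (intro int_adjoin_diff D) simp
    thus ?case using D(1) by (intro exI[of _ D]) simp
  next
    case (m_inv h)
    then obtain D where D: "D > 0" "of_nat D * h \<in> int_adjoin z" by blast
    have h: "h \<noteq> 0" using m_inv by simp
    obtain c s where c: "c > 0" "s \<in> int_adjoin (of_nat D * h)" "of_nat c * inverse (of_nat D * h) = s"
      using int_adjoin_inverse[of "of_nat D * h"] algebraic_int_int_adjoin[OF zi D(2)] D(1) h by auto
    have "of_nat c * inverse h = of_nat D * s"
      using c(3) D(1) h by (simp add: field_simps)
    also have "\<dots> \<in> int_adjoin z"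
      using int_adjoin_subset[OF D(2)] c(2) by (intro int_adjoin_mult int_adjoin_of_nat) auto
    finally show ?case using c(1) h by auto
  next
    case (eng_add x y)
    then obtain D E where D: "D > 0" "of_nat D * x \<in> int_adjoin z" "E > 0" "of_nat E * y \<in> int_adjoin z"
      by blast
    have "of_nat E * (of_nat D * x) + of_nat D * (of_nat E * y) \<in> int_adjoin z"
      by (rule int_adjoin_add[OF int_adjoin_mult[OF int_adjoin_of_nat D(2)]
            int_adjoin_mult[OF int_adjoin_of_nat D(4)]])
    thus ?case using D by (intro exI[of _ "D * E"]) (auto simp: algebra_simps)
  next
    case (eng_mult x y)
    then obtain D E where D: "D > 0" "of_nat D * x \<in> int_adjoin z" "E > 0" "of_nat E * y \<in> int_adjoin z"
      by blast
    have "(of_nat D * x) * (of_nat E * y) \<in> int_adjoin z"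
      by (rule int_adjoin_mult[OF D(2,4)])
    thus ?case using D by (intro exI[of _ "D * E"]) (auto simp: algebra_simps)
  qed
  thus ?thesis using that by (auto simp: z_def)
qed

lemma cyclotomic_fieldI:
  assumes D: "D > (0::nat)" "of_nat D * x \<in> int_adjoin (root_unity n)"
  shows "x \<in> cyclotomic_field n"
proof -
  define z where "z = root_unity n"
  interpret field CC by (rule field_CC)
  define K where "K = generate_field CC {z}"
  have add: "a + b \<in> K" if "a \<in> K" "b \<in> K" for a b
    using generate_field.eng_add[of a CC "{z}" b] that by (simp add: K_def)
  have mult: "a * b \<in> K" if "a \<in> K" "b \<in> K" for a b
    using generate_field.eng_mult[of a CC "{z}" b] that by (simp add: K_def)
  have one: "1 \<in> K" using generate_field.one[of CC "{z}"] by (simp add: K_def)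
  have uminus: "- a \<in> K" if "a \<in> K" for a
    using generate_field.a_inv[of a CC "{z}"] that by (simp add: K_def)
  have inverse: "inverse a \<in> K" if "a \<in> K" "a \<noteq> 0" for a
    using generate_field.m_inv[of a CC "{z}"] that by (simp add: K_def)
  have z: "z \<in> K" unfolding K_def by (rule generate_field.incl) simp
  have zero: "0 \<in> K" using add[OF one uminus[OF one]] by simp
  have nat: "of_nat k \<in> K" for k by (induction k) (auto intro: add one zero)
  have int: "of_int k \<in> K" for k
    using nat uminus[OF nat] by (cases k rule: int_cases2) auto
  have ip: "ipoly_at g z \<in> K" for g
    by (induction g) (auto intro: add mult z int zero)
  have "of_nat D * x \<in> K" using D(2) ip by (auto simp: int_adjoin_def z_def)
  hence "inverse (of_nat D) * (of_nat D * x) \<in> K"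
    using D(1) by (intro mult[OF inverse[OF nat]]) simp_all
  moreover have "inverse (of_nat D) * (of_nat D * x) = x" using D(1) by (simp add: field_simps)
  ultimately have "x \<in> K" by (simp only:)
  thus ?thesis by (simp add: K_def z_def root_unity_def cyclotomic_field_def)
qed

section \<open>Cyclic cubic fields\<close>

text \<open>Outside \<open>F\<close> the values of \<open>\<sigma>\<close> are arbitrary, so every computation with \<open>\<sigma>\<close> has to stay in \<open>F\<close>.\<close>

locale cyclic_cubic =
  fixes F :: "complex set" and \<sigma> :: "complex \<Rightarrow> complex"
  assumes Rats_F: "x \<in> \<rat> \<Longrightarrow> x \<in> F"
    and add_F [simp]: "x \<in> F \<Longrightarrow> y \<in> F \<Longrightarrow> x + y \<in> F"
    and mult_F [simp]: "x \<in> F \<Longrightarrow> y \<in> F \<Longrightarrow> x * y \<in> F"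
    and inverse_F [simp]: "x \<in> F \<Longrightarrow> inverse x \<in> F"
    and \<sigma>_F [simp]: "x \<in> F \<Longrightarrow> \<sigma> x \<in> F"
    and \<sigma>_add [simp]: "x \<in> F \<Longrightarrow> y \<in> F \<Longrightarrow> \<sigma> (x + y) = \<sigma> x + \<sigma> y"
    and \<sigma>_mult [simp]: "x \<in> F \<Longrightarrow> y \<in> F \<Longrightarrow> \<sigma> (x * y) = \<sigma> x * \<sigma> y"
    and \<sigma>3 [simp]: "x \<in> F \<Longrightarrow> \<sigma> (\<sigma> (\<sigma> x)) = x"
    and fixed_iff: "x \<in> F \<Longrightarrow> \<sigma> x = x \<longleftrightarrow> x \<in> \<rat>"
    and nontrivial: "\<exists>x\<in>F. \<sigma> x \<noteq> x"
begin

lemma \<sigma>_Rats [simp]: "x \<in> \<rat> \<Longrightarrow> \<sigma> x = x"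
  using fixed_iff Rats_F by blast

lemma number_F [simp]:
  "0 \<in> F" "1 \<in> F" "of_int k \<in> F" "of_nat n \<in> F" "numeral w \<in> F" "of_rat r \<in> F"
  by (auto intro!: Rats_F)

lemma \<sigma>_number [simp]:
  "\<sigma> 0 = 0" "\<sigma> 1 = 1" "\<sigma> (of_int k) = of_int k" "\<sigma> (of_nat n) = of_nat n"
  "\<sigma> (numeral w) = numeral w" "\<sigma> (of_rat r) = of_rat r"
  by (auto intro!: \<sigma>_Rats)

lemma uminus_F [simp]: "x \<in> F \<Longrightarrow> - x \<in> F"
  using mult_F[of "-1" x] Rats_F[of "-1"] by simp

lemma diff_F [simp]: "x \<in> F \<Longrightarrow> y \<in> F \<Longrightarrow> x - y \<in> F"
  using add_F[of x "- y"] by simp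

lemma divide_F [simp]: "x \<in> F \<Longrightarrow> y \<in> F \<Longrightarrow> x / y \<in> F"
  by (simp add: divide_inverse)

lemma power_F [simp]: "x \<in> F \<Longrightarrow> x ^ n \<in> F"
  by (induction n) auto

lemma \<sigma>_uminus [simp]: "x \<in> F \<Longrightarrow> \<sigma> (- x) = - \<sigma> x"
  using \<sigma>_mult[of "-1" x] Rats_F[of "-1"] by simp

lemma \<sigma>_diff [simp]: "x \<in> F \<Longrightarrow> y \<in> F \<Longrightarrow> \<sigma> (x - y) = \<sigma> x - \<sigma> y"
  using \<sigma>_add[of x "- y"] by simp

lemma \<sigma>_power [simp]: "x \<in> F \<Longrightarrow> \<sigma> (x ^ n) = \<sigma> x ^ n"
  by (induction n) auto

lemma \<sigma>_inj: "x \<in> F \<Longrightarrow> y \<in> F \<Longrightarrow> \<sigma> x = \<sigma> y \<Longrightarrow> x = y"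
  using \<sigma>3 by metis

lemma \<sigma>_inverse [simp]: "x \<in> F \<Longrightarrow> \<sigma> (inverse x) = inverse (\<sigma> x)"
proof (cases "x = 0")
  case False
  assume x: "x \<in> F"
  have "\<sigma> (inverse x) * \<sigma> x = 1"
    using x False by (simp flip: \<sigma>_mult)
  thus ?thesis by (metis inverse_unique mult.commute)
qed simp

lemma \<sigma>_divide [simp]: "x \<in> F \<Longrightarrow> y \<in> F \<Longrightarrow> \<sigma> (x / y) = \<sigma> x / \<sigma> y"
  by (simp add: divide_inverse)

lemma funpow_F [simp]: "x \<in> F \<Longrightarrow> (\<sigma> ^^ n) x \<in> F"
  by (induction n) auto

lemma funpow_mod_3: "x \<in> F \<Longrightarrow> (\<sigma> ^^ n) x = (\<sigma> ^^ (n mod 3)) x"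
proof (induction n rule: less_induct)
  case (less n)
  show ?case
  proof (cases "n < 3")
    case False
    then obtain k where k: "n = k + 3" by (metis add.commute le_add_diff_inverse not_less)
    have "(\<sigma> ^^ n) x = (\<sigma> ^^ k) ((\<sigma> ^^ 3) x)" by (simp add: k funpow_add)
    also have "(\<sigma> ^^ 3) x = x" using less.prems by (simp add: numeral_3_eq_3)
    finally show ?thesis using less.IH[of k] less.prems k by simp
  qed simp
qed

lemma funpow_eq_id_iff: "(\<forall>x\<in>F. (\<sigma> ^^ n) x = x) \<longleftrightarrow> 3 dvd n"
proof
  assume id: "\<forall>x\<in>F. (\<sigma> ^^ n) x = x"
  obtain y where y: "y \<in> F" "\<sigma> y \<noteq> y" using nontrivial by blast
  have "(\<sigma> ^^ (n mod 3)) y = y" using id y(1) funpow_mod_3 by metis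
  moreover have "\<sigma> (\<sigma> y) \<noteq> y" using y \<sigma>3 by metis
  moreover have "n mod 3 = 0 \<or> n mod 3 = 1 \<or> n mod 3 = 2" by presburger
  ultimately show "3 dvd n" using y(2) by (auto simp: numeral_2_eq_2)
next
  assume "3 dvd n"
  thus "\<forall>x\<in>F. (\<sigma> ^^ n) x = x" using funpow_mod_3[of _ n] by auto
qed

subsection \<open>Symmetric functions of conjugates\<close>

definition tr :: "complex \<Rightarrow> complex" where "tr x = x + \<sigma> x + \<sigma> (\<sigma> x)"
definition sy :: "complex \<Rightarrow> complex" where "sy x = x * \<sigma> x + \<sigma> x * \<sigma> (\<sigma> x) + \<sigma> (\<sigma> x) * x"
definition nm :: "complex \<Rightarrow> complex" where "nm x = x * \<sigma> x * \<sigma> (\<sigma> x)"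

lemma symmetric_Rats:
  assumes "x \<in> F"
  shows "tr x \<in> \<rat>" "sy x \<in> \<rat>" "nm x \<in> \<rat>"
proof -
  have F: "tr x \<in> F" "sy x \<in> F" "nm x \<in> F"
    using assms by (simp_all add: tr_def sy_def nm_def)
  have "\<sigma> (tr x) = tr x" "\<sigma> (sy x) = sy x" "\<sigma> (nm x) = nm x"
    using assms by (simp_all add: tr_def sy_def nm_def)
  thus "tr x \<in> \<rat>" "sy x \<in> \<rat>" "nm x \<in> \<rat>"
    using F fixed_iff by blast+
qed

lemma cubic_factored: "(t - x) * (t - \<sigma> x) * (t - \<sigma> (\<sigma> x)) = t ^ 3 - tr x * t\<^sup>2 + sy x * t - nm x"
  by (simp add: tr_def sy_def nm_def power2_eq_square power3_eq_cube algebra_simps)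

lemma cubic_root: "x ^ 3 - tr x * x\<^sup>2 + sy x * x - nm x = 0"
  using cubic_factored[of x x] by simp

text \<open>Each value \<open>h x\<close> is a root of the cubic polynomial of \<open>x\<close> and therefore a conjugate of \<open>x\<close>. That the same
  conjugation serves all \<open>x\<close> follows by comparing \<open>x + a y\<close> and \<open>x + b y\<close> for a fixed irrational \<open>y\<close>: among four
  multiples of \<open>y\<close> two must use the same one of the three conjugations.\<close>

lemma embedding_is_conjugate:
  assumes add: "\<And>x y. x \<in> F \<Longrightarrow> y \<in> F \<Longrightarrow> h (x + y) = h x + h y"
    and mult: "\<And>x y. x \<in> F \<Longrightarrow> y \<in> F \<Longrightarrow> h (x * y) = h x * h y"
    and rat: "\<And>x. x \<in> \<rat> \<Longrightarrow> h x = x"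
  shows "\<exists>i<3. \<forall>x\<in>F. h x = (\<sigma> ^^ i) x"
proof -
  have conj: "\<exists>i<3. h x = (\<sigma> ^^ i) x" if x: "x \<in> F" for x
  proof -
    have "x * (x * x + sy x) = tr x * (x * x) + nm x"
      using cubic_root[of x] by (simp add: power2_eq_square power3_eq_cube algebra_simps)
    hence "h (x * (x * x + sy x)) = h (tr x * (x * x) + nm x)" by simp
    hence "h x * (h x * h x + sy x) = tr x * (h x * h x) + nm x"
      using x symmetric_Rats[OF x] by (simp add: add mult rat Rats_F)
    hence "(h x - x) * (h x - \<sigma> x) * (h x - \<sigma> (\<sigma> x)) = 0"
      unfolding cubic_factored by (simp add: power2_eq_square power3_eq_cube algebra_simps)
    hence "h x = (\<sigma> ^^ 0) x \<or> h x = (\<sigma> ^^ 1) x \<or> h x = (\<sigma> ^^ 2) x"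
      by (simp add: numeral_2_eq_2)
    thus ?thesis by (elim disjE) (rule exI, rule conjI[rotated], assumption, simp)+
  qed
  obtain y where y: "y \<in> F" "\<sigma> y \<noteq> y" using nontrivial by blast
  have "\<sigma> (\<sigma> y) \<noteq> y" "\<sigma> (\<sigma> y) \<noteq> \<sigma> y" using y \<sigma>3 \<sigma>_inj by (metis, metis \<sigma>_F)
  hence inj: "i = j" if "i < 3" "j < 3" "(\<sigma> ^^ i) y = (\<sigma> ^^ j) y" for i j
  proof -
    have "i = 0 \<or> i = 1 \<or> i = 2" "j = 0 \<or> j = 1 \<or> j = 2" using that by auto
    thus ?thesis using that(3) y(2) \<open>\<sigma> (\<sigma> y) \<noteq> y\<close> \<open>\<sigma> (\<sigma> y) \<noteq> \<sigma> y\<close>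
      by (auto simp: numeral_2_eq_2)
  qed
  have pow_add: "(\<sigma> ^^ i) (a + b) = (\<sigma> ^^ i) a + (\<sigma> ^^ i) b" if "a \<in> F" "b \<in> F" for i a b
    using that by (induction i) auto
  have pow_scale: "(\<sigma> ^^ i) (of_nat n * a) = of_nat n * (\<sigma> ^^ i) a" if "a \<in> F" for i n a
    using that by (induction i) auto
  obtain i where i: "i < 3" "h y = (\<sigma> ^^ i) y" using conj[OF y(1)] by blast
  have "h x = (\<sigma> ^^ i) x" if x: "x \<in> F" for x
  proof -
    have "\<forall>n. \<exists>j<3. h (x + of_nat n * y) = (\<sigma> ^^ j) (x + of_nat n * y)"
      using conj x y(1) by simp
    then obtain j where j: "\<And>n. j n < (3::nat)"
      "\<And>n. h (x + of_nat n * y) = (\<sigma> ^^ j n) (x + of_nat n * y)" by metis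
    have "\<not> inj_on j {..<4::nat}"
    proof
      assume "inj_on j {..<4::nat}"
      hence "card {..<4::nat} \<le> card {..<3::nat}"
        using j(1) by (intro card_inj_on_le) auto
      thus False by simp
    qed
    then obtain a b where ab: "a \<noteq> b" "j a = j b" by (auto simp: inj_on_def)
    have eq: "h x + of_nat n * h y = (\<sigma> ^^ j n) x + of_nat n * (\<sigma> ^^ j n) y" for n
      using j(2)[of n] x y(1) by (simp add: add mult rat pow_add pow_scale)
    have "(of_nat a - of_nat b) * (h y - (\<sigma> ^^ j a) y) = (h x + of_nat a * h y)
       - (h x + of_nat b * h y) - (((\<sigma> ^^ j a) x + of_nat a * (\<sigma> ^^ j a) y)
         - ((\<sigma> ^^ j a) x + of_nat b * (\<sigma> ^^ j a) y))"
      by (simp add: algebra_simps)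
    also have "\<dots> = 0" unfolding eq ab(2) by simp
    finally have "(of_nat a - of_nat b) * (h y - (\<sigma> ^^ j a) y) = 0" .
    hence hy: "h y = (\<sigma> ^^ j a) y" using ab(1) by simp
    hence "h x = (\<sigma> ^^ j a) x" using eq[of a] by simp
    moreover have "j a = i" using hy i j(1) inj by metis
    ultimately show ?thesis by simp
  qed
  thus ?thesis using i(1) by blast
qed

lemma cnj_Rats: "r \<in> \<rat> \<Longrightarrow> cnj r = r"
  by (erule Rats_cases') simp

text \<open>Complex conjugation is a power of \<open>\<sigma>\<close> whose square is the identity, and \<open>\<sigma>\<close> has order 3.\<close>

lemma F_real: "x \<in> F \<Longrightarrow> x \<in> \<real>"
proof -
  assume x: "x \<in> F"
  obtain i where i: "i < 3" "\<And>x. x \<in> F \<Longrightarrow> cnj x = (\<sigma> ^^ i) x"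
    using embedding_is_conjugate[of cnj] cnj_Rats by auto
  have "\<forall>x\<in>F. (\<sigma> ^^ (i + i)) x = x"
    using i(2) by (metis complex_cnj_cnj funpow_F funpow_add o_apply)
  hence "3 dvd i + i" using funpow_eq_id_iff by blast
  hence "i = 0" using i(1) by presburger
  thus ?thesis using i(2)[OF x] by (simp add: Reals_cnj_iff)
qed

lemma of_real_Re [simp]: "x \<in> F \<Longrightarrow> of_real (Re x) = x"
  using F_real by simp

subsection \<open>Integers of the field\<close>

definition \<O> :: "complex set" where "\<O> = {x \<in> F. algebraic_int x}"

lemma \<O>_F: "x \<in> \<O> \<Longrightarrow> x \<in> F" and \<O>_int: "x \<in> \<O> \<Longrightarrow> algebraic_int x"
  by (auto simp: \<O>_def)

lemma \<O>_closed [simp]: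
  "x \<in> \<O> \<Longrightarrow> y \<in> \<O> \<Longrightarrow> x + y \<in> \<O>" "x \<in> \<O> \<Longrightarrow> y \<in> \<O> \<Longrightarrow> x * y \<in> \<O>"
  "x \<in> \<O> \<Longrightarrow> y \<in> \<O> \<Longrightarrow> x - y \<in> \<O>" "x \<in> \<O> \<Longrightarrow> - x \<in> \<O>" "x \<in> \<O> \<Longrightarrow> x ^ n \<in> \<O>"
  "of_int k \<in> \<O>" "of_nat m \<in> \<O>" "0 \<in> \<O>" "1 \<in> \<O>" "numeral w \<in> \<O>"
  by (simp_all add: \<O>_def algebraic_int_add algebraic_int_mult algebraic_int_diff algebraic_int_power)

lemma \<sigma>_ipoly: "x \<in> F \<Longrightarrow> \<sigma> (ipoly_at g x) = ipoly_at g (\<sigma> x) \<and> ipoly_at g x \<in> F"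
  by (induction g) auto

lemma \<sigma>_\<O> [simp]: "x \<in> \<O> \<Longrightarrow> \<sigma> x \<in> \<O>"
proof -
  assume x: "x \<in> \<O>"
  then obtain p where p: "ipoly_at p x = 0" "lead_coeff p = (1::int)"
    using \<O>_int[OF x] by (auto simp: algebraic_int_altdef_ipoly ipoly_at_def)
  have "ipoly_at p (\<sigma> x) = 0" using \<sigma>_ipoly[OF \<O>_F[OF x], of p] p(1) by simp
  hence "algebraic_int (\<sigma> x)" using p(2) unfolding algebraic_int_altdef_ipoly ipoly_at_def by blast
  thus "\<sigma> x \<in> \<O>" using x by (simp add: \<O>_def)
qed

lemma symmetric_Ints:
  assumes "x \<in> \<O>"
  shows "tr x \<in> \<int>" "sy x \<in> \<int>" "nm x \<in> \<int>"
proof -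
  have "tr x \<in> \<O>" "sy x \<in> \<O>" "nm x \<in> \<O>"
    using assms by (simp_all add: tr_def sy_def nm_def)
  thus "tr x \<in> \<int>" "sy x \<in> \<int>" "nm x \<in> \<int>"
    using symmetric_Rats[OF \<O>_F[OF assms]] by (simp_all add: rational_algebraic_int_is_int \<O>_int)
qed

text \<open>Integer-valued versions of the symmetric functions. They are meaningful on \<open>\<O>\<close> only, where the real part
  is already an integer.\<close>

definition Tr :: "complex \<Rightarrow> int" where "Tr x = \<lfloor>Re (tr x)\<rfloor>"
definition Sy :: "complex \<Rightarrow> int" where "Sy x = \<lfloor>Re (sy x)\<rfloor>"
definition Nm :: "complex \<Rightarrow> int" where "Nm x = \<lfloor>Re (nm x)\<rfloor>"

lemma of_int_symmetric:
  assumes "x \<in> \<O>"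
  shows "of_int (Tr x) = tr x" "of_int (Sy x) = sy x" "of_int (Nm x) = nm x"
  using symmetric_Ints[OF assms] by (auto simp: Tr_def Sy_def Nm_def elim!: Ints_cases)

lemma \<O>_I:
  assumes "x \<in> F" "tr x = of_int a" "sy x = of_int b" "nm x = of_int c"
  shows "x \<in> \<O>"
  using cubic_root[of x] assms algebraic_int_cubic[of x a b c] by (simp add: \<O>_def)

lemma symmetric_scale:
  assumes "x \<in> F" "r \<in> \<rat>"
  shows "tr (r * x) = r * tr x" "sy (r * x) = r\<^sup>2 * sy x" "nm (r * x) = r ^ 3 * nm x"
  using assms Rats_F[of r]
  by (simp_all add: tr_def sy_def nm_def power2_eq_square power3_eq_cube algebra_simps)

lemma symmetric_square:
  assumes "x \<in> F"
  shows "tr (x\<^sup>2) = (tr x)\<^sup>2 - 2 * sy x" "sy (x\<^sup>2) = (sy x)\<^sup>2 - 2 * tr x * nm x" "nm (x\<^sup>2) = (nm x)\<^sup>2"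
  using assms by (simp_all add: tr_def sy_def nm_def power2_eq_square algebra_simps)

lemma tr_add: "x \<in> F \<Longrightarrow> y \<in> F \<Longrightarrow> tr (x + y) = tr x + tr y"
  and tr_diff: "x \<in> F \<Longrightarrow> y \<in> F \<Longrightarrow> tr (x - y) = tr x - tr y"
  and tr_\<sigma>: "x \<in> F \<Longrightarrow> tr (\<sigma> x) = tr x"
  by (simp_all add: tr_def)

lemma tr_rat: "r \<in> \<rat> \<Longrightarrow> tr r = 3 * r"
  by (simp add: tr_def)

lemma Rats_denominator:
  assumes "(r::complex) \<in> \<rat>"
  obtains d where "d > (0::nat)" "of_nat d * r \<in> \<int>"
proof -
  obtain a b where "b > 0" "r = of_int a / of_int b" using assms by (rule Rats_cases') 
  hence "of_nat (nat b) * r = of_int a" by simp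
  thus ?thesis using that[of "nat b"] \<open>b > 0\<close> by simp
qed

lemma integral_multiple:
  assumes "x \<in> F"
  obtains D where "D > (0::nat)" "of_nat D * x \<in> \<O>"
proof -
  obtain a b c where abc: "a > (0::nat)" "of_nat a * tr x \<in> \<int>" "b > (0::nat)" "of_nat b * sy x \<in> \<int>"
    "c > (0::nat)" "of_nat c * nm x \<in> \<int>"
    using symmetric_Rats[OF assms] by (metis Rats_denominator)
  define D :: complex where "D = of_nat (a * b * c)"
  have "tr (D * x) = (of_nat b * of_nat c) * (of_nat a * tr x)"
       "sy (D * x) = (of_nat a * of_nat c * D) * (of_nat b * sy x)"
       "nm (D * x) = (of_nat a * of_nat b * D * D) * (of_nat c * nm x)"
    using assms by (simp_all add: D_def symmetric_scale power2_eq_square power3_eq_cube)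
  hence "tr (D * x) \<in> \<int>" "sy (D * x) \<in> \<int>" "nm (D * x) \<in> \<int>"
    using abc by (auto simp: D_def intro!: Ints_mult simp del: of_nat_mult)
  hence "D * x \<in> \<O>" using assms \<O>_I[of "D * x"] by (auto simp: D_def elim!: Ints_cases)
  thus ?thesis using that[of "a * b * c"] abc by (simp add: D_def)
qed

subsection \<open>The lattice of integers of trace zero\<close>

definition L :: "complex set" where "L = {x \<in> \<O>. tr x = 0}"

lemma L_\<O>: "x \<in> L \<Longrightarrow> x \<in> \<O>" and L_F: "x \<in> L \<Longrightarrow> x \<in> F" and L_tr: "x \<in> L \<Longrightarrow> tr x = 0"
  by (auto simp: L_def \<O>_def)

lemma L_closed [simp]:
  "x \<in> L \<Longrightarrow> y \<in> L \<Longrightarrow> x + y \<in> L" "x \<in> L \<Longrightarrow> y \<in> L \<Longrightarrow> x - y \<in> L" "x \<in> L \<Longrightarrow> \<sigma> x \<in> L"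
  "x \<in> L \<Longrightarrow> of_int k * x \<in> L"
  by (simp_all add: L_def tr_add tr_diff tr_\<sigma> symmetric_scale \<O>_F)

lemma diff_conj_L: "x \<in> \<O> \<Longrightarrow> x - \<sigma> x \<in> L"
  by (simp add: L_def tr_diff tr_\<sigma> \<O>_F)

lemma traceless_\<sigma>2: "tr x = 0 \<Longrightarrow> \<sigma> (\<sigma> x) = - x - \<sigma> x"
  by (simp add: tr_def add_eq_0_iff algebra_simps)

lemma traceless_sy: "tr x = 0 \<Longrightarrow> sy x = - (x\<^sup>2 + x * \<sigma> x + (\<sigma> x)\<^sup>2)"
  by (simp add: sy_def traceless_\<sigma>2 power2_eq_square algebra_simps)

lemma traceless_sy_comb:
  assumes "x \<in> F" "tr x = 0" "r \<in> \<rat>" "s \<in> \<rat>"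
  shows "sy (r * x + s * \<sigma> x) = (r\<^sup>2 - r * s + s\<^sup>2) * sy x" "tr (r * x + s * \<sigma> x) = 0"
proof -
  have F: "r \<in> F" "s \<in> F" using assms by (auto intro: Rats_F)
  show t: "tr (r * x + s * \<sigma> x) = 0"
    using assms F by (simp add: tr_add symmetric_scale tr_\<sigma>)
  show "sy (r * x + s * \<sigma> x) = (r\<^sup>2 - r * s + s\<^sup>2) * sy x"
  proof -
    define a where "a = \<sigma> x"
    have a: "a \<in> F" "\<sigma> x = a" "\<sigma> a = - x - a"
      using assms traceless_\<sigma>2 by (simp_all add: a_def)
    have c: "\<sigma> (r * x + s * \<sigma> x) = r * a + s * (- x - a)"
      using assms F a by simp
    show ?thesis
      unfolding traceless_sy[OF t] c
      unfolding traceless_sy[OF assms(2)] a(2)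
      by (simp add: power2_eq_square algebra_simps)
  qed
qed

text \<open>On trace zero elements \<open>- 2 sy\<close> is the squared Euclidean length.\<close>

lemma sy_neg:
  assumes "x \<in> F" "tr x = 0" "x \<noteq> 0"
  shows "Re (sy x) < 0"
proof -
  define a b where "a = Re x" and "b = Re (\<sigma> x)"
  have ab: "x = of_real a" "\<sigma> x = of_real b" using assms(1) by (simp_all add: a_def b_def)
  have "sy x = of_real (- (a\<^sup>2 + a * b + b\<^sup>2))"
    unfolding traceless_sy[OF assms(2)] ab(2) by (subst (1 2) ab(1)) simp
  hence "Re (sy x) = - (a\<^sup>2 + a * b + b\<^sup>2)" by simp
  moreover have "a \<noteq> 0" using ab assms(3) by auto
  hence "a\<^sup>2 > 0" by simp
  moreover have "a\<^sup>2 + a * b + b\<^sup>2 = (3/4) * a\<^sup>2 + (a / 2 + b)\<^sup>2"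
    by (simp add: power2_eq_square algebra_simps)
  ultimately show ?thesis using zero_le_power2[of "a / 2 + b"] by linarith
qed

text \<open>Cramer's rule: the coefficients are invariant under \<open>\<sigma>\<close> and hence rational. The determinant is \<open>sy x\<close>
  up to sign.\<close>

lemma traceless_span:
  assumes x: "x \<in> F" "tr x = 0" "x \<noteq> 0" and y: "y \<in> F" "tr y = 0"
  obtains r s where "r \<in> \<rat>" "s \<in> \<rat>" "y = r * x + s * \<sigma> x"
proof -
  define a b where "a = \<sigma> x" and "b = \<sigma> y"
  have F: "a \<in> F" "b \<in> F" using x y by (simp_all add: a_def b_def)
  have s2: "\<sigma> x = a" "\<sigma> y = b" "\<sigma> a = - x - a" "\<sigma> b = - y - b"
    using traceless_\<sigma>2 x y by (simp_all add: a_def b_def)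
  define d where "d = sy x"
  have d: "d = - (x\<^sup>2 + x * a + a\<^sup>2)" using x by (simp add: d_def traceless_sy s2)
  have "d \<noteq> 0" using sy_neg[OF x] by (auto simp: d_def)
  have dR: "d \<in> \<rat>" using symmetric_Rats[OF x(1)] by (simp add: d_def)
  define r where "r = (- y * (x + a) - b * a) / d"
  define s where "s = (x * b - a * y) / d"
  have dF: "d \<in> F" "\<sigma> d = d" using dR Rats_F by auto
  have "\<sigma> r = (- b * (a + (- x - a)) - (- y - b) * (- x - a)) / d" "\<sigma> s = (a * (- y - b) - (- x - a) * b) / d"
    using x y F dF by (simp_all add: r_def s_def s2)
  hence "\<sigma> r = r" "\<sigma> s = s"
    by (simp_all add: r_def s_def algebra_simps)
  hence "r \<in> \<rat>" "s \<in> \<rat>"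
    using fixed_iff[of r] fixed_iff[of s] x y F dF by (simp_all add: r_def s_def)
  moreover have "r * x + s * a = y * d / d"
    by (simp add: r_def s_def d power2_eq_square algebra_simps flip: add_divide_distrib diff_divide_distrib)
  hence "y = r * x + s * \<sigma> x" using \<open>d \<noteq> 0\<close> by (simp add: s2)
  ultimately show ?thesis by (rule that)
qed

text \<open>Division with remainder in the Eisenstein integers: rounding both coordinates leaves a remainder
  \<open>u l + v \<sigma> l\<close> with \<open>|u|, |v| \<le> 1/2\<close>, and then \<open>u\<^sup>2 - u v + v\<^sup>2 < 1\<close> makes it shorter than \<open>l\<close>.\<close>

lemma minimal_trace_zero_generates:
  assumes l: "l \<in> L" "l \<noteq> 0" and min: "\<And>x. x \<in> L \<Longrightarrow> x \<noteq> 0 \<Longrightarrow> - Sy l \<le> - Sy x" and y: "y \<in> L"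
  obtains i j :: int where "y = of_int i * l + of_int j * \<sigma> l"
proof -
  obtain r s where rs: "r \<in> \<rat>" "s \<in> \<rat>" "y = r * l + s * \<sigma> l"
    using traceless_span[OF L_F[OF l(1)] L_tr[OF l(1)] l(2) L_F[OF y] L_tr[OF y]] by blast
  define i j where "i = round (Re r)" and "j = round (Re s)"
  define u v where "u = Re r - of_int i" and "v = Re s - of_int j"
  have uv: "\<bar>u\<bar> \<le> 1 / 2" "\<bar>v\<bar> \<le> 1 / 2"
    using of_int_round_abs_le[of "Re r"] of_int_round_abs_le[of "Re s"]
    by (simp_all add: u_def v_def i_def j_def abs_minus_commute)
  have ruv: "r - of_int i = of_real u" "s - of_int j = of_real v"
    using of_real_Re[OF Rats_F[OF rs(1)]] of_real_Re[OF Rats_F[OF rs(2)]]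
    by (simp_all add: u_def v_def)
  define z where "z = y - (of_int i * l + of_int j * \<sigma> l)"
  have zL: "z \<in> L" using y l by (simp add: z_def)
  have z: "z = (r - of_int i) * l + (s - of_int j) * \<sigma> l"
    by (simp add: z_def rs(3) algebra_simps)
  have "sy z = ((r - of_int i)\<^sup>2 - (r - of_int i) * (s - of_int j) + (s - of_int j)\<^sup>2) * sy l"
    unfolding z using rs by (intro traceless_sy_comb L_F L_tr l) simp_all
  hence "sy z = of_real (u\<^sup>2 - u * v + v\<^sup>2) * of_int (Sy l)"
    using l by (simp add: ruv of_int_symmetric L_\<O>)
  hence "of_real (of_int (Sy z)) = (of_real ((u\<^sup>2 - u * v + v\<^sup>2) * of_int (Sy l)) :: complex)"
    using zL by (simp add: of_int_symmetric L_\<O>)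
  hence sz: "of_int (Sy z) = (u\<^sup>2 - u * v + v\<^sup>2) * of_int (Sy l)" by (simp only: of_real_eq_iff)
  have "of_int (Sy l) = Re (sy l)" using l of_int_symmetric(2)[of l] by (metis Re_complex_of_real L_\<O> of_real_of_int_eq)
  hence neg: "of_int (Sy l) < (0::real)" using sy_neg[OF L_F L_tr, OF l(1) l(1) l(2)] by simp
  have "u\<^sup>2 \<le> 1/4" "v\<^sup>2 \<le> 1/4" "\<bar>u * v\<bar> \<le> 1/4"
    using power_mono[OF uv(1) abs_ge_zero, of 2] power_mono[OF uv(2) abs_ge_zero, of 2]
      mult_mono[OF uv(1) uv(2)] by (simp_all add: power2_eq_square abs_mult)
  hence "u\<^sup>2 - u * v + v\<^sup>2 < 1" by linarith
  hence "(u\<^sup>2 - u * v + v\<^sup>2) * (- of_int (Sy l)) < 1 * (- of_int (Sy l))"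
    using neg by (intro mult_strict_right_mono) auto
  hence "- (of_int (Sy z) :: real) < - of_int (Sy l)" unfolding sz by simp
  hence "- Sy z < - Sy l" by linarith
  hence "z = 0" using min[OF zL] by fastforce
  thus ?thesis using that[of i j] by (simp add: z_def)
qed

lemma trace_zero_generator_exists:
  "\<exists>l. l \<in> L \<and> l \<noteq> 0 \<and> (\<forall>y\<in>L. \<exists>i j :: int. y = of_int i * l + of_int j * \<sigma> l)"
proof -
  obtain x where x: "x \<in> F" "\<sigma> x \<noteq> x" using nontrivial by blast
  obtain D where D: "D > (0::nat)" "of_nat D * x \<in> \<O>" by (rule integral_multiple[OF x(1)])
  \<comment> \<open>A nonzero start for the search for a shortest vector; lengths on \<open>L\<close> are even integers.\<close>
  define x0 where "x0 = of_nat D * x - \<sigma> (of_nat D * x)"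
  have "x0 \<in> L" unfolding x0_def by (rule diff_conj_L[OF D(2)])
  moreover have "x0 \<noteq> 0" using D(1) x by (simp add: x0_def)
  ultimately have "x0 \<in> L \<and> x0 \<noteq> 0" by simp
  then obtain l where l: "l \<in> L \<and> l \<noteq> 0"
    "\<And>y. y \<in> L \<and> y \<noteq> 0 \<Longrightarrow> nat (- Sy l) \<le> nat (- Sy y)"
    using ex_has_least_nat[of "\<lambda>l. l \<in> L \<and> l \<noteq> 0" x0 "\<lambda>l. nat (- Sy l)"] by blast
  have neg: "Sy y < 0" if "y \<in> L" "y \<noteq> 0" for y
  proof -
    have "of_int (Sy y) = Re (sy y)" using that of_int_symmetric(2)[of y] by (metis Re_complex_of_real L_\<O> of_real_of_int_eq)
    thus ?thesis using sy_neg[OF L_F L_tr, OF that(1) that(1) that(2)] by simp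
  qed
  have "- Sy l \<le> - Sy y" if "y \<in> L" "y \<noteq> 0" for y
    using l(2)[of y] neg[of y] that by linarith
  thus ?thesis using minimal_trace_zero_generates[of l] l(1) by metis
qed

lemma symmetric_shift:
  assumes "w \<in> F" "t \<in> \<rat>"
  shows "tr (t + w) = 3 * t + tr w" "sy (t + w) = 3 * t\<^sup>2 + 2 * t * tr w + sy w"
    "nm (t + w) = t ^ 3 + t\<^sup>2 * tr w + t * sy w + nm w"
  using assms Rats_F[of t]
  by (simp_all add: tr_def sy_def nm_def power2_eq_square power3_eq_cube algebra_simps)

text \<open>Up to a factor 3 every integer splits into a rational integer and an element of \<open>L\<close>. The next lemma expresses
  its symmetric functions by those of its trace zero part.\<close>

lemma trace_zero_part: "x \<in> \<O> \<Longrightarrow> 3 * x - of_int (Tr x) \<in> L"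
proof -
  assume x: "x \<in> \<O>"
  have "tr (3 * x - of_int (Tr x)) = tr (3 * x) - tr (of_int (Tr x))"
    using x by (intro tr_diff) (simp_all add: \<O>_F)
  also have "\<dots> = 3 * tr x - 3 * of_int (Tr x)"
    using x by (simp add: symmetric_scale tr_rat \<O>_F del: of_int_symmetric)
  also have "\<dots> = 0" using x by (simp add: of_int_symmetric)
  finally show ?thesis using x by (simp add: L_def)
qed

lemma symmetric_trace_zero_part:
  assumes x: "x \<in> \<O>"
  defines "w \<equiv> 3 * x - of_int (Tr x)"
  shows "9 * Sy x = 3 * (Tr x)\<^sup>2 + Sy w" "27 * Nm x = Tr x ^ 3 + Tr x * Sy w + Nm w"
proof -
  have w: "w \<in> L" unfolding w_def by (rule trace_zero_part[OF x])
  have eq: "3 * x = of_int (Tr x) + w" by (simp add: w_def)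
  have "9 * sy x = sy (3 * x)" using symmetric_scale[of x 3] x by (simp add: \<O>_F)
  also have "\<dots> = 3 * (of_int (Tr x))\<^sup>2 + sy w"
    unfolding eq using w by (simp add: symmetric_shift L_F L_tr)
  finally have "of_int (9 * Sy x) = (of_int (3 * (Tr x)\<^sup>2 + Sy w) :: complex)"
    using x w by (simp add: of_int_symmetric L_\<O>)
  thus "9 * Sy x = 3 * (Tr x)\<^sup>2 + Sy w" by (simp only: of_int_eq_iff)
  have "27 * nm x = nm (3 * x)" using symmetric_scale[of x 3] x by (simp add: \<O>_F)
  also have "\<dots> = of_int (Tr x) ^ 3 + of_int (Tr x) * sy w + nm w"
    unfolding eq using w by (simp add: symmetric_shift L_F L_tr)
  finally have "of_int (27 * Nm x) = (of_int (Tr x ^ 3 + Tr x * Sy w + Nm w) :: complex)"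
    using x w by (simp add: of_int_symmetric L_\<O>)
  thus "27 * Nm x = Tr x ^ 3 + Tr x * Sy w + Nm w" by (simp only: of_int_eq_iff)
qed

lemma Tr_add: "x \<in> \<O> \<Longrightarrow> y \<in> \<O> \<Longrightarrow> Tr (x + y) = Tr x + Tr y"
proof -
  assume "x \<in> \<O>" "y \<in> \<O>"
  hence "of_int (Tr (x + y)) = (of_int (Tr x + Tr y) :: complex)"
    by (simp add: of_int_symmetric tr_add \<O>_F)
  thus ?thesis by (simp only: of_int_eq_iff)
qed

lemma Tr_smult: "x \<in> \<O> \<Longrightarrow> Tr (of_int k * x) = k * Tr x"
proof -
  assume "x \<in> \<O>"
  hence "of_int (Tr (of_int k * x)) = (of_int (k * Tr x) :: complex)"
    by (simp add: of_int_symmetric symmetric_scale \<O>_F)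
  thus ?thesis by (simp only: of_int_eq_iff)
qed

lemma Tr_diff: "x \<in> \<O> \<Longrightarrow> y \<in> \<O> \<Longrightarrow> Tr (x - y) = Tr x - Tr y"
  using Tr_add[of x "of_int (-1) * y"] Tr_smult[of y "-1"] by simp

lemma symmetric_of_int: "Tr (of_int k) = 3 * k" "Nm (of_int k) = k ^ 3"
proof -
  have "of_int (Tr (of_int k)) = (of_int (3 * k) :: complex)"
    by (simp add: of_int_symmetric tr_rat)
  thus "Tr (of_int k) = 3 * k" by (simp only: of_int_eq_iff)
  have "of_int (Nm (of_int k)) = (of_int (k ^ 3) :: complex)"
    by (simp add: of_int_symmetric nm_def power3_eq_cube)
  thus "Nm (of_int k) = k ^ 3" by (simp only: of_int_eq_iff)
qed

lemma Tr_conj: "x \<in> \<O> \<Longrightarrow> Tr (\<sigma> x) = Tr x"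
  by (simp add: Tr_def tr_\<sigma> \<O>_F)

lemma Tr_L: "x \<in> L \<Longrightarrow> Tr x = 0"
  by (simp add: Tr_def L_tr)

lemma L_I: "x \<in> \<O> \<Longrightarrow> Tr x = 0 \<Longrightarrow> x \<in> L"
  using of_int_symmetric(1)[of x] by (simp add: L_def)

lemma Nm_mult: "x \<in> \<O> \<Longrightarrow> y \<in> \<O> \<Longrightarrow> Nm (x * y) = Nm x * Nm y"
proof -
  assume "x \<in> \<O>" "y \<in> \<O>"
  hence "of_int (Nm (x * y)) = (of_int (Nm x * Nm y) :: complex)"
    by (simp add: of_int_symmetric nm_def \<O>_F)
  thus ?thesis by (simp only: of_int_eq_iff)
qed

lemma Nm_conj: "x \<in> \<O> \<Longrightarrow> Nm (\<sigma> x) = Nm x"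
  by (simp add: Nm_def nm_def \<O>_F mult_ac)

lemma Sy_square:
  assumes x: "x \<in> \<O>"
  shows "2 * Sy x = (Tr x)\<^sup>2 - Tr (x\<^sup>2)"
proof -
  have "of_int (2 * Sy x) = (of_int ((Tr x)\<^sup>2 - Tr (x\<^sup>2)) :: complex)"
    using x by (simp add: of_int_symmetric symmetric_square \<O>_F)
  thus ?thesis by (simp only: of_int_eq_iff)
qed

lemma cube_divisible:
  assumes x: "x \<in> \<O>" and k: "k dvd Tr x" "k dvd Sy x" "k dvd Nm x" "k \<noteq> 0"
  shows "x ^ 3 / of_int k \<in> \<O>"
proof -
  obtain a b c where abc: "Tr x = k * a" "Sy x = k * b" "Nm x = k * c" using k by (elim dvdE)
  have "x ^ 3 = of_int (Tr x) * x\<^sup>2 - of_int (Sy x) * x + of_int (Nm x)"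
    using cubic_root[of x] x by (simp add: of_int_symmetric algebra_simps)
  hence "x ^ 3 / of_int k = of_int a * x\<^sup>2 - of_int b * x + of_int c"
    using k(4) unfolding abc by (simp add: field_simps)
  thus ?thesis using x by simp
qed

text \<open>Integrality of \<open>x/k\<close> is read off from its cubic polynomial.\<close>

lemma divisible_by_symmetric:
  assumes x: "x \<in> \<O>" and k: "k \<noteq> 0" "k dvd Tr x" "k\<^sup>2 dvd Sy x" "k ^ 3 dvd Nm x"
  shows "x / of_int k \<in> \<O>"
proof -
  obtain a b c where abc: "Tr x = k * a" "Sy x = k\<^sup>2 * b" "Nm x = k ^ 3 * c" using k by (elim dvdE)
  have r: "1 / of_int k \<in> (\<rat> :: complex set)" by simp
  have 1: "tr (1 / of_int k * x) = of_int a" "sy (1 / of_int k * x) = of_int b"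
    "nm (1 / of_int k * x) = of_int c"
    unfolding symmetric_scale[OF \<O>_F[OF x] r] of_int_symmetric[OF x, symmetric] abc
    using k(1) by (simp_all add: field_simps)
  have "1 / of_int k * x \<in> F" using x by (simp add: \<O>_F)
  from \<O>_I[OF this 1] show ?thesis by simp
qed

lemma square_divisible:
  assumes x: "x \<in> \<O>" and k: "k \<noteq> 0" "k dvd Tr (x\<^sup>2)" "k\<^sup>2 dvd Sy (x\<^sup>2)" "k ^ 3 dvd (Nm x)\<^sup>2"
  shows "x\<^sup>2 / of_int k \<in> \<O>" "of_int k ^ 3 * nm (x\<^sup>2 / of_int k) = (nm x)\<^sup>2" "of_int k * tr (x\<^sup>2 / of_int k) = tr (x\<^sup>2)"
proof -
  have "Nm (x\<^sup>2) = (Nm x)\<^sup>2" using x by (simp add: power2_eq_square Nm_mult)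
  thus "x\<^sup>2 / of_int k \<in> \<O>" using assms by (intro divisible_by_symmetric) auto
  have F: "x\<^sup>2 \<in> F" using x by (simp add: \<O>_F)
  have "nm (1 / of_int k * x\<^sup>2) = (1 / of_int k) ^ 3 * nm (x\<^sup>2)" "tr (1 / of_int k * x\<^sup>2) = (1 / of_int k) * tr (x\<^sup>2)"
    using F by (intro symmetric_scale; simp)+
  thus "of_int k ^ 3 * nm (x\<^sup>2 / of_int k) = (nm x)\<^sup>2" "of_int k * tr (x\<^sup>2 / of_int k) = tr (x\<^sup>2)"
    using k(1) symmetric_square(3)[OF \<O>_F[OF x]] by (simp_all add: field_simps)
qed

text \<open>The product of the differences of the conjugates is invariant under \<open>\<sigma>\<close>.\<close>

lemma discriminant_square:
  assumes x: "x \<in> L"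
  shows "\<exists>s. s\<^sup>2 = 4 * (- Sy x) ^ 3 - 27 * (Nm x)\<^sup>2"
proof -
  define a where "a = \<sigma> x"
  have F: "x \<in> F" "a \<in> F" "x \<in> \<O>" "a \<in> \<O>" using x by (simp_all add: a_def L_F L_\<O>)
  have s2: "\<sigma> x = a" "\<sigma> a = - x - a" using traceless_\<sigma>2 L_tr[OF x] by (simp_all add: a_def)
  define d where "d = (x - a) * (a - (- x - a)) * ((- x - a) - x)"
  have d: "d \<in> \<O>" using F by (simp add: d_def)
  have "\<sigma> d = (a - (- x - a)) * ((- x - a) - x) * (x - a)"
    using F by (simp add: d_def s2)
  hence "\<sigma> d = d" by (simp add: d_def mult_ac)
  hence "d \<in> \<rat>" using fixed_iff[OF \<O>_F[OF d]] by blast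
  hence "d \<in> \<int>" using d by (intro rational_algebraic_int_is_int \<O>_int)
  then obtain s where s: "d = of_int s" by (rule Ints_cases)
  have sy: "sy x = - (x\<^sup>2 + x * a + a\<^sup>2)" using L_tr[OF x] by (simp add: traceless_sy s2)
  have nm: "nm x = x * a * (- x - a)" by (simp add: nm_def s2)
  have "of_int (s\<^sup>2) = (of_int (4 * (- Sy x) ^ 3 - 27 * (Nm x)\<^sup>2) :: complex)"
    using F by (simp add: of_int_symmetric flip: s)
      (simp add: sy nm d_def power2_eq_square power3_eq_cube algebra_simps)
  hence "s\<^sup>2 = 4 * (- Sy x) ^ 3 - 27 * (Nm x)\<^sup>2" by (simp only: of_int_eq_iff)
  thus ?thesis by blast
qed

end

locale trace_zero_basis = cyclic_cubic +
  fixes l :: complex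
  assumes l: "l \<in> L" "l \<noteq> 0"
    and gen: "y \<in> L \<Longrightarrow> \<exists>i j :: int. y = of_int i * l + of_int j * \<sigma> l"
begin

text \<open>The quadratic form \<open>T(y\<^sup>2)\<close> on \<open>L\<close> is \<open>2e (i\<^sup>2 - i j + j\<^sup>2)\<close> in the basis \<open>l, \<sigma> l\<close>.\<close>

definition e :: int where "e = - Sy l"

lemma sy_l: "sy l = - of_int e"
  using l by (simp add: e_def of_int_symmetric L_\<O>)

lemma e_pos: "e > 0"
proof -
  have "Re (sy l) = - of_int e" by (simp add: sy_l)
  thus ?thesis using sy_neg[OF L_F L_tr l(2), OF l(1) l(1)] by simp
qed

lemma independent_l:
  assumes "r \<in> \<rat>" "s \<in> \<rat>" "r * l + s * \<sigma> l = 0"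
  shows "r = 0" "s = 0"
proof -
  have "sy (r * l + s * \<sigma> l) = (r\<^sup>2 - r * s + s\<^sup>2) * sy l"
    using assms by (intro traceless_sy_comb L_F L_tr l)
  hence "r\<^sup>2 - r * s + s\<^sup>2 = 0"
    using assms(3) e_pos by (simp add: sy_l) (simp add: sy_def)
  hence "of_real ((Re r)\<^sup>2 - Re r * Re s + (Re s)\<^sup>2) = (0 :: complex)"
    using assms Rats_F by simp
  hence "(Re r)\<^sup>2 - Re r * Re s + (Re s)\<^sup>2 = 0" by (simp only: of_real_eq_0_iff)
  moreover have "(Re r)\<^sup>2 - Re r * Re s + (Re s)\<^sup>2 = ((Re r)\<^sup>2 + (Re s)\<^sup>2 + (Re r - Re s)\<^sup>2) / 2"
    by (simp add: power2_eq_square algebra_simps)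
  ultimately have 1: "(Re r)\<^sup>2 + (Re s)\<^sup>2 + (Re r - Re s)\<^sup>2 = 0"
    by (metis divide_eq_0_iff zero_neq_numeral)
  have "(Re r)\<^sup>2 = 0"
    using 1 zero_le_power2[of "Re r"] zero_le_power2[of "Re s"] zero_le_power2[of "Re r - Re s"] by linarith
  moreover have "(Re s)\<^sup>2 = 0"
    using 1 zero_le_power2[of "Re r"] zero_le_power2[of "Re s"] zero_le_power2[of "Re r - Re s"] by linarith
  ultimately have "Re r = 0" "Re s = 0" by simp_all
  thus "r = 0" "s = 0" using of_real_Re[OF Rats_F[OF assms(1)]] of_real_Re[OF Rats_F[OF assms(2)]]
    by simp_all
qed

lemma coordinates_unique:
  assumes "of_int i * l + of_int j * \<sigma> l = of_int i' * l + of_int j' * \<sigma> l"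
  shows "i = i'" "j = j'"
proof -
  have "of_int (i - i') * l + of_int (j - j') * \<sigma> l = 0" using assms by (simp add: algebra_simps)
  from independent_l[OF _ _ this] show "i = i'" "j = j'" by simp_all
qed

lemma l_not_divisible: "k > 1 \<Longrightarrow> l / of_int k \<notin> \<O>"
proof
  assume k: "k > 1" and "l / of_int k \<in> \<O>"
  moreover have "tr (1 / of_int k * l) = 1 / of_int k * tr l"
    by (rule symmetric_scale) (simp_all add: L_F l)
  hence "tr (l / of_int k) = 0" using l by (simp add: L_tr)
  ultimately have "l / of_int k \<in> L" by (simp add: L_def)
  then obtain i j :: int where "l / of_int k = of_int i * l + of_int j * \<sigma> l" using gen by blast
  hence "of_int 1 * l + of_int 0 * \<sigma> l = of_int (k * i) * l + of_int (k * j) * \<sigma> l"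
    using k by (simp add: field_simps)
  hence "1 = k * i" by (rule coordinates_unique)
  hence "k dvd 1" by (rule dvdI)
  thus False using k by simp
qed

lemma Sy_comb: "Sy (of_int i * l + of_int j * \<sigma> l) = - ((i\<^sup>2 - i * j + j\<^sup>2) * e)"
proof -
  have "sy (of_int i * l + of_int j * \<sigma> l) = of_int (- ((i\<^sup>2 - i * j + j\<^sup>2) * e))"
    using l by (simp add: traceless_sy_comb L_F L_tr sy_l)
  moreover have "of_int i * l + of_int j * \<sigma> l \<in> \<O>" using l by (simp add: L_\<O>)
  ultimately show ?thesis using of_int_symmetric(2) by (metis of_int_eq_iff)
qed

lemma e_dvd_Sy: "y \<in> L \<Longrightarrow> e dvd Sy y"
  using gen[of y] Sy_comb by (metis dvd_minus_iff dvd_triv_right)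

lemma e_dvd_Tr_mult:
  assumes "x \<in> L" "y \<in> L"
  shows "e dvd Tr (x * y)"
proof -
  have O: "x \<in> \<O>" "y \<in> \<O>" and F: "x \<in> F" "y \<in> F" and t: "tr x = 0" "tr y = 0"
    using assms by (simp_all add: L_\<O> L_F L_tr)
  have "tr (x * y) = - (sy (x + y) - sy x - sy y)"
  proof -
    have "tr x * tr y - tr (x * y) = sy (x + y) - sy x - sy y"
      using F by (simp add: tr_def sy_def algebra_simps)
    hence "- tr (x * y) = sy (x + y) - sy x - sy y" using t by simp
    thus ?thesis by (metis minus_minus)
  qed
  hence "of_int (Tr (x * y)) = (of_int (- (Sy (x + y) - Sy x - Sy y)) :: complex)"
    using O by (simp add: of_int_symmetric)
  hence "Tr (x * y) = - (Sy (x + y) - Sy x - Sy y)" by (simp only: of_int_eq_iff)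
  thus ?thesis using assms e_dvd_Sy by (simp add: dvd_diff)
qed

text \<open>Pair \<open>y\<close> with the trace zero part \<open>z\<close> of \<open>y\<^sup>2\<close>: the trace of \<open>y z\<close> is three times the trace of \<open>y\<^sup>3\<close>, which is
  three times the norm of \<open>y\<close> as \<open>y\<close> has trace zero.\<close>

lemma e_dvd_9_Nm:
  assumes "y \<in> L"
  shows "e dvd 9 * Nm y"
proof -
  have O: "y \<in> \<O>" and F: "y \<in> F" and t: "tr y = 0"
    using assms by (simp_all add: L_\<O> L_F L_tr)
  define z where "z = 3 * y\<^sup>2 - of_int (Tr (y\<^sup>2))"
  have z: "z \<in> L" unfolding z_def by (rule trace_zero_part) (use O in simp)
  have "tr (y * z) = 3 * tr (y ^ 3) - of_int (Tr (y\<^sup>2)) * tr y"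
    using F by (simp add: tr_def z_def power2_eq_square power3_eq_cube algebra_simps)
  also have "tr (y ^ 3) = 3 * nm y"
  proof -
    have "tr (y ^ 3) = y ^ 3 + \<sigma> y ^ 3 + \<sigma> (\<sigma> y) ^ 3" using F by (simp add: tr_def)
    thus ?thesis unfolding nm_def traceless_\<sigma>2[OF t] by (simp add: power3_eq_cube algebra_simps)
  qed
  finally have "of_int (Tr (y * z)) = (of_int (9 * Nm y) :: complex)"
    using O z t by (simp add: of_int_symmetric L_\<O>)
  hence "Tr (y * z) = 9 * Nm y" by (simp only: of_int_eq_iff)
  thus ?thesis using e_dvd_Tr_mult[OF assms z] by simp
qed

subsection \<open>The generator is squarefree away from 3\<close>

lemma Nm_dvd:
  assumes "coprime k 3" "k dvd e" "y \<in> L"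
  shows "k dvd Nm y"
proof -
  have "k dvd 9 * Nm y" using assms(2) e_dvd_9_Nm[OF assms(3)] by (rule dvd_trans)
  moreover have "coprime k (3 ^ 2)" using assms(1) by (simp only: coprime_power_right_iff simp_thms)
  ultimately show ?thesis by (simp add: coprime_dvd_mult_right_iff)
qed

text \<open>Suppose \<open>p\<^sup>2\<close> divides \<open>e\<close>. Then \<open>p\<^sup>2\<close> divides the norms on \<open>L\<close>, so \<open>u = l\<^sup>2/p\<close> is an integer. Its trace is
  divisible by \<open>p\<close>, and splitting \<open>3u\<close> into a rational part and a part in \<open>L\<close> shows that its norm is divisible
  by \<open>p\<^sup>2\<close>. As that norm is \<open>N(l)\<^sup>2/p\<^sup>3\<close>, already \<open>p\<^sup>3\<close>
  divides \<open>N(l)\<close>, and \<open>l/p\<close> would be an integer.\<close>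

lemma e_squarefree_away_from_3:
  assumes p: "prime p" "p \<noteq> (3::int)"
  shows "\<not> p\<^sup>2 dvd e"
proof
  assume p2: "p\<^sup>2 dvd e"
  have cop: "coprime p 3" using p primes_coprime[of p 3] by simp
  have cop2: "coprime (p\<^sup>2) 3" using cop by simp
  have p0: "p > 1" using p(1) prime_gt_1_int by simp
  obtain f where f: "e = p\<^sup>2 * f" using p2 by (rule dvdE)
  obtain N where N: "Nm l = p\<^sup>2 * N" using Nm_dvd[OF cop2 p2 l(1)] by (rule dvdE)
  have O: "l \<in> \<O>" "l \<in> F" using l by (simp_all add: L_\<O> L_F)
  have trl2: "Tr (l\<^sup>2) = 2 * p * (p * f)"
    using Sy_square[OF O(1)] f by (simp add: Tr_L l e_def power2_eq_square)
  have syl2: "Sy (l\<^sup>2) = e\<^sup>2"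
  proof -
    have "of_int (Sy (l\<^sup>2)) = (of_int (e\<^sup>2) :: complex)"
      using O l by (simp add: of_int_symmetric symmetric_square L_tr sy_l)
    thus ?thesis by (simp only: of_int_eq_iff)
  qed
  define u where "u = l\<^sup>2 / of_int p"
  have hyps: "p \<noteq> 0" "p dvd Tr (l\<^sup>2)" "p\<^sup>2 dvd Sy (l\<^sup>2)" "p ^ 3 dvd (Nm l)\<^sup>2"
  proof -
    show "p \<noteq> 0" "p dvd Tr (l\<^sup>2)" using p0 by (simp_all add: trl2)
    show "p\<^sup>2 dvd Sy (l\<^sup>2)" unfolding syl2 using p2 by (simp add: power2_eq_square[of e])
    have "(Nm l)\<^sup>2 = p ^ 3 * (p * N\<^sup>2)" by (simp add: N power2_eq_square power3_eq_cube)
    thus "p ^ 3 dvd (Nm l)\<^sup>2" by simp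
  qed
  note sq = square_divisible[OF O(1) hyps]
  have u: "u \<in> \<O>" unfolding u_def by (rule sq)
  have "of_int (p * Tr u) = (of_int (Tr (l\<^sup>2)) :: complex)"
    using sq(3) u O by (simp add: of_int_symmetric u_def)
  hence "p * Tr u = p * (2 * p * f)" by (simp only: of_int_eq_iff trl2 mult_ac)
  hence Tru: "Tr u = 2 * p * f" using p0 by simp
  have "of_int (p ^ 3 * Nm u) = (of_int ((Nm l)\<^sup>2) :: complex)"
    using sq(2) u O by (simp add: of_int_symmetric u_def)
  hence Nmu: "p ^ 3 * Nm u = (Nm l)\<^sup>2" by (simp only: of_int_eq_iff)
  define w where "w = 3 * u - of_int (Tr u)"
  have w: "w \<in> L" unfolding w_def by (rule trace_zero_part[OF u])
  have "p\<^sup>2 dvd Tr u ^ 3 + Tr u * Sy w + Nm w"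
  proof (intro dvd_add)
    show "p\<^sup>2 dvd Tr u ^ 3" by (simp add: Tru power2_eq_square power3_eq_cube)
    show "p\<^sup>2 dvd Tr u * Sy w" using dvd_trans[OF p2 e_dvd_Sy[OF w]] by simp
    show "p\<^sup>2 dvd Nm w" by (rule Nm_dvd[OF cop2 p2 w])
  qed
  hence "p\<^sup>2 dvd 27 * Nm u"
    using symmetric_trace_zero_part(2)[OF u] by (simp add: w_def)
  moreover have "coprime (p\<^sup>2) (3 ^ 3)" using cop2 by (simp only: coprime_power_right_iff simp_thms)
  ultimately have "p\<^sup>2 dvd Nm u" by (simp add: coprime_dvd_mult_right_iff)
  then obtain k where "Nm u = p\<^sup>2 * k" by (rule dvdE)
  hence "p ^ 3 * (p\<^sup>2 * k) = (p\<^sup>2 * N)\<^sup>2" using Nmu by (simp only: N)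
  moreover have "p ^ 4 * N\<^sup>2 = (p\<^sup>2 * N)\<^sup>2" "p ^ 4 * (p * k) = p ^ 3 * (p\<^sup>2 * k)"
    by (simp_all add: eval_nat_numeral mult_ac)
  ultimately have "p ^ 4 * N\<^sup>2 = p ^ 4 * (p * k)" by (simp only:)
  moreover have "p ^ 4 \<noteq> 0" using p0 by simp
  ultimately have "N\<^sup>2 = p * k" by (metis mult_left_cancel)
  hence "p dvd N" using p(1) by (metis dvd_triv_left prime_dvd_power)
  hence "p ^ 3 dvd Nm l" by (auto simp: N power2_eq_square power3_eq_cube)
  moreover have "p\<^sup>2 dvd Sy l" using p2 by (simp add: e_def)
  ultimately have "l / of_int p \<in> \<O>"
    using O p0 by (intro divisible_by_symmetric) (auto simp: Tr_L l)
  thus False using l_not_divisible[OF p0] by blast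
qed

end

context cyclic_cubic
begin

text \<open>This is the case in which 3 ramifies, and then it does so wildly.\<close>

definition wild :: bool where "wild \<longleftrightarrow> (\<forall>x\<in>\<O>. 3 dvd Tr x)"

lemma wild_Tr: "wild \<Longrightarrow> x \<in> \<O> \<Longrightarrow> 3 dvd Tr x"
  by (simp add: wild_def)

text \<open>The mixed terms in the norm of a sum are two traces. So in the wild case the norm is a ring homomorphism
  onto the field with three elements.\<close>

lemma Nm_add_mod_3:
  assumes "wild" "x \<in> \<O>" "y \<in> \<O>"
  shows "3 dvd Nm (x + y) - (Nm x + Nm y)"
proof -
  have F: "x \<in> F" "y \<in> F" using assms by (simp_all add: \<O>_F)
  define u v where "u = x * \<sigma> x * \<sigma> (\<sigma> y)" and "v = x * \<sigma> y * \<sigma> (\<sigma> y)"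
  have O: "u \<in> \<O>" "v \<in> \<O>" using assms by (simp_all add: u_def v_def)
  have "nm (x + y) - (nm x + nm y) = tr u + tr v"
    using F by (simp add: nm_def tr_def u_def v_def algebra_simps)
  hence "of_int (Nm (x + y) - (Nm x + Nm y)) = (of_int (Tr u + Tr v) :: complex)"
    using assms(2,3) O by (simp add: of_int_symmetric)
  hence "Nm (x + y) - (Nm x + Nm y) = Tr u + Tr v" by (simp only: of_int_eq_iff)
  thus ?thesis using wild_Tr[OF assms(1) O(1)] wild_Tr[OF assms(1) O(2)] by simp
qed

lemma wild_decomposition:
  assumes "wild" "x \<in> \<O>"
  obtains a y where "x = of_int a + y" "y \<in> L" "Tr x = 3 * a"
proof -
  obtain a where a: "Tr x = 3 * a" using wild_Tr[OF assms] by (rule dvdE)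
  moreover have "x - of_int a \<in> L"
    using assms a by (intro L_I) (simp_all add: Tr_diff symmetric_of_int)
  ultimately show ?thesis using that[of a "x - of_int a"] by simp
qed

lemma cube_divisible_wild:
  assumes "wild" "x \<in> \<O>" "3 dvd Nm x"
  shows "x ^ 3 / of_int 3 \<in> \<O>"
proof (rule cube_divisible[OF assms(2)])
  show "3 dvd Tr x" using assms by (simp add: wild_Tr)
  have "3 dvd (Tr x)\<^sup>2 - Tr (x\<^sup>2)"
    using assms by (intro dvd_diff wild_Tr) (auto simp: wild_Tr power2_eq_square)
  hence "3 dvd 2 * Sy x" by (simp add: Sy_square[OF assms(2)])
  thus "3 dvd Sy x" by presburger
qed (use assms in auto)

end

context trace_zero_basis
begin

text \<open>Modulo a divisor of \<open>e\<close> prime to 3, an element whose trace vanishes has characteristic polynomial \<open>x\<^sup>3\<close>.\<close>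

lemma cube_divisible_tame:
  assumes q: "q dvd e" "coprime q 3" and x: "x \<in> \<O>" "q dvd Tr x"
  shows "x ^ 3 / of_int q \<in> \<O>"
proof -
  define w where "w = 3 * x - of_int (Tr x)"
  have w: "w \<in> L" unfolding w_def by (rule trace_zero_part[OF x(1)])
  have Sw: "q dvd Sy w" using q(1) e_dvd_Sy[OF w] by (rule dvd_trans)
  have Nw: "q dvd Nm w" using q w by (intro Nm_dvd)
  have "q dvd 9 * Sy x"
    unfolding symmetric_trace_zero_part(1)[OF x(1)] w_def[symmetric]
    using x(2) Sw by (simp add: power2_eq_square)
  moreover have "coprime q (3 ^ 2)" using q(2) by (simp only: coprime_power_right_iff simp_thms)
  ultimately have S: "q dvd Sy x" by (simp add: coprime_dvd_mult_right_iff)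
  have "q dvd 27 * Nm x"
    unfolding symmetric_trace_zero_part(2)[OF x(1)] w_def[symmetric]
    using x(2) Nw by (simp add: power3_eq_cube)
  moreover have "coprime q (3 ^ 3)" using q(2) by (simp only: coprime_power_right_iff simp_thms)
  ultimately have "q dvd Nm x" by (simp add: coprime_dvd_mult_right_iff)
  moreover have "q \<noteq> 0" using q(2) by auto
  ultimately show ?thesis using x S by (intro cube_divisible)
qed

subsection \<open>The prime 3\<close>

lemma wild_Nm_L:
  assumes "wild" "y \<in> L"
  obtains i j where "y = of_int i * l + of_int j * \<sigma> l" "3 dvd Nm y - (i ^ 3 + j ^ 3) * Nm l"
proof -
  obtain i j :: int where ij: "y = of_int i * l + of_int j * \<sigma> l" using gen[OF assms(2)] by blast
  have O: "l \<in> \<O>" using l by (simp add: L_\<O>)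
  have "3 dvd Nm y - (Nm (of_int i * l) + Nm (of_int j * \<sigma> l))"
    unfolding ij using O by (intro Nm_add_mod_3 assms) auto
  hence "3 dvd Nm y - (i ^ 3 + j ^ 3) * Nm l"
    using O by (simp add: Nm_mult symmetric_of_int Nm_conj distrib_right)
  thus ?thesis using that ij by blast
qed

text \<open>If 3 divides \<open>N(l)\<close>, the norm vanishes on \<open>L\<close> modulo 3, so that the residue of \<open>z\<close> is the residue of its
  rational part \<open>T(z)/3\<close>.\<close>

lemma wild_Nm_l_imp_Tr:
  assumes "wild" "3 dvd Nm l" "z \<in> \<O>" "3 dvd Nm z"
  shows "9 dvd Tr z"
proof -
  obtain a y where ay: "z = of_int a + y" "y \<in> L" "Tr z = 3 * a"
    using wild_decomposition[OF assms(1,3)] by blast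
  obtain i j where "3 dvd Nm y - (i ^ 3 + j ^ 3) * Nm l"
    using wild_Nm_L[OF assms(1) ay(2)] by blast
  hence y: "3 dvd Nm y" using assms(2) by (metis dvd_add_times_triv_left_iff dvd_diff_commute dvd_mult
        diff_add_cancel dvd_add_right_iff)
  have "3 dvd Nm z - (Nm (of_int a) + Nm y)"
    unfolding ay(1) using ay(2) by (intro Nm_add_mod_3 assms) (auto simp: L_\<O>)
  hence "3 dvd Nm (of_int a)" using assms(4) y by presburger
  hence "3 dvd a ^ 3" by (simp add: symmetric_of_int)
  hence "3 dvd a" by (rule prime_dvd_power[rotated]) simp
  thus ?thesis using ay(3) by presburger
qed

text \<open>Apply the preceding lemma to \<open>z = l \<sigma> l\<close>, whose trace is \<open>- e\<close>.\<close>

lemma wild_Nm_l: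
  assumes "wild" "\<not> 9 dvd e"
  shows "\<not> 3 dvd Nm l"
proof
  assume n: "3 dvd Nm l"
  have O: "l \<in> \<O>" and F: "l \<in> F" using l by (simp_all add: L_\<O> L_F)
  have "3 dvd Nm (l * \<sigma> l)" using O n by (simp add: Nm_mult Nm_conj)
  hence "9 dvd Tr (l * \<sigma> l)" using O by (intro wild_Nm_l_imp_Tr assms n) auto
  moreover have "of_int (Tr (l * \<sigma> l)) = (of_int (- e) :: complex)"
    using O F sy_l by (simp add: of_int_symmetric) (simp add: tr_def sy_def)
  hence "Tr (l * \<sigma> l) = - e" by (simp only: of_int_eq_iff)
  ultimately show False using assms(2) by simp
qed

lemma three_dvd_power2: "3 dvd (x::int)\<^sup>2 \<Longrightarrow> 3 dvd x"
  by (rule prime_dvd_power) simp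

text \<open>Suppose 9 divides \<open>e\<close>. Since \<open>4e\<^sup>3 - 27 N(l)\<^sup>2\<close> is a square, 9 divides \<open>N(l)\<close>, so \<open>u = l\<^sup>2/3\<close> is an integer of
  norm divisible by 3. Its trace \<open>2e/3\<close> is then divisible by 9, and 27 divides \<open>e\<close>. Using the square once
  more, 27 divides \<open>N(l)\<close>, and \<open>l/3\<close> would be an integer.\<close>

lemma wild_not_9_dvd_e:
  assumes "wild"
  shows "\<not> 9 dvd e"
proof
  assume "9 dvd e"
  then obtain f where f: "e = 9 * f" by (rule dvdE)
  have O: "l \<in> \<O>" "l \<in> F" using l by (simp_all add: L_\<O> L_F)
  obtain s where s: "s\<^sup>2 = 4 * e ^ 3 - 27 * (Nm l)\<^sup>2"
    using discriminant_square[OF l(1)] by (auto simp: e_def)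
  \<comment> \<open>Each extracted factor 3 of the discriminant is shared by its root and by the norm.\<close>
  have "3 dvd s\<^sup>2" by (simp add: s f power3_eq_cube)
  then obtain s0 where s0: "s = 3 * s0" using three_dvd_power2 by blast
  have e0: "s0\<^sup>2 = 324 * f ^ 3 - 3 * (Nm l)\<^sup>2"
    using s by (simp add: s0 f power2_eq_square power3_eq_cube)
  hence "3 dvd s0\<^sup>2" by simp
  then obtain s1 where s1: "s0 = 3 * s1" using three_dvd_power2 by blast
  have e1: "(Nm l)\<^sup>2 = 108 * f ^ 3 - 3 * s1\<^sup>2"
    using e0 by (simp add: s1 power2_eq_square)
  hence "3 dvd (Nm l)\<^sup>2" by simp
  then obtain n1 where n1: "Nm l = 3 * n1" using three_dvd_power2 by blast
  have e2: "s1\<^sup>2 = 36 * f ^ 3 - 3 * n1\<^sup>2" using e1 by (simp add: n1 power2_eq_square)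
  hence "3 dvd s1\<^sup>2" by simp
  then obtain s2 where s2: "s1 = 3 * s2" using three_dvd_power2 by blast
  have e3: "n1\<^sup>2 = 12 * f ^ 3 - 3 * s2\<^sup>2" using e2 by (simp add: s2 power2_eq_square)
  hence "3 dvd n1\<^sup>2" by simp
  then obtain n2 where n2: "n1 = 3 * n2" using three_dvd_power2 by blast
  have trl2: "Tr (l\<^sup>2) = 18 * f"
    using Sy_square[OF O(1)] f by (simp add: Tr_L l e_def)
  have syl2: "Sy (l\<^sup>2) = 81 * f\<^sup>2"
  proof -
    have "of_int (Sy (l\<^sup>2)) = (of_int (e\<^sup>2) :: complex)"
      using O l by (simp add: of_int_symmetric symmetric_square L_tr sy_l)
    hence "Sy (l\<^sup>2) = e\<^sup>2" by (simp only: of_int_eq_iff)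
    thus ?thesis by (simp add: f power2_eq_square)
  qed
  define u where "u = l\<^sup>2 / of_int 3"
  have hyps: "(3::int) \<noteq> 0" "3 dvd Tr (l\<^sup>2)" "3\<^sup>2 dvd Sy (l\<^sup>2)" "3 ^ 3 dvd (Nm l)\<^sup>2"
  proof -
    show "3 dvd Tr (l\<^sup>2)" unfolding trl2 by presburger
    show "3\<^sup>2 dvd Sy (l\<^sup>2)" unfolding syl2 by simp
    show "3 ^ 3 dvd (Nm l)\<^sup>2" unfolding n1 n2 by (simp add: power_mult_distrib)
  qed simp
  note sq = square_divisible[OF O(1) hyps]
  have u: "u \<in> \<O>" unfolding u_def by (rule sq)
  have "of_int (3 * Tr u) = (of_int (Tr (l\<^sup>2)) :: complex)"
    using sq(3) u O by (simp add: of_int_symmetric u_def)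
  hence Tru: "Tr u = 6 * f" by (simp only: of_int_eq_iff trl2)
  have "of_int (27 * Nm u) = (of_int ((Nm l)\<^sup>2) :: complex)"
    using sq(2) u O by (simp add: of_int_symmetric u_def)
  hence "27 * Nm u = (Nm l)\<^sup>2" by (simp only: of_int_eq_iff)
  hence "Nm u = 3 * n2\<^sup>2" by (simp add: n1 n2 power2_eq_square)
  hence "9 dvd Tr u" using n1 by (intro wild_Nm_l_imp_Tr assms u) auto
  hence "3 dvd f" unfolding Tru by presburger
  then obtain g where g: "f = 3 * g" by (rule dvdE)
  have e4: "s2\<^sup>2 = 108 * g ^ 3 - 3 * n2\<^sup>2"
    using e3 by (simp add: n2 g power2_eq_square power3_eq_cube)
  hence "3 dvd s2\<^sup>2" by simp
  then obtain s3 where s3: "s2 = 3 * s3" using three_dvd_power2 by blast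
  have "n2\<^sup>2 = 36 * g ^ 3 - 3 * s3\<^sup>2" using e4 by (simp add: s3 power2_eq_square)
  hence "3 dvd n2\<^sup>2" by simp
  then obtain n3 where n3: "n2 = 3 * n3" using three_dvd_power2 by blast
  have "l / of_int 3 \<in> \<O>"
  proof (rule divisible_by_symmetric[OF O(1)])
    show "3\<^sup>2 dvd Sy l" using f by (simp add: e_def) presburger
    show "3 ^ 3 dvd Nm l" by (simp add: n1 n2 n3)
  qed (simp_all add: Tr_L l)
  thus False using l_not_divisible[of 3] by simp
qed

text \<open>Take an integer \<open>x\<close> of trace 1 and write \<open>3x - 1 = i l + j \<sigma> l\<close>. As \<open>x - \<sigma> x\<close> lies in \<open>L\<close>, 3 divides \<open>i + j\<close>;
  computing \<open>9 sy x\<close> modulo 9 shows that 3 divides neither \<open>e\<close> nor \<open>i\<close>. Subtracting an element of \<open>L\<close>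
  from \<open>x\<close> reduces \<open>i\<close> to \<open>\<plusminus>1\<close> and \<open>j\<close> to \<open>- i\<close>.\<close>

lemma tame_generator:
  assumes "\<not> wild"
  obtains \<eta> \<epsilon> where "\<eta> \<in> \<O>" "\<epsilon> = 1 \<or> \<epsilon> = (-1::int)" "3 * \<eta> = 1 + of_int \<epsilon> * (l - \<sigma> l)" "\<not> 3 dvd e"
proof -
  have O: "l \<in> \<O>" "l \<in> F" using l by (simp_all add: L_\<O> L_F)
  obtain y where y: "y \<in> \<O>" "\<not> 3 dvd Tr y" using assms by (auto simp: wild_def)
  have "\<exists>x\<in>\<O>. Tr x = 1"
  proof -
    have "Tr y mod 3 = 1 \<or> Tr y mod 3 = 2" using y(2) by presburger
    hence "Tr y = 3 * (Tr y div 3) + 1 \<or> - Tr y = 3 * (- (Tr y div 3) - 1) + 1" by presburger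
    then obtain k where "Tr y = 3 * k + 1 \<or> - Tr y = 3 * k + 1" by blast
    moreover have "Tr (y - of_int k) = Tr y - 3 * k" "Tr (of_int (-1) * y - of_int k) = - Tr y - 3 * k"
      using y(1) Tr_smult[of y "-1"] by (simp_all add: Tr_diff symmetric_of_int)
    ultimately show ?thesis
      using y(1) \<O>_closed(3)[OF y(1) \<O>_closed(6)[of k]]
        \<O>_closed(3)[OF \<O>_closed(2)[OF \<O>_closed(6)[of "-1"] y(1)] \<O>_closed(6)[of k]]
      by (metis add_diff_cancel_left')
  qed
  then obtain x where x: "x \<in> \<O>" "Tr x = 1" by blast
  define w where "w = 3 * x - 1"
  have w: "w \<in> L" using trace_zero_part[OF x(1)] x(2) by (simp add: w_def)
  obtain i j :: int where ij: "w = of_int i * l + of_int j * \<sigma> l" using gen[OF w] by blast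
  have Syw: "9 * Sy x = 3 - (i\<^sup>2 - i * j + j\<^sup>2) * e"
    using symmetric_trace_zero_part(1)[OF x(1)] x(2) Sy_comb[of i j] ij by (simp add: w_def)
  have "x - \<sigma> x \<in> L" by (rule diff_conj_L[OF x(1)])
  then obtain a b :: int where ab: "x - \<sigma> x = of_int a * l + of_int b * \<sigma> l" using gen by blast
  have s2: "\<sigma> (\<sigma> l) = - l - \<sigma> l" using l by (intro traceless_\<sigma>2 L_tr)
  have "w - \<sigma> w = 3 * (x - \<sigma> x)" using x(1) by (simp add: w_def \<O>_F)
  moreover have "w - \<sigma> w = of_int (i + j) * l + of_int (2 * j - i) * \<sigma> l"
    unfolding ij using O by (simp add: s2 algebra_simps)
  ultimately have "of_int (i + j) * l + of_int (2 * j - i) * \<sigma> l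
     = of_int (3 * a) * l + of_int (3 * b) * \<sigma> l"
    by (simp add: ab algebra_simps)
  hence "i + j = 3 * a" by (rule coordinates_unique)
  hence j: "j = 3 * a - i" by simp
  have i2: "i\<^sup>2 - i * j + j\<^sup>2 = 3 * (i\<^sup>2 - 3 * a * i + 3 * a\<^sup>2)"
    by (simp add: j power2_eq_square algebra_simps)
  have 1: "3 * Sy x = 1 - (i\<^sup>2 - 3 * a * i + 3 * a\<^sup>2) * e"
    using Syw unfolding i2 by (simp add: algebra_simps)
  have e3: "\<not> 3 dvd e"
  proof
    assume "3 dvd e"
    hence "3 dvd (i\<^sup>2 - 3 * a * i + 3 * a\<^sup>2) * e" by simp
    then obtain t where "(i\<^sup>2 - 3 * a * i + 3 * a\<^sup>2) * e = 3 * t" by (rule dvdE)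
    hence "3 * Sy x = 1 - 3 * t" using 1 by simp
    thus False by presburger
  qed
  have i3: "\<not> 3 dvd i"
  proof
    assume "3 dvd i"
    hence "3 dvd (i\<^sup>2 - 3 * a * i + 3 * a\<^sup>2) * e" by (simp add: power2_eq_square)
    then obtain t where "(i\<^sup>2 - 3 * a * i + 3 * a\<^sup>2) * e = 3 * t" by (rule dvdE)
    hence "3 * Sy x = 1 - 3 * t" using 1 by simp
    thus False by presburger
  qed
  hence "i mod 3 = 1 \<or> i mod 3 = 2" by presburger
  hence "i = 3 * (i div 3) + 1 \<or> i = 3 * (i div 3 + 1) + (-1)" by presburger
  then obtain c \<epsilon> where c: "i = 3 * c + \<epsilon>" "\<epsilon> = 1 \<or> \<epsilon> = (-1::int)" by blast
  define \<eta> where "\<eta> = x - (of_int c * l + of_int (a - c) * \<sigma> l)"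
  have "\<eta> \<in> \<O>" using x(1) O by (simp add: \<eta>_def)
  moreover have "3 * \<eta> = 1 + w - 3 * (of_int c * l + of_int (a - c) * \<sigma> l)"
    by (simp add: \<eta>_def w_def algebra_simps)
  hence "3 * \<eta> = 1 + of_int \<epsilon> * (l - \<sigma> l)"
    by (simp add: ij j c(1) algebra_simps)
  ultimately show ?thesis using that c(2) e3 by blast
qed

end

section \<open>Automorphisms and ramification of cyclotomic fields\<close>

text \<open>The automorphism with \<open>\<zeta> \<mapsto> \<zeta>\<^sup>a\<close>, on elements written as \<open>g(\<zeta>)/D\<close>. For \<open>a\<close> prime to \<open>m\<close> the value does not
  depend on the representation, by \<open>root_of_unity_conjugate\<close>.\<close>

definition cyc_conj :: "nat \<Rightarrow> nat \<Rightarrow> complex \<Rightarrow> complex" where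
  "cyc_conj m a x = (SOME y. \<exists>D g. D > (0::nat) \<and> of_nat D * x = ipoly_at g (root_unity m) \<and>
     of_nat D * y = ipoly_at g (root_unity m ^ a))"

lemma cyc_conj_eq:
  assumes m: "m > 0" and a: "coprime a m" and D: "D > (0::nat)" "of_nat D * x = ipoly_at g (root_unity m)"
  shows "of_nat D * cyc_conj m a x = ipoly_at g (root_unity m ^ a)"
proof -
  have "\<exists>y D g. D > (0::nat) \<and> of_nat D * x = ipoly_at g (root_unity m) \<and>
     of_nat D * y = ipoly_at g (root_unity m ^ a)"
    using D by (intro exI[of _ "ipoly_at g (root_unity m ^ a) / of_nat D"] exI[of _ D] exI[of _ g]) simp
  hence "\<exists>D g. D > (0::nat) \<and> of_nat D * x = ipoly_at g (root_unity m) \<and>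
     of_nat D * cyc_conj m a x = ipoly_at g (root_unity m ^ a)"
    unfolding cyc_conj_def by (rule someI_ex)
  then obtain E h where E: "E > (0::nat)" "of_nat E * x = ipoly_at h (root_unity m)"
    "of_nat E * cyc_conj m a x = ipoly_at h (root_unity m ^ a)" by blast
  have "ipoly_at (of_nat D * h - of_nat E * g) (root_unity m) = 0"
    by (simp flip: D(2) E(2))
  hence "ipoly_at (of_nat D * h - of_nat E * g) (root_unity m ^ a) = 0"
    using root_of_unity_conjugate[OF root_unity_power_self[OF m] m a] by blast
  hence "of_nat E * (of_nat D * cyc_conj m a x) = of_nat E * ipoly_at g (root_unity m ^ a)"
    by (simp flip: E(3) add: mult_ac)
  thus ?thesis using E(1) by simp
qed

context
  fixes m :: nat
  assumes m: "m > 0"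
begin

lemma cyclotomic_repr:
  assumes "x \<in> cyclotomic_field m"
  obtains D g where "D > (0::nat)" "of_nat D * x = ipoly_at g (root_unity m)"
  using cyclotomic_field_denominator[OF m assms] unfolding int_adjoin_def by blast

lemma cyc_conj_add:
  assumes a: "coprime a m" and xy: "x \<in> cyclotomic_field m" "y \<in> cyclotomic_field m"
  shows "cyc_conj m a (x + y) = cyc_conj m a x + cyc_conj m a y"
proof -
  obtain D g E h where D: "D > 0" "of_nat D * x = ipoly_at g (root_unity m)"
    and E: "E > 0" "of_nat E * y = ipoly_at h (root_unity m)"
    using cyclotomic_repr xy by metis
  have "of_nat (D * E) * (x + y) = of_nat E * (of_nat D * x) + of_nat D * (of_nat E * y)"
    by (simp add: algebra_simps)
  hence "of_nat (D * E) * (x + y) = ipoly_at (of_nat E * g + of_nat D * h) (root_unity m)"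
    by (simp only: D E ipoly_at_simps)
  hence "of_nat (D * E) * cyc_conj m a (x + y) = ipoly_at (of_nat E * g + of_nat D * h) (root_unity m ^ a)"
    using D E by (intro cyc_conj_eq m a) auto
  also have "\<dots> = of_nat E * (of_nat D * cyc_conj m a x) + of_nat D * (of_nat E * cyc_conj m a y)"
    using cyc_conj_eq[OF m a D] cyc_conj_eq[OF m a E] by simp
  also have "\<dots> = of_nat (D * E) * (cyc_conj m a x + cyc_conj m a y)" by (simp add: algebra_simps)
  moreover have "(of_nat (D * E) :: complex) \<noteq> 0" using D E by simp
  ultimately show ?thesis by (metis mult_left_cancel)
qed

lemma cyc_conj_mult:
  assumes a: "coprime a m" and xy: "x \<in> cyclotomic_field m" "y \<in> cyclotomic_field m"
  shows "cyc_conj m a (x * y) = cyc_conj m a x * cyc_conj m a y"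
proof -
  obtain D g E h where D: "D > 0" "of_nat D * x = ipoly_at g (root_unity m)"
    and E: "E > 0" "of_nat E * y = ipoly_at h (root_unity m)"
    using cyclotomic_repr xy by metis
  have "of_nat (D * E) * (x * y) = (of_nat D * x) * (of_nat E * y)"
    by (simp add: algebra_simps)
  hence "of_nat (D * E) * (x * y) = ipoly_at (g * h) (root_unity m)"
    by (simp only: D E ipoly_at_simps)
  hence "of_nat (D * E) * cyc_conj m a (x * y) = ipoly_at (g * h) (root_unity m ^ a)"
    using D E by (intro cyc_conj_eq m a) auto
  also have "\<dots> = (of_nat D * cyc_conj m a x) * (of_nat E * cyc_conj m a y)"
    using cyc_conj_eq[OF m a D] cyc_conj_eq[OF m a E] by simp
  also have "\<dots> = of_nat (D * E) * (cyc_conj m a x * cyc_conj m a y)" by (simp add: algebra_simps)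
  moreover have "(of_nat (D * E) :: complex) \<noteq> 0" using D E by simp
  ultimately show ?thesis by (metis mult_left_cancel)
qed

lemma cyc_conj_Rats:
  assumes a: "coprime a m" and x: "x \<in> \<rat>"
  shows "cyc_conj m a x = x"
proof -
  obtain k d where kd: "d > 0" "x = of_int k / of_int d" using x by (rule Rats_cases')
  hence "of_nat (nat d) * x = ipoly_at (of_int k) (root_unity m)" by simp
  hence "of_nat (nat d) * cyc_conj m a x = ipoly_at (of_int k) (root_unity m ^ a)"
    using kd by (intro cyc_conj_eq m a) auto
  also have "\<dots> = of_nat (nat d) * x" using kd by simp
  finally have "of_nat (nat d) * cyc_conj m a x = of_nat (nat d) * x" .
  moreover have "(of_nat (nat d) :: complex) \<noteq> 0" using kd(1) by simp
  ultimately show ?thesis by (metis mult_left_cancel)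
qed

lemma root_unity_power_cong:
  assumes "[a = b] (mod m)"
  shows "root_unity m ^ a = root_unity m ^ b"
proof -
  have "root_unity m ^ a = root_unity m ^ (a mod m)" for a
  proof -
    have "root_unity m ^ a = root_unity m ^ (m * (a div m) + a mod m)" by simp
    also have "\<dots> = root_unity m ^ (a mod m)"
      using root_unity_power_self[OF m] unfolding power_add power_mult by simp
    finally show ?thesis .
  qed
  thus ?thesis using assms unfolding cong_def by metis
qed

lemma cyc_conj_cong:
  "[a = b] (mod m) \<Longrightarrow> cyc_conj m a x = cyc_conj m b x"
  using root_unity_power_cong[of a b] by (simp add: cyc_conj_def)

lemma cyc_conj_1:
  assumes "x \<in> cyclotomic_field m"
  shows "cyc_conj m 1 x = x"
proof -
  obtain D g where D: "D > 0" "of_nat D * x = ipoly_at g (root_unity m)"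
    using cyclotomic_repr[OF assms] by blast
  have "of_nat D * cyc_conj m 1 x = of_nat D * x"
    using cyc_conj_eq[OF m _ D, of 1] D(2) by simp
  thus ?thesis using D(1) by simp
qed

lemma cyc_conj_comp:
  assumes a: "coprime a m" and b: "coprime b m" and x: "x \<in> cyclotomic_field m"
  shows "cyc_conj m a (cyc_conj m b x) = cyc_conj m (a * b) x"
proof -
  obtain D g where D: "D > 0" "of_nat D * x = ipoly_at g (root_unity m)"
    using cyclotomic_repr[OF x] by blast
  have "of_nat D * cyc_conj m b x = ipoly_at (pcompose g (monom 1 b)) (root_unity m)"
    using cyc_conj_eq[OF m b D] by simp
  hence "of_nat D * cyc_conj m a (cyc_conj m b x) = ipoly_at (pcompose g (monom 1 b)) (root_unity m ^ a)"
    by (rule cyc_conj_eq[OF m a D(1)])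
  also have "\<dots> = ipoly_at g (root_unity m ^ (a * b))" by (simp add: power_mult)
  also have "\<dots> = of_nat D * cyc_conj m (a * b) x"
    using cyc_conj_eq[OF m _ D, of "a * b"] a b by simp
  finally show ?thesis using D(1) by simp
qed

end

lemma power_eq_1_coprime:
  fixes w :: complex
  assumes "w ^ p = 1" "w ^ j = 1" "coprime j p" "p > 0"
  shows "w = 1"
proof -
  obtain u where u: "[j * u = 1] (mod p)" using cong_solve_coprime_nat[OF assms(3)] by auto
  have md: "w ^ a = w ^ (a mod p)" for a
  proof -
    have "w ^ a = w ^ (p * (a div p) + a mod p)" by simp
    also have "\<dots> = w ^ (a mod p)" using assms(1) unfolding power_add power_mult by simp
    finally show ?thesis .
  qed
  have "w ^ (j * u) = w ^ 1" using md u unfolding cong_def by metis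
  thus ?thesis using assms(2) by (simp add: power_mult)
qed

lemma coprime_one_add_mult:
  assumes "prime (p::nat)"
  shows "coprime (1 + n * t) (p * n) \<longleftrightarrow> \<not> p dvd 1 + n * t"
proof -
  have "coprime (1 + n * t) n"
    by (metis coprime_1_left coprime_iff_gcd_eq_1 gcd.commute gcd_add_mult mult.commute add.commute)
  hence "coprime (1 + n * t) (p * n) \<longleftrightarrow> coprime (1 + n * t) p" by simp
  also have "\<dots> \<longleftrightarrow> \<not> p dvd 1 + n * t"
    using assms by (metis coprime_commute coprime_absorb_left not_prime_unit prime_imp_coprime)
  finally show ?thesis .
qed

text \<open>Average \<open>x\<close> over the automorphisms with \<open>a \<equiv> 1\<close> modulo \<open>n\<close>. For a power of \<open>\<zeta>\<close> whose exponent is divisible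
  by \<open>p\<close> every conjugate lies in the field of \<open>n\<close>-th roots of unity. For the other exponents the sum
  over all \<open>a = 1 + n t\<close> is a vanishing geometric sum, so the sum over the \<open>a\<close> prime to \<open>p\<close> is minus the sum over
  the multiples \<open>a\<close> of \<open>p\<close>, whose terms lie in that field.\<close>

lemma cyclotomic_descent:
  assumes p: "prime p" and n: "n > 0" and x: "x \<in> cyclotomic_field (p * n)"
    and inv: "\<And>a. coprime a (p * n) \<Longrightarrow> [a = 1] (mod n) \<Longrightarrow> cyc_conj (p * n) a x = x"
  shows "x \<in> cyclotomic_field n"
proof -
  define m where "m = p * n"
  define z where "z = root_unity m"
  have p0: "p > 0" using p by (rule prime_gt_0_nat)
  have m: "m > 0" using p0 n by (simp add: m_def)
  have zp: "z ^ p = root_unity n" unfolding z_def m_def by (rule root_unity_mult_power[OF n p0])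
  have zn: "z ^ n = root_unity p"
    unfolding z_def m_def mult.commute[of p] by (rule root_unity_mult_power[OF p0 n])
  obtain D g where D: "D > 0" "of_nat D * x = ipoly_at g z"
    using cyclotomic_repr[OF m] x unfolding m_def z_def by blast
  define T where "T = {t. t < p \<and> \<not> p dvd 1 + n * t}"
  \<comment> \<open>The numbers \<open>1 + n t\<close> are prime to \<open>n\<close>, so those with \<open>t\<close> in \<open>T\<close> are prime to \<open>p n\<close>.\<close>
  define T' where "T' = {t. t < p \<and> p dvd 1 + n * t}"
  have fin: "finite T" "finite T'" by (simp_all add: T_def T'_def)
  have in_n: "z ^ k \<in> int_adjoin (root_unity n)" if dvd: "p dvd k" for k
  proof -
    obtain c where "k = p * c" using dvd by (rule dvdE)
    hence "z ^ k = root_unity n ^ c" by (simp add: power_mult zp)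
    thus ?thesis by (simp add: int_adjoin_power int_adjoin_self)
  qed
  have mono: "(\<Sum>t\<in>T. (z ^ (1 + n * t)) ^ j) \<in> int_adjoin (root_unity n)" for j
  proof (cases "p dvd j")
    case True
    show ?thesis
    proof (rule int_adjoin_sum)
      fix t
      have "p dvd (1 + n * t) * j" using True by (rule dvd_mult)
      thus "(z ^ (1 + n * t)) ^ j \<in> int_adjoin (root_unity n)"
        using in_n by (simp only: power_mult[symmetric])
    qed
  next
    case False
    hence cop: "coprime j p" using p by (metis coprime_commute prime_imp_coprime)
    define w where "w = root_unity p ^ j"
    have wp: "w ^ p = 1"
      unfolding w_def power_mult[symmetric] mult.commute[of j] by (simp add: power_mult root_unity_power_self[OF p0])
    have w1: "w \<noteq> 1"
    proof
      assume "w = 1"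
      hence "root_unity p = 1"
        unfolding w_def using power_eq_1_coprime[OF root_unity_power_self[OF p0] _ cop p0] by blast
      thus False using root_unity_prime_neq_1 prime_gt_1_nat[OF p] by blast
    qed
    have summand: "(z ^ (1 + n * t)) ^ j = z ^ j * w ^ t" for t
      by (simp add: w_def power_add power_mult zn power_mult_distrib flip: zn) 
         (simp add: mult_ac flip: power_mult)
    have "(\<Sum>t<p. (z ^ (1 + n * t)) ^ j) = z ^ j * (\<Sum>t<p. w ^ t)"
      by (simp only: summand sum_distrib_left)
    also have "(\<Sum>t<p. w ^ t) = 0" using w1 wp by (simp add: geometric_sum)
    finally have "(\<Sum>t<p. (z ^ (1 + n * t)) ^ j) = 0" by simp
    moreover have "{..<p} = T \<union> T'" "T \<inter> T' = {}" by (auto simp: T_def T'_def)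
    ultimately have "(\<Sum>t\<in>T. (z ^ (1 + n * t)) ^ j) + (\<Sum>t\<in>T'. (z ^ (1 + n * t)) ^ j) = 0"
      using fin by (simp add: sum.union_disjoint)
    hence "(\<Sum>t\<in>T. (z ^ (1 + n * t)) ^ j) = of_int (-1) * (\<Sum>t\<in>T'. (z ^ (1 + n * t)) ^ j)"
      by (simp add: add_eq_0_iff)
    also have "\<dots> \<in> int_adjoin (root_unity n)"
    proof (intro int_adjoin_mult int_adjoin_of_int int_adjoin_sum)
      fix t assume "t \<in> T'"
      hence "p dvd 1 + n * t" by (simp only: T'_def mem_Collect_eq)
      hence "p dvd (1 + n * t) * j" by (rule dvd_mult2)
      thus "(z ^ (1 + n * t)) ^ j \<in> int_adjoin (root_unity n)"
        using in_n by (simp only: power_mult[symmetric])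
    qed
    finally show ?thesis .
  qed
  have all: "(\<Sum>t\<in>T. ipoly_at g (z ^ (1 + n * t))) \<in> int_adjoin (root_unity n)" for g
  proof -
    have "ipoly_at g y = (\<Sum>j\<le>degree g. of_int (coeff g j) * y ^ j)" for y
      by (simp add: ipoly_at_def poly_altdef coeff_map_poly)
    hence "(\<Sum>t\<in>T. ipoly_at g (z ^ (1 + n * t)))
      = (\<Sum>t\<in>T. \<Sum>j\<le>degree g. of_int (coeff g j) * (z ^ (1 + n * t)) ^ j)" by (simp only:)
    also have "\<dots> = (\<Sum>j\<le>degree g. of_int (coeff g j) * (\<Sum>t\<in>T. (z ^ (1 + n * t)) ^ j))"
      unfolding sum_distrib_left by (rule sum.swap)
    also have "\<dots> \<in> int_adjoin (root_unity n)"
      by (rule int_adjoin_sum, rule int_adjoin_mult[OF int_adjoin_of_int mono])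
    finally show ?thesis .
  qed
  have "ipoly_at g (z ^ (1 + n * t)) = of_nat D * x" if "t \<in> T" for t
  proof -
    have cop: "coprime (1 + n * t) m"
      using that p unfolding T_def m_def by (subst coprime_one_add_mult) auto
    have "[1 + n * t = 1 + 0] (mod n)" by (intro cong_add cong_refl) (simp add: cong_0_iff)
    hence "[1 + n * t = 1] (mod n)" by (simp only: add_0_right)
    hence "cyc_conj m (1 + n * t) x = x" using inv cop by (simp only: m_def)
    thus ?thesis using cyc_conj_eq[OF m cop D[unfolded z_def]] by (simp add: z_def)
  qed
  hence "(\<Sum>t\<in>T. ipoly_at g (z ^ (1 + n * t))) = of_nat (card T * D) * x" by simp
  hence "of_nat (card T * D) * x \<in> int_adjoin (root_unity n)" using all[of g] by simp
  moreover have "0 \<in> T" using p0 p by (auto simp: T_def)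
  hence "card T * D > 0" using D(1) fin by (auto simp: card_gt_0_iff)
  ultimately show ?thesis by (rule cyclotomic_fieldI[rotated])
qed

text \<open>For \<open>p\<close> prime to \<open>m\<close> a power of the Frobenius map is the identity on \<open>\<int>[\<zeta>]/p\<close>, so this ring has no nilpotent
  elements. A multiple of \<open>x\<close> by a number prime to \<open>p\<close> lies in \<open>\<int>[\<zeta>]\<close>.\<close>

lemma unramified_cube:
  assumes m: "m > 0" and p: "prime p" "\<not> p dvd m" and x: "x \<in> cyclotomic_field m"
    "algebraic_int x" "algebraic_int (x ^ 3 / of_nat p)"
  shows "algebraic_int (x / of_nat p)"
proof -
  define z where "z = root_unity m"
  have zm: "z ^ (p ^ 0 * m) = 1" using root_unity_power_self[OF m] by (simp add: z_def)
  have zi: "algebraic_int z" using algebraic_int_root_of_unity[of z m] zm m by simp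
  have cop: "coprime p m" using p by (rule prime_imp_coprime)
  have p0: "p > 0" using p(1) by (rule prime_gt_0_nat)
  have frob: "\<exists>n\<ge>B. \<exists>s\<in>int_adjoin z. r - r ^ n = of_nat p * s" if "r \<in> int_adjoin z" for r B
  proof (rule root_of_unity_frobenius[OF p(1) cop zm _ _ that])
    show "\<exists>s\<in>int_adjoin z. of_nat p = of_nat p * s"
      by (intro bexI[of _ 1]) (use int_adjoin_of_int[of 1 z] in auto)
    show "\<exists>s\<in>int_adjoin z. 1 - z ^ m = of_nat p * s"
      using zm by (intro bexI[of _ 0]) (use int_adjoin_of_int[of 0 z] in auto)
  qed
  have desc: "y \<in> int_adjoin z" if "algebraic_int y" "of_nat p * y \<in> int_adjoin z" for y
    by (rule int_adjoin_integral_descent[OF frob int_adjoin_of_nat _ that]) (use p0 in auto)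
  obtain D where D: "D > 0" "of_nat D * x \<in> int_adjoin z"
    using cyclotomic_field_denominator[OF m x(1)] by (auto simp: z_def)
  have one: "1 \<in> int_adjoin z" using int_adjoin_of_int[of 1 z] by simp
  have "(of_nat p :: complex) ^ 1 = of_nat p * 1" by simp
  then obtain E where E: "coprime E p" "E > 0" "of_nat E * x \<in> int_adjoin z"
    using prime_to_p_denominator[OF desc algebraic_int_of_nat one _ p(1) x(2) D] by blast
  \<comment> \<open>An exponent of at least 3 makes the power \<open>x\<^sup>n\<close> a multiple of \<open>x\<^sup>3\<close>, and so of \<open>p\<close>.\<close>
  obtain n s where n: "n \<ge> 3" "s \<in> int_adjoin z" "of_nat E * x - (of_nat E * x) ^ n = of_nat p * s"
    using frob[OF E(3)] by blast
  have "(of_nat E * x) ^ n = of_nat E ^ n * (x ^ (n - 3) * x ^ 3)"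
    using n(1) by (simp add: power_mult_distrib flip: power_add)
  hence eq0: "of_nat E * x = of_nat p * s + of_nat E ^ n * (x ^ (n - 3) * x ^ 3)"
    using n(3) by (simp add: algebra_simps)
  have "of_nat E * (x / of_nat p) = (of_nat E * x) / of_nat p" by simp
  also have "\<dots> = s + of_nat E ^ n * (x ^ (n - 3) * (x ^ 3 / of_nat p))"
    unfolding eq0 using p0 by (simp add: add_divide_distrib)
  finally have eq: "of_nat E * (x / of_nat p) = s + of_nat E ^ n * (x ^ (n - 3) * (x ^ 3 / of_nat p))" .
  have "algebraic_int (of_nat E ^ n * (x ^ (n - 3) * (x ^ 3 / of_nat p)))"
    by (intro algebraic_int_mult[OF algebraic_int_power[OF algebraic_int_of_nat] algebraic_int_mult[OF algebraic_int_power[OF x(2)] x(3)]])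
  hence "algebraic_int (of_nat E * (x / of_nat p))"
    unfolding eq by (intro algebraic_int_add algebraic_int_int_adjoin[OF zi n(2)])
  moreover have "algebraic_int (of_nat p * (x / of_nat p))" using x(2) p0 by simp
  moreover have "coprime (int E) (int p)" using E(1) by simp
  ultimately show ?thesis
    using algebraic_int_divide_coprime[of "int E" "x / of_nat p" "int p"] by simp
qed

lemma one_minus_power_dvd:
  assumes "w \<in> int_adjoin z"
  shows "\<exists>s\<in>int_adjoin z. 1 - w ^ t = (1 - w) * s"
  using assms by (intro bexI[of _ "\<Sum>i<t. w ^ i"])
    (auto simp: one_diff_power_eq intro: int_adjoin_sum int_adjoin_power)

lemma prime_3_nat: "prime (3 :: nat)" by simp

context
  fixes m p k l :: nat
  assumes p: "prime p" and k: "k > 0" and m_eq: "m = p ^ k * l" and cop: "coprime p l" and l: "l > 0"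
begin

text \<open>For \<open>m = p\<^sup>k l\<close> with \<open>p\<close> prime to \<open>l\<close> this is \<open>1 - \<zeta>\<close> for a root of unity \<open>\<zeta>\<close> of order \<open>p\<^sup>k\<close>, a local parameter at
  the primes above \<open>p\<close>.\<close>

definition unif :: complex where "unif = 1 - root_unity m ^ l"

lemma modulus_pos: "m > 0" using p l by (simp add: m_eq prime_gt_0_nat)

lemma unif_in: "unif \<in> int_adjoin (root_unity m)"
  using int_adjoin_of_int[of 1] unfolding unif_def
  by (intro int_adjoin_diff int_adjoin_power int_adjoin_self) simp

lemma root_unity_l: "root_unity m ^ l = root_unity (p ^ k)"
  using root_unity_mult_power[of "p ^ k" l] p l prime_gt_0_nat[OF p] by (simp add: m_eq mult.commute)

lemma unif_nonzero: "unif \<noteq> 0"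
proof -
  have "p ^ k > 1" using k prime_gt_1_nat[OF p] by (rule one_less_power[rotated])
  thus ?thesis using root_unity_prime_neq_1[of "p ^ k"] by (simp add: unif_def root_unity_l)
qed

text \<open>The value at 1 of \<open>1 + x + \<dots> + x\<^sup>p\<^sup>-\<^sup>1\<close> minus its value at a root of unity of order \<open>p\<close>, which is 0, exhibits \<open>p\<close>
  as a sum of multiples of \<open>1 - \<zeta>\<close>.\<close>

lemma unif_dvd_p: "\<exists>s\<in>int_adjoin (root_unity m). of_nat p = unif * s"
proof -
  define z where "z = root_unity m"
  define w where "w = z ^ (l * p ^ (k - 1))"
  have p0: "p > 0" using p by (rule prime_gt_0_nat)
  have "m = (l * p ^ (k - 1)) * p" using k by (cases k) (simp_all add: m_eq mult_ac)
  hence w: "w = root_unity p"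
    using root_unity_mult_power[of p "l * p ^ (k - 1)"] p0 l by (simp add: w_def z_def)
  have "w \<noteq> 1" using w root_unity_prime_neq_1 prime_gt_1_nat[OF p] by simp
  moreover have "w ^ p = 1" using w root_unity_power_self[OF p0] by simp
  ultimately have "(\<Sum>j<p. w ^ j) = 0" by (simp add: geometric_sum)
  hence sum: "of_nat p = (\<Sum>j<p. 1 - w ^ j)" by (simp add: sum_subtractf)
  have "\<forall>j. \<exists>s\<in>int_adjoin z. 1 - w ^ j = unif * s"
  proof
    fix j
    have "w ^ j = (z ^ l) ^ (p ^ (k - 1) * j)" by (simp add: w_def mult.assoc flip: power_mult)
    thus "\<exists>s\<in>int_adjoin z. 1 - w ^ j = unif * s"
      using one_minus_power_dvd[OF int_adjoin_power[OF int_adjoin_self], of z l] by (simp add: unif_def z_def)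
  qed
  then obtain s where s: "\<And>j. s j \<in> int_adjoin z" "\<And>j. 1 - w ^ j = unif * s j" by metis
  have "of_nat p = unif * (\<Sum>j<p. s j)" unfolding sum s(2) by (simp add: sum_distrib_left)
  thus ?thesis using s(1) by (auto simp: z_def intro!: bexI[of _ "\<Sum>j<p. s j"] int_adjoin_sum)
qed

lemma p_dvd_unif_power: "\<exists>s\<in>int_adjoin (root_unity m). unif ^ (p ^ k) = of_nat p * s"
proof -
  define w where "w = root_unity m ^ l"
  obtain r where r: "r \<in> int_adjoin w"
    "ipoly_at [:1,-1:] w ^ (p ^ k) = ipoly_at [:1,-1:] (w ^ (p ^ k)) + of_nat p * r"
    using ipoly_at_frobenius[OF p, of w "[:1,-1:]" k] by blast
  have "w ^ (p ^ k) = 1"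
    using root_unity_power_self[of "p ^ k"] p prime_gt_0_nat[OF p] by (simp add: w_def root_unity_l)
  hence "unif ^ (p ^ k) = of_nat p * r" using r(2) by (simp add: unif_def w_def)
  moreover have "r \<in> int_adjoin (root_unity m)"
    using r(1) int_adjoin_subset[OF int_adjoin_power[OF int_adjoin_self]] by (auto simp: w_def)
  ultimately show ?thesis by blast
qed

lemma \<zeta>_int: "algebraic_int (root_unity m)"
  using algebraic_int_root_of_unity[OF root_unity_power_self modulus_pos] modulus_pos by blast

lemma unif_int: "algebraic_int unif"
  by (rule algebraic_int_int_adjoin[OF \<zeta>_int unif_in])

lemma unif_dvd_int:
  assumes "algebraic_int (of_int n / unif)"
  shows "int p dvd n"
proof -
  obtain s where s: "s \<in> int_adjoin (root_unity m)" "unif ^ (p ^ k) = of_nat p * s"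
    using p_dvd_unif_power by blast
  have p0: "p > 0" using p by (rule prime_gt_0_nat)
  have s0: "s \<noteq> 0" using s(2) unif_nonzero p0 by auto
  have "s * (of_int n / unif) ^ (p ^ k) = of_int (n ^ (p ^ k)) / of_int (int p)"
    using s0 by (simp add: power_divide s(2))
  moreover have "algebraic_int (s * (of_int n / unif) ^ (p ^ k))"
    using algebraic_int_int_adjoin[OF \<zeta>_int s(1)] assms by (intro algebraic_int_mult algebraic_int_power)
  ultimately have "int p dvd n ^ (p ^ k)"
    using algebraic_int_of_int_divide_iff[of "int p" "n ^ (p ^ k)"] p0 by simp
  thus ?thesis using p by (metis prime_dvd_power prime_nat_int_transfer)
qed

text \<open>Clear denominators by a number prime to \<open>p\<close>. Then \<open>x = g(\<zeta>)\<close> and its conjugate \<open>g(\<zeta>\<^sup>a)\<close> differ by a multiple of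
  \<open>\<zeta> - \<zeta>\<^sup>a\<close>, where \<open>\<zeta>\<^sup>a\<^sup>-\<^sup>1\<close> has \<open>p\<close>-power order because \<open>a \<equiv> 1\<close> modulo \<open>m/p\<close>.\<close>

lemma inertia:
  assumes a: "coprime a m" "[a = 1] (mod m div p)"
    and x: "x \<in> cyclotomic_field m" "algebraic_int x" "algebraic_int (cyc_conj m a x)"
  shows "algebraic_int ((x - cyc_conj m a x) / unif)"
proof -
  define z where "z = root_unity m"
  have p0: "p > 0" using p by (rule prime_gt_0_nat)
  have zm: "z ^ (p ^ k * l) = 1" using root_unity_power_self[OF modulus_pos] by (simp add: z_def flip: m_eq)
  have unifz: "unif \<in> int_adjoin z" unfolding z_def by (rule unif_in)
  have zunif: "1 - z ^ l = unif" by (simp add: unif_def z_def)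
  have one: "1 \<in> int_adjoin z" using int_adjoin_of_int[of 1 z] by simp
  have frob: "\<exists>n\<ge>B. \<exists>s\<in>int_adjoin z. r - r ^ n = unif * s" if "r \<in> int_adjoin z" for r B
    by (rule root_of_unity_frobenius[OF p cop zm _ _ that])
      (use unif_dvd_p zunif one in \<open>auto simp: z_def intro!: bexI[of _ 1]\<close>)
  have desc: "y \<in> int_adjoin z" if "algebraic_int y" "unif * y \<in> int_adjoin z" for y
    by (rule int_adjoin_integral_descent[OF frob unifz unif_nonzero that])
  obtain s where s: "s \<in> int_adjoin z" "unif ^ (p ^ k) = of_nat p * s"
    using p_dvd_unif_power by (auto simp: z_def)
  obtain D where D: "D > 0" "of_nat D * x \<in> int_adjoin z"
    using cyclotomic_field_denominator[OF modulus_pos x(1)] by (auto simp: z_def)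
  obtain E where E: "coprime E p" "E > 0" "of_nat E * x \<in> int_adjoin z"
    using prime_to_p_denominator[OF desc unif_int s p x(2) D] by blast
  obtain g where g: "of_nat E * x = ipoly_at g z" using E(3) by (auto simp: int_adjoin_def)
  have gc: "of_nat E * cyc_conj m a x = ipoly_at g (z ^ a)"
    using cyc_conj_eq[OF modulus_pos a(1) E(2) g[unfolded z_def]] by (simp add: z_def)
  obtain r where r: "r \<in> int_adjoin z" "ipoly_at g z - ipoly_at g (z ^ a) = (z - z ^ a) * r"
    using ipoly_at_diff_dvd[OF int_adjoin_self int_adjoin_power[OF int_adjoin_self]] by blast
  have "a > 0"
  proof (rule ccontr)
    assume "\<not> a > 0"
    hence "m = 1" using a(1) by simp
    thus False using k prime_gt_1_nat[OF p] by (simp add: m_eq)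
  qed
  then obtain t where t: "a = 1 + (m div p) * t"
    using a(2) by (metis cong_to_1_nat dvdE le_add_diff_inverse Suc_leI One_nat_def)
  have mp: "m div p = l * p ^ (k - 1)" using k p0 by (cases k) (simp_all add: m_eq)
  obtain s' where s': "s' \<in> int_adjoin z" "1 - (z ^ l) ^ (p ^ (k - 1) * t) = (1 - z ^ l) * s'"
    using one_minus_power_dvd[OF int_adjoin_power[OF int_adjoin_self]] by blast
  have "z - z ^ a = z * (1 - (z ^ l) ^ (p ^ (k - 1) * t))"
    unfolding t mp by (simp add: algebra_simps flip: power_mult power_Suc)
  hence "z - z ^ a = unif * (z * s')" unfolding s'(2) zunif by simp
  hence "of_nat E * (x - cyc_conj m a x) = unif * (z * s' * r)"
    using r(2) by (simp add: right_diff_distrib g gc)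
  hence "of_nat E * ((x - cyc_conj m a x) / unif) = z * s' * r"
    using unif_nonzero by (simp add: field_simps)
  hence 1: "algebraic_int (of_nat E * ((x - cyc_conj m a x) / unif))"
    using algebraic_int_int_adjoin[OF \<zeta>_int] r(1) s'(1) int_adjoin_self
    by (simp add: z_def int_adjoin_mult)
  obtain u where u: "u \<in> int_adjoin z" "of_nat p = unif * u" using unif_dvd_p by (auto simp: z_def)
  have "of_nat p * ((x - cyc_conj m a x) / unif) = u * (x - cyc_conj m a x)"
    unfolding u(2) using unif_nonzero by simp
  hence 2: "algebraic_int (of_nat p * ((x - cyc_conj m a x) / unif))"
    using algebraic_int_int_adjoin[OF \<zeta>_int] u(1) x(2,3)
    by (simp add: z_def algebraic_int_mult algebraic_int_diff)
  have "coprime (int E) (int p)" using E(1) by simp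
  thus ?thesis
    using algebraic_int_divide_coprime[of "int E" _ "int p"] 1 2 by simp
qed

end

section \<open>The conductor\<close>

locale conductor_field = trace_zero_basis +
  fixes m :: nat
  assumes m_pos: "m > 0" and F_sub: "F \<subseteq> cyclotomic_field m"
    and minimal: "n > 0 \<Longrightarrow> F \<subseteq> cyclotomic_field n \<Longrightarrow> m \<le> n"
begin

lemma cyc_conj_is_conjugate:
  assumes "coprime a m"
  shows "\<exists>i<3. \<forall>x\<in>F. cyc_conj m a x = (\<sigma> ^^ i) x"
  using F_sub by (intro embedding_is_conjugate cyc_conj_add cyc_conj_mult cyc_conj_Rats m_pos assms) auto

lemma cyc_conj_power:
  assumes "coprime a m" "\<forall>x\<in>F. cyc_conj m a x = (\<sigma> ^^ i) x" "x \<in> F"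
  shows "cyc_conj m (a ^ n) x = (\<sigma> ^^ (i * n)) x"
proof (induction n)
  case 0
  show ?case using cyc_conj_1[OF m_pos] F_sub assms(3) by auto
next
  case (Suc n)
  have "cyc_conj m (a ^ Suc n) x = cyc_conj m a (cyc_conj m (a ^ n) x)"
    using cyc_conj_comp[OF m_pos assms(1), of "a ^ n" x] assms F_sub by auto
  also have "\<dots> = (\<sigma> ^^ i) ((\<sigma> ^^ (i * n)) x)" using assms Suc.IH by simp
  finally show ?case by (simp add: funpow_add)
qed

text \<open>If no such automorphism moved \<open>F\<close>, then \<open>F\<close> would lie in the field of \<open>m/p\<close>-th roots of unity.\<close>

lemma inertia_witness:
  assumes p: "prime p" "p dvd m"
  obtains a i where "coprime a m" "[a = 1] (mod m div p)" "i = 1 \<or> i = 2"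
    "\<forall>x\<in>F. cyc_conj m a x = (\<sigma> ^^ i) x"
proof -
  define n where "n = m div p"
  have m_eq: "m = p * n" using p(2) by (simp add: n_def)
  have n: "n > 0" using m_pos m_eq by (intro gr0I) auto
  have "n < m" using prime_gt_1_nat[OF p(1)] n by (simp add: m_eq)
  hence "\<not> F \<subseteq> cyclotomic_field n" using minimal[OF n] by auto
  then obtain x where x: "x \<in> F" "x \<notin> cyclotomic_field n" by blast
  obtain a where a: "coprime a m" "[a = 1] (mod n)" "cyc_conj m a x \<noteq> x"
    using cyclotomic_descent[OF p(1) n, of x] x F_sub by (auto simp: m_eq)
  obtain i where i: "i < 3" "\<forall>x\<in>F. cyc_conj m a x = (\<sigma> ^^ i) x"
    using cyc_conj_is_conjugate[OF a(1)] by blast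
  have "i \<noteq> 0" using i(2) x(1) a(3) by (metis funpow_0)
  hence "i = 1 \<or> i = 2" using i(1) by linarith
  thus ?thesis using that[of a i] a i by (simp add: n_def)
qed

text \<open>An automorphism that moves \<open>F\<close> has order 3 on \<open>F\<close>.\<close>

lemma power_not_cong_1:
  assumes "coprime a m" "i = 1 \<or> i = 2" "\<forall>x\<in>F. cyc_conj m a x = (\<sigma> ^^ i) x"
    and "[a ^ n = 1] (mod m)"
  shows "3 dvd n"
proof -
  have "(\<sigma> ^^ (i * n)) x = x" if x: "x \<in> F" for x
  proof -
    have "(\<sigma> ^^ (i * n)) x = cyc_conj m (a ^ n) x"
      using cyc_conj_power[OF assms(1,3) x] by simp
    also have "\<dots> = cyc_conj m 1 x" by (rule cyc_conj_cong[OF m_pos assms(4)])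
    also have "\<dots> = x" using cyc_conj_1[OF m_pos] F_sub x by auto
    finally show ?thesis .
  qed
  hence "3 dvd i * n" using funpow_eq_id_iff by blast
  thus ?thesis using assms(2) by (elim disjE) (simp, simp, presburger)
qed

lemma power_one_add_cong:
  assumes "(M::nat) dvd u\<^sup>2"
  shows "[(1 + u) ^ n = 1 + n * u] (mod M)"
proof (induction n)
  case (Suc n)
  have "[(1 + u) ^ Suc n = (1 + u) * (1 + n * u)] (mod M)"
    unfolding power_Suc by (intro cong_mult Suc cong_refl)
  also have "(1 + u) * (1 + n * u) = (1 + Suc n * u) + n * u\<^sup>2"
    by (simp add: algebra_simps power2_eq_square)
  also have "[\<dots> = (1 + Suc n * u) + 0] (mod M)"
    using assms by (intro cong_add cong_refl) (auto simp: cong_0_iff)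
  finally show ?case by simp
qed simp

text \<open>If \<open>p\<^sup>2\<close> divides \<open>m\<close>, every \<open>a \<equiv> 1\<close> modulo \<open>m/p\<close> satisfies \<open>a\<^sup>p \<equiv> 1\<close> modulo \<open>m\<close>.\<close>

lemma inertia_power:
  assumes p: "prime p" "p\<^sup>2 dvd m"
  shows "p = 3"
proof -
  have "p dvd m" using p(2) by (simp add: power2_eq_square dvd_mult_left)
  then obtain a i where a: "coprime a m" "[a = 1] (mod m div p)" "i = 1 \<or> i = 2"
    "\<forall>x\<in>F. cyc_conj m a x = (\<sigma> ^^ i) x" using inertia_witness[OF p(1)] by blast
  obtain c where c: "m = p\<^sup>2 * c" using p(2) by (rule dvdE)
  have p0: "p > 0" using p(1) by (rule prime_gt_0_nat)
  have mp: "m div p = p * c" using p0 by (simp add: c power2_eq_square)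
  have "a > 0" using a(1) \<open>p dvd m\<close> p(1) by (intro gr0I) auto
  then obtain t where t: "a = 1 + p * c * t"
    using a(2) unfolding mp by (metis cong_to_1_nat dvdE le_add_diff_inverse Suc_leI One_nat_def)
  have "[a ^ p = 1 + p * (p * c * t)] (mod m)"
    unfolding t by (rule power_one_add_cong) (simp add: c power2_eq_square mult_ac)
  also have "1 + p * (p * c * t) = 1 + m * t" by (simp add: c power2_eq_square mult_ac)
  also have "[\<dots> = 1 + 0] (mod m)" by (intro cong_add cong_refl) (simp add: cong_0_iff)
  also have "1 + 0 = (1 :: nat)" by simp
  finally have "3 dvd p" by (rule power_not_cong_1[OF a(1,3,4)])
  thus ?thesis using p(1) by (metis primes_dvd_imp_eq prime_3_nat)
qed

text \<open>If \<open>m/2\<close> is odd, \<open>a \<equiv> 1\<close> modulo \<open>m/2\<close> and \<open>a\<close> odd force \<open>a \<equiv> 1\<close> modulo \<open>m\<close>.\<close>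

lemma conductor_odd: "odd m"
proof
  assume m2: "even m"
  obtain a i where a: "coprime a m" "[a = 1] (mod m div 2)" "i = 1 \<or> i = 2"
    "\<forall>x\<in>F. cyc_conj m a x = (\<sigma> ^^ i) x" using inertia_witness[OF two_is_prime_nat m2] by blast
  have "\<not> 2\<^sup>2 dvd m" using inertia_power[OF two_is_prime_nat] by auto
  hence "odd (m div 2)" using m2 by (auto elim!: evenE)
  hence "coprime (m div 2) 2" by simp
  moreover have "odd a" using a(1) m2 coprime_common_divisor_nat[of a m 2] by auto
  hence "[a = 1] (mod 2)" by (simp add: cong_def odd_iff_mod_2_eq_one)
  ultimately have "[a = 1] (mod (m div 2) * 2)" using a(2) by (intro coprime_cong_mult_nat)
  hence "[a ^ 1 = 1] (mod m)" using m2 by simp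
  from power_not_cong_1[OF a(1,3,4) this] show False by simp
qed

text \<open>If 9 did not divide \<open>m\<close>, the inertia group at 3 would have order 2. If 27 divided \<open>m\<close>, each of its elements
  would be a cube: \<open>1 + (m/3) t\<close> is congruent to the cube of \<open>1 + (m/9) t\<close>.\<close>

lemma conductor_3:
  assumes "3 dvd m"
  shows "9 dvd m" "\<not> 27 dvd m"
proof -
  obtain a i where a: "coprime a m" "[a = 1] (mod m div 3)" "i = 1 \<or> i = 2"
    "\<forall>x\<in>F. cyc_conj m a x = (\<sigma> ^^ i) x" using inertia_witness[OF _ assms] prime_3_nat by blast
  have "a > 0" using a(1) assms by (intro gr0I) auto
  then obtain t where t: "a = 1 + (m div 3) * t"
    using a(2) by (metis cong_to_1_nat dvdE le_add_diff_inverse Suc_leI One_nat_def)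
  show "9 dvd m"
  proof (rule ccontr)
    assume n9: "\<not> 9 dvd m"
    have "\<not> 3 dvd m div 3" using n9 assms by presburger
    hence "coprime (m div 3) 3" using prime_3_nat by (metis coprime_commute prime_imp_coprime)
    moreover have "[a\<^sup>2 = 1] (mod 3)"
    proof -
      have "\<not> 3 dvd a" using a(1) assms coprime_common_divisor_nat[of a m 3] by auto
      hence "a mod 3 = 1 \<or> a mod 3 = 2" by presburger
      thus ?thesis unfolding cong_def power2_eq_square
        by (subst mod_mult_eq[symmetric]) auto
    qed
    moreover have "[a\<^sup>2 = 1\<^sup>2] (mod m div 3)" using a(2) by (rule cong_pow)
    ultimately have "[a\<^sup>2 = 1] (mod (m div 3) * 3)" by (intro coprime_cong_mult_nat) simp_all
    hence "[a\<^sup>2 = 1] (mod m)" using assms by simp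
    from power_not_cong_1[OF a(1,3,4) this] show False by simp
  qed
  show "\<not> 27 dvd m"
  proof
    assume "27 dvd m"
    then obtain c where c: "m = 27 * c" by (rule dvdE)
    define b where "b = 1 + 3 * c * t"
    have "b ^ 3 = (1 + m div 3 * t) + m * (c * t\<^sup>2 + c\<^sup>2 * t ^ 3)"
      by (simp add: b_def c power2_eq_square power3_eq_cube algebra_simps)
    hence ba: "[b ^ 3 = a] (mod m)" unfolding t cong_def by (metis mod_mult_self2)
    have "coprime (b ^ 3) m" using a(1) ba by (metis cong_gcd_eq coprime_iff_gcd_eq_1)
    hence b: "coprime b m" by simp
    obtain j where j: "\<forall>x\<in>F. cyc_conj m b x = (\<sigma> ^^ j) x"
      using cyc_conj_is_conjugate[OF b] by blast
    have "(\<sigma> ^^ i) x = x" if x: "x \<in> F" for x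
    proof -
      have "(\<sigma> ^^ i) x = cyc_conj m a x" using a(4) x by simp
      also have "\<dots> = cyc_conj m (b ^ 3) x" using cyc_conj_cong[OF m_pos ba] by simp
      also have "\<dots> = (\<sigma> ^^ (j * 3)) x" by (rule cyc_conj_power[OF b j x])
      also have "\<dots> = x" using funpow_eq_id_iff[of "j * 3"] x by simp
      finally show ?thesis .
    qed
    hence "3 dvd i" using funpow_eq_id_iff by blast
    thus False using a(3) by auto
  qed
qed

text \<open>All conjugates of an integer are congruent modulo the parameter \<open>\<tau>\<close>. Applied to \<open>l\<close>, with \<open>T(l) = 0\<close>, this
  makes \<open>e\<close> divisible by \<open>\<tau>\<close>; applied to any \<open>x\<close> it gives \<open>T(x) \<equiv> 3x\<close>, which is 0 modulo \<open>\<tau>\<close> when \<open>p = 3\<close>.\<close>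

lemma ramified:
  assumes p: "prime p" "p dvd m"
  shows "int p dvd e" "p = 3 \<Longrightarrow> wild"
proof -
  define k where "k = multiplicity p m"
  have m0: "m \<noteq> 0" using m_pos by simp
  obtain c where c: "m = p ^ k * c" "\<not> p dvd c"
    using multiplicity_decompose'[of m p] m0 p(1) not_prime_unit unfolding k_def by metis
  have k: "k > 0"
    unfolding k_def using p m0 by (simp add: prime_multiplicity_gt_zero_iff)
  have cop: "coprime p c" using p(1) c(2) by (rule prime_imp_coprime)
  have c0: "c > 0" using c m0 by (intro gr0I) auto
  note data = p(1) k c(1) cop c0
  define \<tau> where "\<tau> = unif m c"
  obtain a i where a: "coprime a m" "[a = 1] (mod m div p)" "i = 1 \<or> i = 2"
    "\<forall>x\<in>F. cyc_conj m a x = (\<sigma> ^^ i) x" by (rule inertia_witness[OF p])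
  have 1: "algebraic_int ((x - (\<sigma> ^^ i) x) / \<tau>)" if x: "x \<in> \<O>" for x
  proof -
    have xF: "x \<in> F" using x by (rule \<O>_F)
    have eq: "cyc_conj m a x = (\<sigma> ^^ i) x" using a(4) xF by blast
    have "(\<sigma> ^^ i) x \<in> \<O>" using a(3) x by (auto simp: numeral_2_eq_2)
    hence "algebraic_int (cyc_conj m a x)" unfolding eq by (rule \<O>_int)
    thus ?thesis
      using inertia[OF data a(1,2) _ \<O>_int[OF x]] F_sub xF unfolding eq \<tau>_def by blast
  qed
  have 2: "algebraic_int ((x - \<sigma> x) / \<tau>) \<and> algebraic_int ((x - \<sigma> (\<sigma> x)) / \<tau>)" if x: "x \<in> \<O>" for x
  \<comment> \<open>Whichever nontrivial power of \<open>\<sigma>\<close> the inertia element induces, using it for \<open>x\<close> and for \<open>\<sigma> x\<close> gives both.\<close>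
  proof (cases "i = 1")
    case True
    have s: "algebraic_int ((x - \<sigma> x) / \<tau>)" "algebraic_int ((\<sigma> x - \<sigma> (\<sigma> x)) / \<tau>)"
      using 1[of x] 1[of "\<sigma> x"] x True by simp_all
    have "(x - \<sigma> (\<sigma> x)) / \<tau> = (x - \<sigma> x) / \<tau> + (\<sigma> x - \<sigma> (\<sigma> x)) / \<tau>"
      by (simp add: diff_divide_distrib)
    thus ?thesis using s algebraic_int_add[OF s] by simp
  next
    case False
    hence i: "i = 2" using a(3) by simp
    have s: "algebraic_int ((x - \<sigma> (\<sigma> x)) / \<tau>)" "algebraic_int ((\<sigma> x - x) / \<tau>)"
      using 1[of x] 1[of "\<sigma> x"] x i by (simp_all add: numeral_2_eq_2 \<O>_F)
    have "(x - \<sigma> x) / \<tau> = - ((\<sigma> x - x) / \<tau>)" by (simp add: diff_divide_distrib)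
    thus ?thesis using s by simp
  qed
  have O: "l \<in> \<O>" "\<sigma> l \<in> \<O>" "\<sigma> (\<sigma> l) \<in> \<O>" using l by (simp_all add: L_\<O>)
  define u v where "u = l - \<sigma> l" and "v = l - \<sigma> (\<sigma> l)"
  have uv: "algebraic_int (u / \<tau>)" "algebraic_int (v / \<tau>)" "algebraic_int u" "algebraic_int v" "algebraic_int l"
    using 2[OF O(1)] O \<O>_int by (auto simp: u_def v_def)
  have "sy l = u * v - l * (u + v) + l * tr l"
    by (simp add: sy_def tr_def u_def v_def algebra_simps)
  hence "- of_int e = u * v - l * (u + v)" using L_tr[OF l(1)] sy_l by simp
  hence "of_int e = l * (u + v) - u * v" by (metis minus_diff_eq minus_minus)
  hence "of_int e / \<tau> = - (u / \<tau> * v - l * (u / \<tau> + v / \<tau>))"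
    by (simp add: diff_divide_distrib add_divide_distrib distrib_left)
  also have "algebraic_int \<dots>"
    unfolding algebraic_int_minus_iff
    by (rule algebraic_int_diff[OF algebraic_int_mult[OF uv(1,4)]
        algebraic_int_mult[OF uv(5) algebraic_int_add[OF uv(1,2)]]])
  finally have "algebraic_int (of_int e / \<tau>)" .
  thus "int p dvd e" unfolding \<tau>_def by (rule unif_dvd_int[OF data])
  show wild if p3: "p = 3"
    unfolding wild_def
  proof
    fix x assume x: "x \<in> \<O>"
    obtain s where s: "s \<in> int_adjoin (root_unity m)" "of_nat p = \<tau> * s"
      using unif_dvd_p[OF data] by (auto simp: \<tau>_def)
    have si: "algebraic_int s" by (rule algebraic_int_int_adjoin[OF \<zeta>_int[OF data] s(1)])
    have \<tau>0: "\<tau> \<noteq> 0" using unif_nonzero[OF data] by (simp add: \<tau>_def)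
    have "of_int (Tr x) = of_nat p * x - (x - \<sigma> x) - (x - \<sigma> (\<sigma> x))"
      using x p3 by (simp add: of_int_symmetric tr_def)
    hence "of_int (Tr x) / \<tau> = s * x - (x - \<sigma> x) / \<tau> - (x - \<sigma> (\<sigma> x)) / \<tau>"
      unfolding s(2) using \<tau>0 by (simp only: diff_divide_distrib) simp
    also have "algebraic_int \<dots>" using 2[OF x] \<O>_int[OF x] si by (intro algebraic_int_diff algebraic_int_mult) auto
    finally have "algebraic_int (of_int (Tr x) / \<tau>)" .
    hence "int p dvd Tr x" unfolding \<tau>_def by (rule unif_dvd_int[OF data])
    thus "3 dvd Tr x" by (simp add: p3)
  qed
qed

text \<open>Here \<open>l\<^sup>3/p\<close> is an integer and \<open>l/p\<close> is not.\<close>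

lemma prime_dvd_conductor:
  assumes p: "prime p" "int p dvd e" "p \<noteq> 3"
  shows "p dvd m"
proof (rule ccontr)
  assume np: "\<not> p dvd m"
  have O: "l \<in> \<O>" "l \<in> F" using l by (simp_all add: L_\<O> L_F)
  have "coprime p 3" using p(1,3) prime_3_nat by (simp add: primes_coprime)
  hence "coprime (int p) 3" by (metis coprime_int_iff of_nat_numeral)
  hence "l ^ 3 / of_int (int p) \<in> \<O>"
    using p O by (intro cube_divisible_tame) (auto simp: Tr_L l)
  hence "algebraic_int (l / of_nat p)"
    using unramified_cube[OF m_pos p(1) np, of l] O F_sub \<O>_int by auto
  hence "l / of_int (int p) \<in> \<O>" using O by (simp add: \<O>_def)
  thus False using l_not_divisible[of "int p"] prime_gt_1_nat[OF p(1)] by simp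
qed

text \<open>Here \<open>x = l - \<sigma> l\<close> has norm divisible by 3, so \<open>x\<^sup>3/3\<close> is an integer, but \<open>x/3\<close> is not.\<close>

lemma wild_3_dvd_conductor:
  assumes wild
  shows "3 dvd m"
proof (rule ccontr)
  assume n3: "\<not> 3 dvd m"
  have O: "l \<in> \<O>" "l \<in> F" using l by (simp_all add: L_\<O> L_F)
  define x where "x = l - \<sigma> l"
  have x: "x \<in> L" "x \<in> \<O>" "x \<in> F" using l by (simp_all add: x_def L_\<O> L_F)
  obtain i j where ij: "x = of_int i * l + of_int j * \<sigma> l" "3 dvd Nm x - (i ^ 3 + j ^ 3) * Nm l"
    using wild_Nm_L[OF assms x(1)] by blast
  have "of_int i * l + of_int j * \<sigma> l = of_int 1 * l + of_int (-1) * \<sigma> l"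
    using ij(1) by (simp add: x_def)
  hence "i = 1" "j = -1" by (rule coordinates_unique)+
  hence "3 dvd Nm x" using ij(2) by simp
  hence "x ^ 3 / of_int 3 \<in> \<O>" by (rule cube_divisible_wild[OF assms x(2)])
  hence "algebraic_int (x / of_nat 3)"
    using unramified_cube[OF m_pos prime_3_nat n3, of x] x F_sub \<O>_int by auto
  hence "x / of_int 3 \<in> \<O>" using x by (simp add: \<O>_def)
  moreover have "3 * tr (x / of_int 3) = tr x"
    using symmetric_scale(1)[of "x / 3" 3] x by simp
  hence "tr (x / of_int 3) = 0" using L_tr[OF x(1)] by simp
  ultimately have "x / of_int 3 \<in> L" by (simp add: L_def)
  then obtain a b :: int where "x / of_int 3 = of_int a * l + of_int b * \<sigma> l" using gen by blast
  hence "x = 3 * (of_int a * l + of_int b * \<sigma> l)" by (simp add: field_simps)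
  hence "of_int 1 * l + of_int (-1) * \<sigma> l = of_int (3 * a) * l + of_int (3 * b) * \<sigma> l"
    by (simp add: x_def algebra_simps)
  hence "1 = 3 * a" by (rule coordinates_unique)
  thus False by presburger
qed

lemma wild_iff: "wild \<longleftrightarrow> 3 dvd m"
  using wild_3_dvd_conductor ramified(2)[OF prime_3_nat] by blast

text \<open>Both sides have the same prime divisors. The exponents of \<open>p \<noteq> 3\<close> are at most 1 on both sides, and the
  exponents of 3 are both 2 in the wild case and both 0 otherwise.\<close>

theorem conductor_eq: "int m = (if wild then 3 * e else e)"
proof -
  define E where "E = nat (if wild then 3 * e else e)"
  have E0: "E > 0" using e_pos by (simp add: E_def)
  have iE: "int E = (if wild then 3 * e else e)" using e_pos by (simp add: E_def)
  have "multiplicity p m = multiplicity p E" if p: "prime p" for p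
  proof (cases "p = 3")
    case False
    have cop: "coprime (int p) 3"
      using primes_coprime[OF p prime_3_nat False] by (metis coprime_int_iff of_nat_numeral)
    have dvd: "p ^ n dvd E \<longleftrightarrow> int p ^ n dvd e" for n
    proof -
      have "p ^ n dvd E \<longleftrightarrow> int p ^ n dvd int E" by (metis of_nat_dvd_iff of_nat_power)
      also have "\<dots> \<longleftrightarrow> int p ^ n dvd e"
        using cop by (simp add: iE coprime_dvd_mult_right_iff)
      finally show ?thesis .
    qed
    have iff: "p dvd m \<longleftrightarrow> p dvd E"
      using dvd[of 1] ramified(1)[OF p] prime_dvd_conductor[OF p _ False] by auto
    have "\<not> p ^ Suc 1 dvd m" using inertia_power[OF p] False by (auto simp: numeral_2_eq_2)
    moreover have "\<not> (int p)\<^sup>2 dvd e"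
      using e_squarefree_away_from_3[of "int p"] p False by simp
    hence "\<not> p ^ Suc 1 dvd E" using dvd[of 2] by (simp add: numeral_2_eq_2)
    ultimately show ?thesis
      using iff by (cases "p dvd m") (auto simp: not_dvd_imp_multiplicity_0 multiplicity_eqI[of p 1])
  next
    case True
    show ?thesis
    proof (cases wild)
      case False
      have "\<not> 3 dvd m" using False wild_iff by simp
      moreover have "\<not> 3 dvd e" using tame_generator[OF False] by metis
      hence "\<not> 3 dvd int E" by (simp add: iE False)
      hence "\<not> 3 dvd E" by presburger
      ultimately show ?thesis by (simp add: True not_dvd_imp_multiplicity_0)
    next
      case w: True
      hence m3: "3 dvd m" using wild_iff by simp
      have "3 dvd e" using ramified(1)[OF prime_3_nat m3] by simp
      moreover have "\<not> 9 dvd e" by (rule wild_not_9_dvd_e[OF w])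
      ultimately have "9 dvd int E" "\<not> 27 dvd int E" by (simp_all add: iE w) presburger+
      hence "9 dvd E" "\<not> 27 dvd E" by presburger+
      hence "multiplicity 3 E = 2" by (intro multiplicity_eqI[of 3 2]) simp_all
      moreover have "multiplicity 3 m = 2"
        using conductor_3[OF m3] by (intro multiplicity_eqI[of 3 2]) simp_all
      ultimately show ?thesis by (simp add: True)
    qed
  qed
  hence "m = E" by (rule multiplicity_eq_nat[OF m_pos E0])
  thus ?thesis using iE by simp
qed

end

section \<open>Ideals of square-free norm\<close>

lemma squarefree_pos: "squarefree (q :: nat) \<Longrightarrow> q > 0"
  by (cases "q = 0") simp_all

lemma squarefree_dvdI:
  assumes q: "squarefree (q :: nat)" and dvd: "\<And>p. prime p \<Longrightarrow> p dvd q \<Longrightarrow> p dvd k"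
  shows "q dvd k"
proof (cases "k = 0")
  case False
  have q0: "q \<noteq> 0" using squarefree_pos[OF q] by simp
  show ?thesis
  proof (rule multiplicity_le_imp_dvd[OF q0])
    fix p :: nat assume p: "prime p"
    show "multiplicity p q \<le> multiplicity p k"
    proof (cases "p dvd q")
      case True
      hence "multiplicity p k \<ge> 1"
        using dvd[OF p True] False p by (intro multiplicity_geI) (auto simp: prime_gt_1_nat)
      moreover have "\<not> p ^ Suc 1 dvd q"
        using q p by (metis Suc_1 not_prime_unit squarefreeD)
      hence "multiplicity p q \<le> 1"
        using multiplicity_geI[of p q 2] q0 p not_less_eq_eq[of "multiplicity p q" 1] multiplicity_dvd'[of 2 p q]
        by (auto simp: numeral_2_eq_2)
      ultimately show ?thesis by simp
    qed (simp add: not_dvd_imp_multiplicity_0)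
  qed
qed simp

context cyclic_cubic
begin

abbreviation RO :: "complex ring" where "RO \<equiv> ring_of_integers F"

lemma RO_simps [simp]:
  "carrier RO = \<O>" "x \<otimes>\<^bsub>RO\<^esub> y = x * y" "\<one>\<^bsub>RO\<^esub> = 1" "\<zero>\<^bsub>RO\<^esub> = 0" "x \<oplus>\<^bsub>RO\<^esub> y = x + y"
  by (simp_all add: ring_of_integers_def \<O>_def)

lemma cring_RO: "cring RO"
proof (rule cringI)
  show "abelian_group RO"
  proof (rule abelian_groupI)
    fix x assume "x \<in> carrier RO"
    thus "\<exists>y\<in>carrier RO. y \<oplus>\<^bsub>RO\<^esub> x = \<zero>\<^bsub>RO\<^esub>" by (intro bexI[of _ "- x"]) simp_all
  qed simp_all
  show "comm_monoid RO" by (rule comm_monoidI) (simp_all add: mult_ac)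
qed (simp add: distrib_right)

lemma RO_minus [simp]: "x \<in> \<O> \<Longrightarrow> y \<in> \<O> \<Longrightarrow> x \<ominus>\<^bsub>RO\<^esub> y = x - y"
proof -
  assume xy: "x \<in> \<O>" "y \<in> \<O>"
  interpret R: cring RO by (rule cring_RO)
  have "\<ominus>\<^bsub>RO\<^esub> y = - y" by (rule R.minus_equality) (use xy in simp_all)
  thus ?thesis by (simp add: R.minus_eq)
qed

lemma ideal_facts:
  assumes I: "ideal I RO"
  shows "I \<subseteq> \<O>" "0 \<in> I" "\<And>x y. x \<in> I \<Longrightarrow> y \<in> I \<Longrightarrow> x + y \<in> I" "\<And>x y. x \<in> I \<Longrightarrow> y \<in> I \<Longrightarrow> x - y \<in> I"
    "\<And>x y. x \<in> I \<Longrightarrow> y \<in> \<O> \<Longrightarrow> y * x \<in> I"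
proof -
  interpret ideal I RO by (rule I)
  show sub: "I \<subseteq> \<O>" using a_subset by simp
  show "0 \<in> I" using zero_closed additive_subgroup.zero_closed[OF additive_subgroup_axioms] by simp
  show add: "x + y \<in> I" if "x \<in> I" "y \<in> I" for x y using additive_subgroup.a_closed[OF additive_subgroup_axioms that] by simp
  show mult: "y * x \<in> I" if "x \<in> I" "y \<in> \<O>" for x y using I_l_closed[of x y] that by simp
  show "x - y \<in> I" if "x \<in> I" "y \<in> I" for x y
    using add[OF that(1) mult[OF that(2), of "of_int (-1)"]] by simp
qed

lemma coset_eq_iff:
  assumes "ideal I RO" "x \<in> \<O>" "y \<in> \<O>"
  shows "I +>\<^bsub>RO\<^esub> x = I +>\<^bsub>RO\<^esub> y \<longleftrightarrow> x - y \<in> I"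
proof -
  interpret R: cring RO by (rule cring_RO)
  show ?thesis using R.quotient_eq_iff_same_a_r_cos[OF assms(1), of x y] assms by simp
qed

lemma carrier_Quot: "carrier (RO Quot I) = (\<lambda>x. I +>\<^bsub>RO\<^esub> x) ` \<O>"
  by (auto simp: FactRing_def A_RCOSETS_def' )

lemma Quot_add:
  assumes "ideal I RO" "x \<in> \<O>" "y \<in> \<O>"
  shows "(I +>\<^bsub>RO\<^esub> x) \<oplus>\<^bsub>RO Quot I\<^esub> (I +>\<^bsub>RO\<^esub> y) = I +>\<^bsub>RO\<^esub> (x + y)"
  using ideal.a_rcos_sum[OF assms(1), of x y] assms(2,3) by (simp add: FactRing_def)

lemma Quot_group:
  assumes "ideal I RO"
  shows "group (add_monoid (RO Quot I))"
proof -
  interpret Q: ring "RO Quot I" by (rule ideal.quotient_is_ring[OF assms])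
  show ?thesis by (rule Q.a_group)
qed

lemma Quot_pow:
  assumes I: "ideal I RO" and x: "x \<in> \<O>"
  shows "(I +>\<^bsub>RO\<^esub> x) [^]\<^bsub>add_monoid (RO Quot I)\<^esub> (n::nat) = I +>\<^bsub>RO\<^esub> (of_nat n * x)"
proof (induction n)
  case 0
  have "I +>\<^bsub>RO\<^esub> 0 = I"
    using I x by (intro abelian_subgroup.a_rcos_const)
      (auto intro: ideal_facts ideal.axioms(2) abelian_subgroupI3 ideal.axioms(1) ring.is_abelian_group)
  thus ?case by (simp add: nat_pow_def FactRing_def)
next
  case (Suc n)
  have "(I +>\<^bsub>RO\<^esub> x) [^]\<^bsub>add_monoid (RO Quot I)\<^esub> Suc n
    = (I +>\<^bsub>RO\<^esub> (of_nat n * x)) \<oplus>\<^bsub>RO Quot I\<^esub> (I +>\<^bsub>RO\<^esub> x)"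
    using Suc.IH by (simp add: nat_pow_def)
  also have "\<dots> = I +>\<^bsub>RO\<^esub> (of_nat (Suc n) * x)"
    using Quot_add[OF I, of "of_nat n * x" x] x by (simp add: algebra_simps)
  finally show ?case .
qed

text \<open>By Cauchy's theorem each prime \<open>p\<close> dividing \<open>q\<close> is the order of some \<open>x\<close> modulo \<open>I\<close>. As \<open>k\<close> annihilates the
  quotient, \<open>p\<close> divides \<open>k\<close>; since \<open>q\<close> is square-free, so does \<open>q\<close>.\<close>

lemma ideal_Int_norm:
  assumes I: "ideal I RO" and q: "ideal_norm F I = q" "squarefree q" and k: "of_int k \<in> I"
  shows "int q dvd k"
proof -
  let ?G = "add_monoid (RO Quot I)"
  interpret G: group ?G by (rule Quot_group[OF I])
  have card: "card (carrier ?G) = q" using q(1) by (simp add: ideal_norm_def)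
  have q0: "q > 0" by (rule squarefree_pos[OF q(2)])
  have fin: "finite (carrier ?G)" using card q0 card_ge_0_finite by metis
  have one: "\<one>\<^bsub>?G\<^esub> = I" by (simp add: FactRing_def)
  have prime_case: "int p dvd k" if p: "prime p" "p dvd q" for p
  proof (rule ccontr)
    assume npk: "\<not> int p dvd k"
    obtain c where c: "q = p * c" using p(2) by (rule dvdE)
    have "order ?G = p ^ 1 * c" using card c by (simp add: order_def)
    then obtain H where H: "subgroup H ?G" "card H = p ^ 1"
      using sylow_thm[OF p(1) G.is_group _ fin] by blast
    have "\<not> H \<subseteq> {\<one>\<^bsub>?G\<^esub>}"
    proof
      assume "H \<subseteq> {\<one>\<^bsub>?G\<^esub>}"
      hence "card H \<le> 1" using card_mono[of "{\<one>\<^bsub>?G\<^esub>}" H] by simp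
      thus False using H(2) prime_gt_1_nat[OF p(1)] by simp
    qed
    then obtain h where h: "h \<in> H" "h \<noteq> \<one>\<^bsub>?G\<^esub>" by blast
    interpret H: group "?G\<lparr>carrier := H\<rparr>" by (rule subgroup.subgroup_is_group[OF H(1) G.is_group])
    have "h [^]\<^bsub>?G\<lparr>carrier := H\<rparr>\<^esub> order (?G\<lparr>carrier := H\<rparr>) = \<one>\<^bsub>?G\<lparr>carrier := H\<rparr>\<^esub>"
      by (rule H.pow_order_eq_1) (use h in simp)
    hence pow: "h [^]\<^bsub>?G\<^esub> p = \<one>\<^bsub>?G\<^esub>"
      using H(2) by (simp add: order_def nat_pow_def)
    have "h \<in> carrier ?G" using h(1) H(1) subgroup.subset by blast
    then obtain x where x: "x \<in> \<O>" "h = I +>\<^bsub>RO\<^esub> x" by (auto simp: carrier_Quot)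
    have I0: "I +>\<^bsub>RO\<^esub> 0 = I" using Quot_pow[OF I, of 0 0] by (simp add: nat_pow_def one[simplified])
    have "I +>\<^bsub>RO\<^esub> (of_nat p * x) = I +>\<^bsub>RO\<^esub> 0"
      using pow Quot_pow[OF I x(1), of p] by (simp only: x(2) one I0)
    hence px: "of_nat p * x \<in> I" using coset_eq_iff[OF I, of "of_nat p * x" 0] x(1) by simp
    have kx: "of_int k * x \<in> I" using ideal_facts(5)[OF I k x(1)] by (simp add: mult.commute)
    have "coprime (int p) k" using p(1) npk by (intro prime_imp_coprime) simp_all
    then obtain u v where "u * int p + v * k = 1" using bezout_int[of "int p" k] by auto
    hence "(of_int u * of_nat p + of_int v * of_int k :: complex) = 1"
      by (metis of_int_1 of_int_add of_int_mult of_int_of_nat_eq)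
    hence "x = of_int u * (of_nat p * x) + of_int v * (of_int k * x)"
      by (simp add: mult.assoc[symmetric] distrib_right[symmetric])
    also have "\<dots> \<in> I"
      by (rule ideal_facts(3)[OF I ideal_facts(5)[OF I px] ideal_facts(5)[OF I kx]]) simp_all
    finally have "x \<in> I" .
    hence "I +>\<^bsub>RO\<^esub> x = I +>\<^bsub>RO\<^esub> 0" using coset_eq_iff[OF I x(1), of 0] by simp
    thus False using h(2) x(2) one I0 by simp
  qed
  have "q dvd nat \<bar>k\<bar>"
  proof (rule squarefree_dvdI[OF q(2)])
    fix p assume "prime p" "p dvd q"
    hence "int p dvd \<bar>k\<bar>" using prime_case by simp
    hence "int p dvd int (nat \<bar>k\<bar>)" by simp
    thus "p dvd nat \<bar>k\<bar>" by (simp only: int_dvd_int_iff)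
  qed
  hence "int q dvd int (nat \<bar>k\<bar>)" by (simp only: int_dvd_int_iff)
  thus ?thesis by simp
qed

lemma norm_in_ideal:
  assumes I: "ideal I RO" and q: "ideal_norm F I = q" "q > 0"
  shows "x \<in> \<O> \<Longrightarrow> of_nat q * x \<in> I"
proof -
  assume x: "x \<in> \<O>"
  let ?G = "add_monoid (RO Quot I)"
  interpret G: group ?G by (rule Quot_group[OF I])
  have ord: "order ?G = q" using q(1) by (simp add: ideal_norm_def order_def)
  have "(I +>\<^bsub>RO\<^esub> x) [^]\<^bsub>?G\<^esub> order ?G = \<one>\<^bsub>?G\<^esub>"
    by (rule G.pow_order_eq_1) (use x in \<open>simp add: carrier_Quot\<close>)
  moreover have "\<one>\<^bsub>?G\<^esub> = I +>\<^bsub>RO\<^esub> (of_nat 0 * x)"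
    using Quot_pow[OF I x, of 0] by (simp add: nat_pow_def)
  ultimately have "I +>\<^bsub>RO\<^esub> (of_nat q * x) = I +>\<^bsub>RO\<^esub> (of_nat 0 * x)"
    by (simp only: Quot_pow[OF I x] ord)
  thus ?thesis using coset_eq_iff[OF I, of "of_nat q * x" 0] x by simp
qed

end

text \<open>A ring homomorphism from \<open>\<O>\<close> onto \<open>\<int>/q\<close> whose kernel is nilpotent modulo \<open>q\<close>. It is given by integer
  representatives, so that \<open>q\<close> can be a parameter.\<close>

locale residue_map = cyclic_cubic +
  fixes \<psi> :: "complex \<Rightarrow> int" and q :: nat
  assumes q: "squarefree q"
    and \<psi>_add: "x \<in> \<O> \<Longrightarrow> y \<in> \<O> \<Longrightarrow> [\<psi> (x + y) = \<psi> x + \<psi> y] (mod int q)"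
    and \<psi>_mult: "x \<in> \<O> \<Longrightarrow> y \<in> \<O> \<Longrightarrow> [\<psi> (x * y) = \<psi> x * \<psi> y] (mod int q)"
    and \<psi>_1: "[\<psi> 1 = 1] (mod int q)"
    and nilpotent: "x \<in> \<O> \<Longrightarrow> int q dvd \<psi> x \<Longrightarrow> x ^ 3 / of_nat q \<in> \<O>"
begin

definition Q :: "complex set" where "Q = {x \<in> \<O>. int q dvd \<psi> x}"

lemma q_pos: "q > 0"
  by (rule squarefree_pos[OF q])

lemma \<psi>_diff: "x \<in> \<O> \<Longrightarrow> y \<in> \<O> \<Longrightarrow> [\<psi> (x - y) = \<psi> x - \<psi> y] (mod int q)"
  using \<psi>_add[of "x - y" y] by (simp add: cong_iff_dvd_diff algebra_simps dvd_diff_commute)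

lemma \<psi>_of_nat: "[\<psi> (of_nat k) = int k] (mod int q)"
proof (induction k)
  case 0
  show ?case using \<psi>_diff[of 0 0] by simp
next
  case (Suc k)
  have "[\<psi> (1 + of_nat k) = \<psi> 1 + \<psi> (of_nat k)] (mod int q)" by (rule \<psi>_add) simp_all
  also have "[\<psi> 1 + \<psi> (of_nat k) = 1 + int k] (mod int q)" by (intro cong_add \<psi>_1 Suc)
  finally show ?case by simp
qed

lemma \<psi>_of_int: "[\<psi> (of_int k) = k] (mod int q)"
proof (cases k rule: int_diff_cases)
  case (diff m n)
  have "[\<psi> (of_nat m - of_nat n) = \<psi> (of_nat m) - \<psi> (of_nat n)] (mod int q)"
    by (rule \<psi>_diff) simp_all
  also have "[\<psi> (of_nat m) - \<psi> (of_nat n) = int m - int n] (mod int q)"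
    by (intro cong_diff \<psi>_of_nat)
  finally show ?thesis by (simp add: diff)
qed

lemma Q_iff_cong: "x \<in> Q \<longleftrightarrow> x \<in> \<O> \<and> [\<psi> x = 0] (mod int q)"
  by (simp add: Q_def cong_0_iff)

lemma Q_subset: "Q \<subseteq> \<O>" by (auto simp: Q_def)

lemma diff_in_Q_iff: "x \<in> \<O> \<Longrightarrow> y \<in> \<O> \<Longrightarrow> x - y \<in> Q \<longleftrightarrow> [\<psi> x = \<psi> y] (mod int q)"
proof -
  assume xy: "x \<in> \<O>" "y \<in> \<O>"
  have "x - y \<in> Q \<longleftrightarrow> [\<psi> (x - y) = 0] (mod int q)" using xy by (simp add: Q_iff_cong)
  also have "\<dots> \<longleftrightarrow> [\<psi> x - \<psi> y = 0] (mod int q)"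
    using \<psi>_diff[OF xy] by (metis cong_sym cong_trans)
  also have "\<dots> \<longleftrightarrow> [\<psi> x = \<psi> y] (mod int q)" by (simp add: cong_diff_iff_cong_0)
  finally show ?thesis .
qed

lemma ideal_Q: "ideal Q RO"
proof (rule idealI)
  interpret R: cring RO by (rule cring_RO)
  show "ring RO" by (rule R.ring_axioms)
  show "subgroup Q (add_monoid RO)"
  proof (rule R.add.subgroupI)
    show "Q \<subseteq> carrier RO" using Q_subset by simp
    show "Q \<noteq> {}" using diff_in_Q_iff[of 0 0] by auto
    fix x y assume xy: "x \<in> Q" "y \<in> Q"
    hence O: "x \<in> \<O>" "y \<in> \<O>" using Q_subset by auto
    have "[\<psi> (x + y) = 0 + 0] (mod int q)"
      using \<psi>_add[OF O] xy cong_add[of "\<psi> x" 0 "int q" "\<psi> y" 0]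
      unfolding Q_iff_cong by (blast intro: cong_trans)
    thus "x \<oplus>\<^bsub>RO\<^esub> y \<in> Q" using O by (simp add: Q_iff_cong)
  next
    fix x assume x: "x \<in> Q"
    hence O: "x \<in> \<O>" using Q_subset by auto
    have eq: "\<ominus>\<^bsub>RO\<^esub> x = - x" by (rule R.minus_equality) (use O in simp_all)
    have "[0 = \<psi> x] (mod int q)" using x unfolding Q_iff_cong by (blast intro: cong_sym)
    moreover have "[\<psi> 0 = 0] (mod int q)" using \<psi>_of_int[of 0] by simp
    ultimately have "0 - x \<in> Q" using O diff_in_Q_iff[of 0 x] by (auto intro: cong_trans)
    thus "\<ominus>\<^bsub>RO\<^esub> x \<in> Q" unfolding eq by simp
  qed
  fix a x assume "a \<in> Q" "x \<in> carrier RO"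
  hence a: "a \<in> \<O>" "[\<psi> a = 0] (mod int q)" and x: "x \<in> \<O>" by (auto simp: Q_iff_cong)
  have "[\<psi> x * \<psi> a = \<psi> x * 0] (mod int q)" by (intro cong_mult cong_refl a)
  with \<psi>_mult[OF x a(1)] have "[\<psi> (x * a) = \<psi> x * 0] (mod int q)" by (rule cong_trans)
  hence "x * a \<in> Q" using x a by (simp add: Q_iff_cong)
  thus "x \<otimes>\<^bsub>RO\<^esub> a \<in> Q" "a \<otimes>\<^bsub>RO\<^esub> x \<in> Q" by (simp_all add: mult.commute)
qed

lemma Q_representative:
  assumes "x \<in> \<O>"
  shows "\<exists>k<q. x - of_nat k \<in> Q"
proof -
  define k where "k = nat (\<psi> x mod int q)"
  have "k < q" using q_pos by (simp add: k_def nat_less_iff)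
  moreover have "int k = \<psi> x mod int q" using q_pos by (simp add: k_def)
  hence "[\<psi> x = int k] (mod int q)" by (simp add: cong_def)
  hence "[\<psi> x = \<psi> (of_nat k)] (mod int q)" using \<psi>_of_nat[of k] by (metis cong_sym cong_trans)
  hence "x - of_nat k \<in> Q" using assms by (simp add: diff_in_Q_iff)
  ultimately show ?thesis by blast
qed

lemma norm_Q: "ideal_norm F Q = q"
proof -
  have "bij_betw (\<lambda>k. Q +>\<^bsub>RO\<^esub> of_nat k) {..<q} (carrier (RO Quot Q))"
    unfolding bij_betw_def
  proof
    show "inj_on (\<lambda>k. Q +>\<^bsub>RO\<^esub> of_nat k) {..<q}"
    proof (rule inj_onI)
      fix a b assume ab: "a \<in> {..<q}" "b \<in> {..<q}" "Q +>\<^bsub>RO\<^esub> of_nat a = Q +>\<^bsub>RO\<^esub> of_nat b"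
      hence "(of_nat a - of_nat b :: complex) \<in> Q" using coset_eq_iff[OF ideal_Q] by simp
      hence "[\<psi> (of_nat a) = \<psi> (of_nat b)] (mod int q)" by (simp add: diff_in_Q_iff)
      hence "[int a = int b] (mod int q)" using \<psi>_of_nat by (metis cong_sym cong_trans)
      thus "a = b" using ab by (simp add: cong_int_iff cong_def)
    qed
    show "(\<lambda>k. Q +>\<^bsub>RO\<^esub> of_nat k) ` {..<q} = carrier (RO Quot Q)"
    proof
      show "(\<lambda>k. Q +>\<^bsub>RO\<^esub> of_nat k) ` {..<q} \<subseteq> carrier (RO Quot Q)" by (auto simp: carrier_Quot)
      show "carrier (RO Quot Q) \<subseteq> (\<lambda>k. Q +>\<^bsub>RO\<^esub> of_nat k) ` {..<q}"
      proof
        fix C assume "C \<in> carrier (RO Quot Q)"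
        then obtain x where x: "x \<in> \<O>" "C = Q +>\<^bsub>RO\<^esub> x" by (auto simp: carrier_Quot)
        obtain k where "k < q" "x - of_nat k \<in> Q" using Q_representative[OF x(1)] by blast
        hence "C = Q +>\<^bsub>RO\<^esub> of_nat k" using coset_eq_iff[OF ideal_Q x(1)] x(2) by simp
        thus "C \<in> (\<lambda>k. Q +>\<^bsub>RO\<^esub> of_nat k) ` {..<q}" using \<open>k < q\<close> by blast
      qed
    qed
  qed
  hence "card {..<q} = card (carrier (RO Quot Q))" by (rule bij_betw_same_card)
  thus ?thesis by (simp add: ideal_norm_def)
qed

lemma q_in_Q: "of_nat q \<in> Q"
proof -
  have "[\<psi> (of_nat q) = int q] (mod int q)" by (rule \<psi>_of_nat)
  moreover have "[int q = 0] (mod int q)" by (simp add: cong_def)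
  ultimately show ?thesis by (simp add: Q_iff_cong) (rule cong_trans)
qed

lemma nonzero_Q: "Q \<noteq> {0}"
  using q_in_Q q_pos by (metis of_nat_eq_0_iff singletonD less_irrefl)

text \<open>The numbers \<open>0, \<dots>, q - 1\<close> represent all classes modulo \<open>I\<close>. If \<open>x \<in> Q\<close> is congruent to \<open>k\<close>, then \<open>k\<^sup>3 \<in> I\<close>
  because \<open>x\<^sup>3 \<in> q\<O> \<subseteq> I\<close>; so \<open>q\<close> divides \<open>k\<^sup>3\<close>, hence \<open>k\<close>, and \<open>x \<in> I\<close>. Both ideals meet \<open>\<int>\<close> in \<open>q\<int>\<close>, which
  gives the other inclusion.\<close>

lemma Q_unique:
  assumes I: "ideal I RO" and n: "ideal_norm F I = q"
  shows "I = Q"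
proof -
  have inj: "inj_on (\<lambda>k. I +>\<^bsub>RO\<^esub> of_nat k) {..<q}"
  proof (rule inj_onI)
    fix a b assume ab: "a \<in> {..<q}" "b \<in> {..<q}" "I +>\<^bsub>RO\<^esub> of_nat a = I +>\<^bsub>RO\<^esub> of_nat b"
    hence "(of_nat a - of_nat b :: complex) \<in> I" using coset_eq_iff[OF I] by simp
    hence "of_int (int a - int b) \<in> I" by simp
    hence "int q dvd int a - int b" by (rule ideal_Int_norm[OF I n q])
    hence "[int a = int b] (mod int q)" by (simp add: cong_iff_dvd_diff)
    thus "a = b" using ab by (simp add: cong_int_iff cong_def)
  qed
  have fin: "finite (carrier (RO Quot I))"
    using n q_pos card_ge_0_finite unfolding ideal_norm_def by metis
  have "(\<lambda>k. I +>\<^bsub>RO\<^esub> of_nat k) ` {..<q} = carrier (RO Quot I)"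
  proof (rule card_subset_eq[OF fin])
    show "(\<lambda>k. I +>\<^bsub>RO\<^esub> of_nat k) ` {..<q} \<subseteq> carrier (RO Quot I)" by (auto simp: carrier_Quot)
    show "card ((\<lambda>k. I +>\<^bsub>RO\<^esub> of_nat k) ` {..<q}) = card (carrier (RO Quot I))"
      using card_image[OF inj] n by (simp add: ideal_norm_def)
  qed
  hence rep: "\<exists>k<q. x - of_nat k \<in> I" if "x \<in> \<O>" for x
  proof -
    have "I +>\<^bsub>RO\<^esub> x \<in> carrier (RO Quot I)" using that by (simp add: carrier_Quot)
    hence "I +>\<^bsub>RO\<^esub> x \<in> (\<lambda>k. I +>\<^bsub>RO\<^esub> of_nat k) ` {..<q}"
      using \<open>_ = carrier (RO Quot I)\<close> by simp
    then obtain k where "k < q" "I +>\<^bsub>RO\<^esub> x = I +>\<^bsub>RO\<^esub> of_nat k" by auto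
    thus ?thesis using coset_eq_iff[OF I that] by auto
  qed
  have QI: "Q \<subseteq> I"
  proof
    fix x assume "x \<in> Q"
    hence x: "x \<in> \<O>" "int q dvd \<psi> x" by (auto simp: Q_def)
    obtain k where k: "k < q" "x - of_nat k \<in> I" using rep[OF x(1)] by blast
    have "of_nat q * (x ^ 3 / of_nat q) \<in> I" by (rule norm_in_ideal[OF I n q_pos nilpotent[OF x]])
    hence x3: "x ^ 3 \<in> I" using q_pos by simp
    have "x ^ 3 - of_nat k ^ 3 = (x\<^sup>2 + x * of_nat k + (of_nat k)\<^sup>2) * (x - of_nat k)"
      by (simp add: power2_eq_square power3_eq_cube algebra_simps)
    also have "\<dots> \<in> I" using x(1) by (intro ideal_facts(5)[OF I k(2)]) simp
    finally have "x ^ 3 - (x ^ 3 - of_nat k ^ 3) \<in> I" by (rule ideal_facts(4)[OF I x3])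
    hence "of_int (int k ^ 3) \<in> I" by simp
    hence "int q dvd int k ^ 3" by (rule ideal_Int_norm[OF I n q])
    hence "q dvd k ^ 3" by (simp flip: of_nat_power)
    hence "q dvd k" by (intro squarefree_dvdI[OF q]) (metis dvd_trans prime_dvd_power)
    hence "k = 0" using k(1) by (auto dest: dvd_imp_le)
    thus "x \<in> I" using k(2) by simp
  qed
  moreover have "I \<subseteq> Q"
  proof
    fix y assume y: "y \<in> I"
    hence yO: "y \<in> \<O>" using ideal_facts(1)[OF I] by blast
    obtain k where k: "k < q" "y - of_nat k \<in> Q" using Q_representative[OF yO] by blast
    hence "y - of_nat k \<in> I" using QI by blast
    with y have "y - (y - of_nat k) \<in> I" by (rule ideal_facts(4)[OF I])
    hence "of_int (int k) \<in> I" by simp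
    hence "int q dvd int k" by (rule ideal_Int_norm[OF I n q])
    hence "q dvd k" by simp
    hence "k = 0" using k(1) by (auto dest: dvd_imp_le)
    thus "y \<in> Q" using k(2) by simp
  qed
  ultimately show ?thesis by blast
qed

theorem unique_ideal: "nonzero_ideal F I \<and> ideal_norm F I = q \<longleftrightarrow> I = Q"
proof
  assume "nonzero_ideal F I \<and> ideal_norm F I = q"
  thus "I = Q" unfolding nonzero_ideal_def using Q_unique by blast
next
  assume "I = Q"
  thus "nonzero_ideal F I \<and> ideal_norm F I = q"
    unfolding nonzero_ideal_def using ideal_Q norm_Q nonzero_Q by blast
qed

end

context trace_zero_basis
begin

text \<open>Expand \<open>9xy\<close> by splitting \<open>3x\<close> and \<open>3y\<close> into rational and trace zero parts. The only term that is not
  rational or of trace zero is a product of two elements of \<open>L\<close>.\<close>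

lemma Tr_mult_cong:
  assumes x: "x \<in> \<O>" and y: "y \<in> \<O>"
  shows "e dvd 9 * Tr (x * y) - 3 * (Tr x * Tr y)"
proof -
  define v w where "v = 3 * x - of_int (Tr x)" and "w = 3 * y - of_int (Tr y)"
  have vw: "v \<in> L" "w \<in> L" unfolding v_def w_def using x y by (intro trace_zero_part; simp)+
  hence O: "v \<in> \<O>" "w \<in> \<O>" by (simp_all add: L_\<O>)
  have "of_int 9 * (x * y) = of_int (Tr x * Tr y) + (of_int (Tr x) * w + (of_int (Tr y) * v + v * w))"
    by (simp add: v_def w_def algebra_simps)
  hence "Tr (of_int 9 * (x * y)) = Tr (of_int (Tr x * Tr y) + (of_int (Tr x) * w + (of_int (Tr y) * v + v * w)))"
    by (rule arg_cong)
  also have "Tr (of_int 9 * (x * y)) = 9 * Tr (x * y)" using x y by (intro Tr_smult) simp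
  also have "Tr (of_int (Tr x * Tr y) + (of_int (Tr x) * w + (of_int (Tr y) * v + v * w)))
    = Tr (of_int (Tr x * Tr y)) + (Tr (of_int (Tr x) * w) + (Tr (of_int (Tr y) * v) + Tr (v * w)))"
    using O \<O>_closed(2)[OF \<O>_closed(6) O(1)] \<O>_closed(2)[OF \<O>_closed(6) O(2)]
    by (subst Tr_add, simp, simp)+ simp
  also have "\<dots> = 3 * (Tr x * Tr y) + Tr (v * w)"
    unfolding symmetric_of_int(1) Tr_smult[OF O(1)] Tr_smult[OF O(2)] Tr_L[OF vw(1)] Tr_L[OF vw(2)] by simp
  finally show ?thesis using e_dvd_Tr_mult[OF vw] by simp
qed

text \<open>The homomorphism is \<open>x \<mapsto> T(x)/3\<close>, where division by 3 means multiplication with its inverse \<open>u\<close> modulo \<open>q\<close>.\<close>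

lemma tame_residue:
  assumes q: "squarefree q" "coprime q 3" "int q dvd e"
  shows "\<exists>\<psi>. residue_map F \<sigma> \<psi> q \<and> (\<forall>x\<in>\<O>. int q dvd \<psi> x \<longleftrightarrow> int q dvd Tr x)"
proof -
  have cop: "coprime (int q) 3" using q(2) by (metis coprime_int_iff of_nat_numeral)
  obtain u where u: "[3 * u = 1] (mod int q)"
    using cong_solve_coprime_int[of 3 "int q"] cop by (auto simp: coprime_commute)
  have copu: "coprime (int q) u"
    using cong_imp_coprime[OF cong_sym[OF u]] by (simp add: coprime_commute)
  define \<psi> where "\<psi> = (\<lambda>x. u * Tr x)"
  have dvd: "int q dvd \<psi> x \<longleftrightarrow> int q dvd Tr x" for x
    using copu by (simp add: \<psi>_def coprime_dvd_mult_right_iff)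
  have mult: "[\<psi> (x * y) = \<psi> x * \<psi> y] (mod int q)" if "x \<in> \<O>" "y \<in> \<O>" for x y
  proof -
    have "int q dvd 9 * Tr (x * y) - 3 * (Tr x * Tr y)"
      using q(3) Tr_mult_cong[OF that] by (rule dvd_trans)
    hence "int q dvd 3 * (3 * Tr (x * y) - Tr x * Tr y)" by (simp add: algebra_simps)
    hence "int q dvd 3 * Tr (x * y) - Tr x * Tr y"
      using cop by (simp only: coprime_dvd_mult_right_iff)
    hence "[3 * Tr (x * y) = Tr x * Tr y] (mod int q)" by (simp add: cong_iff_dvd_diff)
    hence "[u * u * (3 * Tr (x * y)) = u * u * (Tr x * Tr y)] (mod int q)" by (rule cong_scalar_left)
    moreover have "[3 * u * (u * Tr (x * y)) = 1 * (u * Tr (x * y))] (mod int q)"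
      by (rule cong_scalar_right[OF u])
    ultimately show ?thesis
      unfolding \<psi>_def by (simp add: mult_ac) (metis cong_sym cong_trans)
  qed
  have "residue_map F \<sigma> \<psi> q"
  proof unfold_locales
    show "squarefree q" by fact
    show "[\<psi> (x + y) = \<psi> x + \<psi> y] (mod int q)" if "x \<in> \<O>" "y \<in> \<O>" for x y
      using that by (simp add: \<psi>_def Tr_add distrib_left)
    show "[\<psi> (x * y) = \<psi> x * \<psi> y] (mod int q)" if "x \<in> \<O>" "y \<in> \<O>" for x y
      using that by (rule mult)
    show "[\<psi> 1 = 1] (mod int q)"
      using u symmetric_of_int(1)[of 1] by (simp add: \<psi>_def mult.commute)
    show "x ^ 3 / of_nat q \<in> \<O>" if "x \<in> \<O>" "int q dvd \<psi> x" for x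
      using cube_divisible_tame[OF q(3) cop that(1)] that(2) dvd[of x] by simp
  qed
  thus ?thesis using dvd by blast
qed

text \<open>The Chinese remainder theorem glues the trace modulo \<open>q\<close> and the norm modulo 3.\<close>

lemma wild_residue:
  assumes w: "wild" and q: "squarefree q" "coprime q 3" "int q dvd e"
  shows "\<exists>\<psi>. residue_map F \<sigma> \<psi> (3 * q) \<and>
    (\<forall>x\<in>\<O>. int (3 * q) dvd \<psi> x \<longleftrightarrow> int q dvd Tr x \<and> 3 dvd Nm x)"
proof -
  obtain \<phi> where \<phi>: "residue_map F \<sigma> \<phi> q" "\<And>x. x \<in> \<O> \<Longrightarrow> int q dvd \<phi> x \<longleftrightarrow> int q dvd Tr x"
    using tame_residue[OF q] by blast
  interpret R: residue_map F \<sigma> \<phi> q by (rule \<phi>(1))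
  have cop: "coprime (int q) 3" using q(2) by (metis coprime_int_iff of_nat_numeral)
  have "\<exists>z. [z = \<phi> x] (mod int q) \<and> [z = Nm x] (mod 3)" for x
    using binary_chinese_remainder_int[OF cop, of "\<phi> x" "Nm x"] by blast
  then obtain \<psi> where \<psi>: "\<And>x. [\<psi> x = \<phi> x] (mod int q)" "\<And>x. [\<psi> x = Nm x] (mod 3)" by metis
  have iff: "[a = b] (mod int (3 * q)) \<longleftrightarrow> [a = b] (mod int q) \<and> [a = b] (mod 3)" for a b
  proof
    assume "[a = b] (mod int (3 * q))"
    thus "[a = b] (mod int q) \<and> [a = b] (mod 3)"
      by (auto simp: cong_iff_dvd_diff intro: dvd_trans[of _ "3 * int q"])
  next
    assume "[a = b] (mod int q) \<and> [a = b] (mod 3)"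
    hence "[a = b] (mod int q * 3)" using cop by (intro coprime_cong_mult) auto
    thus "[a = b] (mod int (3 * q))" by (simp add: mult.commute)
  qed
  have transfer: "[\<psi> x = c] (mod int (3 * q)) \<longleftrightarrow> [\<phi> x = c] (mod int q) \<and> [Nm x = c] (mod 3)" for x c
    unfolding iff using \<psi> by (metis cong_sym cong_trans)
  have dvd: "int (3 * q) dvd \<psi> x \<longleftrightarrow> int q dvd Tr x \<and> 3 dvd Nm x" if "x \<in> \<O>" for x
    using transfer[of x 0] \<phi>(2)[OF that] by (simp only: cong_0_iff)
  have "residue_map F \<sigma> \<psi> (3 * q)"
  proof unfold_locales
    have "\<not> 3 dvd q" using q(2) by (metis coprime_absorb_left coprime_commute dvd_refl not_prime_unit prime_3_nat)
    hence "coprime 3 q" using prime_3_nat by (intro prime_imp_coprime)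
    thus "squarefree (3 * q)"
      using q(1) squarefree_prime[OF prime_3_nat] by (intro squarefree_mult_coprime)
    show "[\<psi> (x + y) = \<psi> x + \<psi> y] (mod int (3 * q))" if xy: "x \<in> \<O>" "y \<in> \<O>" for x y
      unfolding transfer
    proof
      have "[\<phi> x + \<phi> y = \<psi> x + \<psi> y] (mod int q)" by (intro cong_add cong_sym[OF \<psi>(1)])
      thus "[\<phi> (x + y) = \<psi> x + \<psi> y] (mod int q)" by (rule cong_trans[OF R.\<psi>_add[OF xy]])
      have "[Nm (x + y) = Nm x + Nm y] (mod 3)"
        using Nm_add_mod_3[OF w xy] by (simp only: cong_iff_dvd_diff)
      moreover have "[Nm x + Nm y = \<psi> x + \<psi> y] (mod 3)" by (intro cong_add cong_sym[OF \<psi>(2)])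
      ultimately show "[Nm (x + y) = \<psi> x + \<psi> y] (mod 3)" by (rule cong_trans)
    qed
    show "[\<psi> (x * y) = \<psi> x * \<psi> y] (mod int (3 * q))" if xy: "x \<in> \<O>" "y \<in> \<O>" for x y
      unfolding transfer
    proof
      have "[\<phi> x * \<phi> y = \<psi> x * \<psi> y] (mod int q)" by (intro cong_mult cong_sym[OF \<psi>(1)])
      thus "[\<phi> (x * y) = \<psi> x * \<psi> y] (mod int q)" by (rule cong_trans[OF R.\<psi>_mult[OF xy]])
      show "[Nm (x * y) = \<psi> x * \<psi> y] (mod 3)"
        unfolding Nm_mult[OF xy] by (intro cong_mult cong_sym[OF \<psi>(2)])
    qed
    show "[\<psi> 1 = 1] (mod int (3 * q))"
      unfolding transfer using R.\<psi>_1 symmetric_of_int(2)[of 1] by simp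
    show "x ^ 3 / of_nat (3 * q) \<in> \<O>" if x: "x \<in> \<O>" "int (3 * q) dvd \<psi> x" for x
    proof -
      have q0: "q > 0" by (rule squarefree_pos[OF q(1)])
      have d: "int q dvd \<phi> x" "3 dvd Nm x" using x dvd \<phi>(2) by blast+
      have 1: "x ^ 3 / of_nat q \<in> \<O>" by (rule R.nilpotent[OF x(1) d(1)])
      have 2: "x ^ 3 / of_int 3 \<in> \<O>" by (rule cube_divisible_wild[OF w x(1) d(2)])
      have "of_int 3 * (x ^ 3 / of_nat (3 * q)) = x ^ 3 / of_nat q"
        "of_int (int q) * (x ^ 3 / of_nat (3 * q)) = x ^ 3 / of_int 3"
        using q0 by simp_all
      hence "algebraic_int (of_int 3 * (x ^ 3 / of_nat (3 * q)))"
        "algebraic_int (of_int (int q) * (x ^ 3 / of_nat (3 * q)))"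
        using 1 2 by (simp_all only: \<O>_int)
      moreover have "coprime 3 (int q)" using cop by (simp add: coprime_commute)
      ultimately have "algebraic_int (x ^ 3 / of_nat (3 * q))" by (rule algebraic_int_divide_coprime)
      moreover have "x ^ 3 / of_nat (3 * q) \<in> F" using x(1) by (intro divide_F power_F \<O>_F number_F)
      ultimately show ?thesis by (simp add: \<O>_def)
    qed
  qed
  thus ?thesis using dvd by blast
qed

end

section \<open>Two families of lattices in three-space\<close>

context
  fixes e1 e2 e3 :: "real ^ 3"
begin

definition lattice_of :: "(real ^ 3) set" where
  "lattice_of = {of_int i *\<^sub>R e1 + of_int j *\<^sub>R e2 + of_int k *\<^sub>R e3 | i j k :: int. True}"

lemma lattice_ofI: "of_int i *\<^sub>R e1 + of_int j *\<^sub>R e2 + of_int k *\<^sub>R e3 \<in> lattice_of"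
  unfolding lattice_of_def by blast

lemma basis_in_lattice_of: "e1 \<in> lattice_of" "e2 \<in> lattice_of" "e3 \<in> lattice_of"
  using lattice_ofI[of 1 0 0] lattice_ofI[of 0 1 0] lattice_ofI[of 0 0 1] by simp_all

context
  assumes indep: "\<And>i j k. i *\<^sub>R e1 + j *\<^sub>R e2 + k *\<^sub>R e3 = 0 \<Longrightarrow> i = 0 \<and> j = 0 \<and> k = 0"
begin

lemma distinct_basis: "e1 \<noteq> e2" "e1 \<noteq> e3" "e2 \<noteq> e3"
  using indep[of 1 "-1" 0] indep[of 1 0 "-1"] indep[of 0 1 "-1"] by auto

lemma independent_basis: "independent {e1, e2, e3}" "card {e1, e2, e3} = 3"
proof -
  show "card {e1, e2, e3} = 3" using distinct_basis by simp
  show "independent {e1, e2, e3}"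
  proof
    assume "dependent {e1, e2, e3}"
    then obtain u where u: "\<exists>v\<in>{e1,e2,e3}. u v \<noteq> 0" "(\<Sum>v\<in>{e1,e2,e3}. u v *\<^sub>R v) = 0"
      by (subst (asm) dependent_finite) auto
    have "u e1 *\<^sub>R e1 + u e2 *\<^sub>R e2 + u e3 *\<^sub>R e3 = 0"
      using u(2) distinct_basis by (simp add: add.assoc)
    thus False using indep[of "u e1" "u e2" "u e3"] u(1) by auto
  qed
qed

lemma full_rank: "full_rank_lattice lattice_of"
  unfolding full_rank_lattice_def
proof (intro exI conjI)
  show "independent {e1, e2, e3}" "card {e1, e2, e3} = DIM(real ^ 3)"
    using independent_basis by simp_all
  have sum: "(\<Sum>b\<in>{e1,e2,e3}. of_int (c b) *\<^sub>R b)
    = of_int (c e1) *\<^sub>R e1 + of_int (c e2) *\<^sub>R e2 + of_int (c e3) *\<^sub>R e3" for c :: "real ^ 3 \<Rightarrow> int"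
    using distinct_basis by (simp add: add.assoc)
  show "lattice_of = {\<Sum>b\<in>{e1,e2,e3}. of_int (c b) *\<^sub>R b | c :: real ^ 3 \<Rightarrow> int. True}"
  proof (intro equalityI subsetI)
    fix v assume "v \<in> lattice_of"
    then obtain i j k :: int where v: "v = of_int i *\<^sub>R e1 + of_int j *\<^sub>R e2 + of_int k *\<^sub>R e3"
      by (auto simp: lattice_of_def)
    define c where "c = (\<lambda>b. if b = e1 then i else if b = e2 then j else k)"
    have "v = (\<Sum>b\<in>{e1,e2,e3}. of_int (c b) *\<^sub>R b)"
      unfolding sum v using distinct_basis by (simp add: c_def)
    thus "v \<in> {\<Sum>b\<in>{e1,e2,e3}. of_int (c b) *\<^sub>R b | c :: real ^ 3 \<Rightarrow> int. True}" by blast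
  next
    fix v assume "v \<in> {\<Sum>b\<in>{e1,e2,e3}. of_int (c b) *\<^sub>R b | c :: real ^ 3 \<Rightarrow> int. True}"
    then obtain c :: "real ^ 3 \<Rightarrow> int" where "v = (\<Sum>b\<in>{e1,e2,e3}. of_int (c b) *\<^sub>R b)" by blast
    thus "v \<in> lattice_of" unfolding sum using lattice_ofI by simp
  qed
qed

end

end

lemma not_well_rounded_if_span:
  fixes \<Lambda> :: "(real ^ 3) set"
  assumes "minimal_vectors \<Lambda> \<subseteq> span S" "finite S" "card S \<le> 2"
  shows "\<not> well_rounded \<Lambda>"
proof
  assume "well_rounded \<Lambda>"
  then obtain B where B: "B \<subseteq> minimal_vectors \<Lambda>" "independent B" "card B = DIM(real ^ 3)"
    by (auto simp: well_rounded_def)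
  have "B \<subseteq> span S" using B(1) assms(1) by blast
  hence "card B \<le> card S" using independent_span_bound[OF assms(2) B(2)] by blast
  thus False using B(3) assms(3) by simp
qed

lemma card_insert_le_2: "card {a, b} \<le> 2"
  by (cases "a = b") simp_all

lemma minimal_vectorsD:
  assumes "v \<in> minimal_vectors \<Lambda>" "w \<in> \<Lambda>" "w \<noteq> 0"
  shows "v \<bullet> v \<le> w \<bullet> w"
  using assms by (simp add: minimal_vectors_def norm_le)

text \<open>With \<open>s = i + j + k\<close> the squared length of \<open>i e\<^sub>1 + j e\<^sub>2 + k e\<^sub>3\<close> is
  \<open>(q\<^sup>2 s\<^sup>2 + m ((i-j)\<^sup>2 + (j-k)\<^sup>2 + (k-i)\<^sup>2))/3\<close>. It is at least \<open>3q\<^sup>2\<close> on the diagonal \<open>i = j = k\<close>, at least \<open>2m\<close>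
  on the plane \<open>s = 0\<close> and at least \<open>(q\<^sup>2 + 2m)/3\<close> elsewhere, with equality for the basis vectors. When one of the
  first two bounds is the strict minimum, all minimal vectors lie on a line or in a plane.\<close>

lemma well_rounded_circulant:
  fixes e1 e2 e3 :: "real ^ 3" and q m :: real
  assumes qm: "q > 0" "m > 0"
    and diag: "e1 \<bullet> e1 = (q\<^sup>2 + 2 * m) / 3" "e2 \<bullet> e2 = (q\<^sup>2 + 2 * m) / 3" "e3 \<bullet> e3 = (q\<^sup>2 + 2 * m) / 3"
    and off: "e1 \<bullet> e2 = (q\<^sup>2 - m) / 3" "e2 \<bullet> e3 = (q\<^sup>2 - m) / 3" "e1 \<bullet> e3 = (q\<^sup>2 - m) / 3"
  shows "well_rounded (lattice_of e1 e2 e3) \<longleftrightarrow> m / 4 \<le> q\<^sup>2 \<and> q\<^sup>2 \<le> 4 * m"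
proof -
  let ?La = "lattice_of e1 e2 e3"
  have off': "e2 \<bullet> e1 = (q\<^sup>2 - m) / 3" "e3 \<bullet> e2 = (q\<^sup>2 - m) / 3" "e3 \<bullet> e1 = (q\<^sup>2 - m) / 3"
    using off by (simp_all add: inner_commute)
  define nf where "nf = (\<lambda>i j k :: real. (q\<^sup>2 * (i + j + k)\<^sup>2 + m * ((i - j)\<^sup>2 + (j - k)\<^sup>2 + (k - i)\<^sup>2)) / 3)"
  have nf: "(i *\<^sub>R e1 + j *\<^sub>R e2 + k *\<^sub>R e3) \<bullet> (i *\<^sub>R e1 + j *\<^sub>R e2 + k *\<^sub>R e3) = nf i j k" for i j k
    unfolding nf_def
    by (simp add: inner_add_left inner_add_right diag off off' power2_eq_square)
       (simp add: field_simps)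
  have q2: "q\<^sup>2 > 0" using qm by simp
  have indep: "i = 0 \<and> j = 0 \<and> k = 0" if "i *\<^sub>R e1 + j *\<^sub>R e2 + k *\<^sub>R e3 = 0" for i j k
  proof -
    have "nf i j k = 0" using nf[of i j k] that by simp
    hence *: "q\<^sup>2 * (i + j + k)\<^sup>2 + m * ((i - j)\<^sup>2 + (j - k)\<^sup>2 + (k - i)\<^sup>2) = 0" by (simp add: nf_def)
    have "q\<^sup>2 * (i + j + k)\<^sup>2 \<ge> 0" "m * ((i - j)\<^sup>2 + (j - k)\<^sup>2 + (k - i)\<^sup>2) \<ge> 0" using qm by simp_all
    hence "q\<^sup>2 * (i + j + k)\<^sup>2 = 0" "m * ((i - j)\<^sup>2 + (j - k)\<^sup>2 + (k - i)\<^sup>2) = 0" using * by linarith+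
    hence s: "i + j + k = 0" and d: "(i - j)\<^sup>2 + (j - k)\<^sup>2 + (k - i)\<^sup>2 = 0" using qm by simp_all
    have "(i - j)\<^sup>2 = 0" "(j - k)\<^sup>2 = 0"
      using d zero_le_power2[of "i - j"] zero_le_power2[of "j - k"] zero_le_power2[of "k - i"] by linarith+
    thus ?thesis using s by simp
  qed
  note full = full_rank[OF indep]
  note ind = independent_basis[OF indep]
  \<comment> \<open>The diagonal, the plane \<open>s = 0\<close>, and the remaining lattice vectors.\<close>
  have eqs: "nf (of_int i) (of_int j) (of_int k) \<ge> 3 * q\<^sup>2" if "i = j" "j = k" "i \<noteq> 0" for i j k :: int
  proof -
    have "1 \<le> i\<^sup>2" using that(3) by (simp add: int_one_le_iff_zero_less)
    hence "1 \<le> (of_int i :: real)\<^sup>2" by (metis of_int_1_le_iff of_int_power)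
    hence "3 * q\<^sup>2 * 1 \<le> 3 * q\<^sup>2 * (of_int i)\<^sup>2" using q2 by (intro mult_left_mono) auto
    thus ?thesis using that by (simp add: nf_def power2_eq_square algebra_simps)
  qed
  have zero_sum: "nf (of_int i) (of_int j) (of_int k) \<ge> 2 * m" if "i + j + k = 0" "\<not> (i = 0 \<and> j = 0)" for i j k :: int
  proof -
    have k: "k = - i - j" using that(1) by simp
    have "1 \<le> i\<^sup>2 + i * j + j\<^sup>2"
    proof -
      have "4 * (i\<^sup>2 + i * j + j\<^sup>2) = (2 * i + j)\<^sup>2 + 3 * j\<^sup>2" by (simp add: power2_eq_square algebra_simps)
      moreover have "(2 * i + j)\<^sup>2 + 3 * j\<^sup>2 > 0"
      proof (cases "j = 0")
        case True
        thus ?thesis using that(2) by simp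
      next
        case False
        hence "3 * j\<^sup>2 > 0" by simp
        thus ?thesis using zero_le_power2[of "2 * i + j"] by linarith
      qed
      ultimately have "0 < 4 * (i\<^sup>2 + i * j + j\<^sup>2)" by (simp only:)
      hence "0 < i\<^sup>2 + i * j + j\<^sup>2" by (simp only: zero_less_mult_iff) simp
      thus ?thesis by simp
    qed
    hence "1 \<le> (of_int i :: real)\<^sup>2 + of_int i * of_int j + (of_int j)\<^sup>2"
      by (metis of_int_1_le_iff of_int_add of_int_mult of_int_power)
    hence "2 * m * 1 \<le> 2 * m * ((of_int i)\<^sup>2 + of_int i * of_int j + (of_int j)\<^sup>2)"
      using qm by (intro mult_left_mono) auto
    thus ?thesis by (simp add: nf_def k power2_eq_square algebra_simps)
  qed
  have generic: "nf (of_int i) (of_int j) (of_int k) \<ge> (q\<^sup>2 + 2 * m) / 3"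
    if "i + j + k \<noteq> 0" "\<not> (i = j \<and> j = k)" for i j k :: int
  proof -
    have "1 \<le> (i + j + k)\<^sup>2" using that(1) by (simp add: int_one_le_iff_zero_less)
    hence 1: "1 \<le> (of_int i + of_int j + of_int k :: real)\<^sup>2"
      by (metis of_int_1_le_iff of_int_add of_int_power)
    have "2 \<le> (i - j)\<^sup>2 + (j - k)\<^sup>2 + (k - i)\<^sup>2"
    proof -
      have ge: "1 \<le> x\<^sup>2" if "x \<noteq> 0" for x :: int using that by (simp add: int_one_le_iff_zero_less)
      consider "i \<noteq> j" "j \<noteq> k" | "i \<noteq> j" "k \<noteq> i" | "j \<noteq> k" "k \<noteq> i" using \<open>\<not> (i = j \<and> j = k)\<close> by blast
      moreover have sum: "2 \<le> a + b + c"
        if "1 \<le> a \<and> 1 \<le> b \<or> 1 \<le> a \<and> 1 \<le> c \<or> 1 \<le> b \<and> 1 \<le> c"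
          "0 \<le> a" "0 \<le> b" "0 \<le> c" for a b c :: int
        using that by linarith
      ultimately show ?thesis
        by (cases; intro sum zero_le_power2) (simp_all add: ge)
    qed
    hence 2: "2 \<le> (of_int i - of_int j :: real)\<^sup>2 + (of_int j - of_int k)\<^sup>2 + (of_int k - of_int i)\<^sup>2"
      by (metis of_int_add of_int_diff of_int_numeral_le_iff of_int_power)
    have "q\<^sup>2 * 1 \<le> q\<^sup>2 * (of_int i + of_int j + of_int k)\<^sup>2" using 1 q2 by (intro mult_left_mono) auto
    moreover have "m * 2 \<le> m * ((of_int i - of_int j)\<^sup>2 + (of_int j - of_int k)\<^sup>2 + (of_int k - of_int i)\<^sup>2)"
      using 2 qm by (intro mult_left_mono) auto
    ultimately show ?thesis unfolding nf_def by (intro divide_right_mono) auto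
  qed
  show ?thesis
  proof
    assume "m / 4 \<le> q\<^sup>2 \<and> q\<^sup>2 \<le> 4 * m"
    hence R: "m \<le> 4 * q\<^sup>2" "q\<^sup>2 \<le> 4 * m" by simp_all
    have min: "v \<in> minimal_vectors ?La" if v: "v \<in> ?La" "v \<bullet> v = (q\<^sup>2 + 2 * m) / 3" for v
      unfolding minimal_vectors_def
    proof (intro CollectI conjI ballI impI)
      show "v \<in> ?La" by fact
      show "v \<noteq> 0"
      proof
        assume "v = 0"
        hence "q\<^sup>2 + 2 * m = 0" using v(2) by simp
        thus False using q2 qm by linarith
      qed
      fix w assume "w \<in> ?La" "w \<noteq> 0"
      then obtain i j k :: int where w: "w = of_int i *\<^sub>R e1 + of_int j *\<^sub>R e2 + of_int k *\<^sub>R e3"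
        by (auto simp: lattice_of_def)
      have nz: "\<not> (i = 0 \<and> j = 0 \<and> k = 0)" using \<open>w \<noteq> 0\<close> w by auto
      have "(q\<^sup>2 + 2 * m) / 3 \<le> nf (of_int i) (of_int j) (of_int k)"
      proof (cases "i = j \<and> j = k")
        case True
        hence "3 * q\<^sup>2 \<le> nf (of_int i) (of_int j) (of_int k)" using nz by (intro eqs) auto
        hence "q\<^sup>2 + 2 * m \<le> 3 * nf (of_int i) (of_int j) (of_int k)" using R by linarith
        thus ?thesis by simp
      next
        case False
        show ?thesis
        proof (cases "i + j + k = 0")
          case True
          hence "2 * m \<le> nf (of_int i) (of_int j) (of_int k)" using nz by (intro zero_sum) auto
          hence "q\<^sup>2 + 2 * m \<le> 3 * nf (of_int i) (of_int j) (of_int k)" using R by linarith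
          thus ?thesis by simp
        next
          case s: False
          show ?thesis by (rule generic[OF s False])
        qed
      qed
      thus "norm v \<le> norm w" unfolding norm_le v(2) w nf .
    qed
    show "well_rounded ?La" unfolding well_rounded_def
    proof (intro conjI full exI)
      show "{e1, e2, e3} \<subseteq> minimal_vectors ?La"
        using min basis_in_lattice_of diag by blast
      show "independent {e1, e2, e3}" "card {e1, e2, e3} = DIM(real ^ 3)" using ind by simp_all
    qed
  next
    assume wr: "well_rounded ?La"
    have e1': "e1 - e2 \<in> ?La" "e1 + e2 + e3 \<in> ?La"
      using lattice_ofI[of 1 e1 "-1" e2 0 e3] lattice_ofI[of 1 e1 1 e2 1 e3] by simp_all
    have e1n: "e1 - e2 \<noteq> 0" "e1 + e2 + e3 \<noteq> 0"
      using indep[of 1 "-1" 0] indep[of 1 1 1] by auto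
    have n1: "(e1 - e2) \<bullet> (e1 - e2) = 2 * m" "(e1 + e2 + e3) \<bullet> (e1 + e2 + e3) = 3 * q\<^sup>2"
      using nf[of 1 "-1" 0] nf[of 1 1 1] by (simp_all add: nf_def power2_eq_square)
    show "m / 4 \<le> q\<^sup>2 \<and> q\<^sup>2 \<le> 4 * m"
    proof (intro conjI; rule ccontr)
      assume "\<not> m / 4 \<le> q\<^sup>2"
      hence small: "4 * q\<^sup>2 < m" by simp
      have "minimal_vectors ?La \<subseteq> span {e1 + e2 + e3}"
      proof
        fix v assume v: "v \<in> minimal_vectors ?La"
        then obtain i j k :: int where w: "v = of_int i *\<^sub>R e1 + of_int j *\<^sub>R e2 + of_int k *\<^sub>R e3"
          by (auto simp: lattice_of_def minimal_vectors_def)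
        have le: "nf (of_int i) (of_int j) (of_int k) \<le> 3 * q\<^sup>2"
          using minimal_vectorsD[OF v e1'(2) e1n(2)] unfolding n1 w nf .
        have "i = j \<and> j = k"
        proof (rule ccontr)
          assume ne: "\<not> (i = j \<and> j = k)"
          show False
          proof (cases "i + j + k = 0")
            case True
            hence "2 * m \<le> nf (of_int i) (of_int j) (of_int k)" using ne by (intro zero_sum) auto
            thus False using le small q2 by linarith
          next
            case False
            have "q\<^sup>2 + 2 * m \<le> 3 * nf (of_int i) (of_int j) (of_int k)"
              using generic[OF False ne] by simp
            thus False using le small by linarith
          qed
        qed
        hence "v = of_int i *\<^sub>R (e1 + e2 + e3)" by (simp add: w algebra_simps)
        thus "v \<in> span {e1 + e2 + e3}" by (simp add: span_base span_scale)
      qed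
      from not_well_rounded_if_span[OF this] wr show False by simp
    next
      assume "\<not> q\<^sup>2 \<le> 4 * m"
      hence large: "q\<^sup>2 > 4 * m" by simp
      have "minimal_vectors ?La \<subseteq> span {e1 - e3, e2 - e3}"
      proof
        fix v assume v: "v \<in> minimal_vectors ?La"
        then obtain i j k :: int where w: "v = of_int i *\<^sub>R e1 + of_int j *\<^sub>R e2 + of_int k *\<^sub>R e3" and "v \<noteq> 0"
          by (auto simp: lattice_of_def minimal_vectors_def)
        have nz: "\<not> (i = 0 \<and> j = 0 \<and> k = 0)" using \<open>v \<noteq> 0\<close> w by auto
        have le: "nf (of_int i) (of_int j) (of_int k) \<le> 2 * m"
          using minimal_vectorsD[OF v e1'(1) e1n(1)] unfolding n1 w nf .
        have "i + j + k = 0"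
        proof (rule ccontr)
          assume ne: "i + j + k \<noteq> 0"
          show False
          proof (cases "i = j \<and> j = k")
            case True
            hence "3 * q\<^sup>2 \<le> nf (of_int i) (of_int j) (of_int k)" using nz by (intro eqs) auto
            thus False using le large qm by linarith
          next
            case False
            have "q\<^sup>2 + 2 * m \<le> 3 * nf (of_int i) (of_int j) (of_int k)"
              using generic[OF ne False] by simp
            thus False using le large by linarith
          qed
        qed
        hence k: "k = - i - j" by simp
        have "v = of_int i *\<^sub>R (e1 - e3) + of_int j *\<^sub>R (e2 - e3)" by (simp add: w k algebra_simps)
        thus "v \<in> span {e1 - e3, e2 - e3}" by (simp add: span_add span_base span_scale)
      qed
      from not_well_rounded_if_span[OF this _ card_insert_le_2] wr show False by simp
    qed
  qed
qed

text \<open>The lattice is the orthogonal sum of a line with shortest squared length \<open>a\<close> and a hexagonal plane lattice with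
  shortest squared length \<open>2b\<close>; the summand with the smaller one contains all minimal vectors.\<close>

lemma not_well_rounded_orthogonal:
  fixes e1 e2 e3 :: "real ^ 3" and a b :: real
  assumes ab: "a > 0" "b > 0" "a \<noteq> 2 * b"
    and diag: "e1 \<bullet> e1 = a" "e2 \<bullet> e2 = 2 * b" "e3 \<bullet> e3 = 2 * b"
    and off: "e1 \<bullet> e2 = 0" "e2 \<bullet> e3 = - b" "e1 \<bullet> e3 = 0"
  shows "\<not> well_rounded (lattice_of e1 e2 e3)"
proof -
  let ?La = "lattice_of e1 e2 e3"
  have off': "e2 \<bullet> e1 = 0" "e3 \<bullet> e2 = - b" "e3 \<bullet> e1 = 0"
    using off by (simp_all add: inner_commute)
  have nf: "(i *\<^sub>R e1 + j *\<^sub>R e2 + k *\<^sub>R e3) \<bullet> (i *\<^sub>R e1 + j *\<^sub>R e2 + k *\<^sub>R e3)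
      = a * i\<^sup>2 + b * (j\<^sup>2 + k\<^sup>2 + (j - k)\<^sup>2)" for i j k
    by (simp add: inner_add_left inner_add_right diag off off' power2_eq_square algebra_simps)
  have e12: "e1 \<in> ?La" "e2 \<in> ?La" "e1 \<noteq> 0" "e2 \<noteq> 0"
    using basis_in_lattice_of diag ab by auto
  have ge: "1 \<le> (of_int x :: real)\<^sup>2" if "x \<noteq> 0" for x :: int
  proof -
    have "1 \<le> x\<^sup>2" using that by (simp add: int_one_le_iff_zero_less)
    thus ?thesis by (metis of_int_1_le_iff of_int_power)
  qed
  have jk: "2 * b \<le> b * ((of_int j)\<^sup>2 + (of_int k)\<^sup>2 + (of_int j - of_int k)\<^sup>2)" if "\<not> (j = 0 \<and> k = 0)" for j k :: int
  proof -
    have "2 \<le> (of_int j :: real)\<^sup>2 + (of_int k)\<^sup>2 + (of_int j - of_int k)\<^sup>2"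
    proof -
      consider "j = 0" "k \<noteq> 0" | "k = 0" "j \<noteq> 0" | "j \<noteq> 0" "k \<noteq> 0"
        using \<open>\<not> (j = 0 \<and> k = 0)\<close> by blast
      thus ?thesis
      proof cases
        case 3
        thus ?thesis using ge[of j] ge[of k] zero_le_power2[of "of_int j - of_int k :: real"] by linarith
      qed (use ge[of j] ge[of k] in auto)
    qed
    hence "b * 2 \<le> b * ((of_int j)\<^sup>2 + (of_int k)\<^sup>2 + (of_int j - of_int k)\<^sup>2)"
      using ab by (intro mult_left_mono) auto
    thus ?thesis by simp
  qed
  consider "a < 2 * b" | "2 * b < a" using ab(3) by linarith
  thus ?thesis
  proof cases
    case 1
    have "minimal_vectors ?La \<subseteq> span {e1}"
    proof
      fix v assume v: "v \<in> minimal_vectors ?La"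
      then obtain i j k :: int where w: "v = of_int i *\<^sub>R e1 + of_int j *\<^sub>R e2 + of_int k *\<^sub>R e3"
        by (auto simp: lattice_of_def minimal_vectors_def)
      have le: "a * (of_int i)\<^sup>2 + b * ((of_int j)\<^sup>2 + (of_int k)\<^sup>2 + (of_int j - of_int k)\<^sup>2) \<le> a"
        using minimal_vectorsD[OF v e12(1,3)] unfolding diag w nf .
      have "j = 0 \<and> k = 0"
      proof (rule ccontr)
        assume "\<not> (j = 0 \<and> k = 0)"
        hence "2 * b \<le> b * ((of_int j)\<^sup>2 + (of_int k)\<^sup>2 + (of_int j - of_int k)\<^sup>2)" by (rule jk)
        moreover have "a * (of_int i)\<^sup>2 \<ge> 0" using ab by simp
        ultimately show False using le 1 by linarith
      qed
      thus "v \<in> span {e1}" by (simp add: w span_base span_scale)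
    qed
    thus ?thesis by (rule not_well_rounded_if_span) simp_all
  next
    case 2
    have "minimal_vectors ?La \<subseteq> span {e2, e3}"
    proof
      fix v assume v: "v \<in> minimal_vectors ?La"
      then obtain i j k :: int where w: "v = of_int i *\<^sub>R e1 + of_int j *\<^sub>R e2 + of_int k *\<^sub>R e3"
        by (auto simp: lattice_of_def minimal_vectors_def)
      have le: "a * (of_int i)\<^sup>2 + b * ((of_int j)\<^sup>2 + (of_int k)\<^sup>2 + (of_int j - of_int k)\<^sup>2) \<le> 2 * b"
        using minimal_vectorsD[OF v e12(2,4)] unfolding diag w nf .
      have "i = 0"
      proof (rule ccontr)
        assume "i \<noteq> 0"
        hence "a * 1 \<le> a * (of_int i)\<^sup>2" using ab ge by (intro mult_left_mono) auto
        moreover have "b * ((of_int j)\<^sup>2 + (of_int k)\<^sup>2 + (of_int j - of_int k)\<^sup>2) \<ge> 0" using ab by simp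
        ultimately show False using le 2 by linarith
      qed
      thus "v \<in> span {e2, e3}" by (simp add: w span_add span_base span_scale)
    qed
    thus ?thesis by (rule not_well_rounded_if_span) (simp_all add: card_insert_le_2)
  qed
qed

section \<open>Lattice bases of the ideals\<close>

context cyclic_cubic
begin

abbreviation emb :: "complex \<Rightarrow> real ^ 3" where "emb \<equiv> field_embedding \<sigma>"

lemma emb_add: "x \<in> F \<Longrightarrow> y \<in> F \<Longrightarrow> emb (x + y) = emb x + emb y"
  by (simp add: field_embedding_def Finite_Cartesian_Product.vec_eq_iff forall_3)

lemma emb_smult: "x \<in> F \<Longrightarrow> emb (of_int k * x) = of_int k *\<^sub>R emb x"
  by (simp add: field_embedding_def Finite_Cartesian_Product.vec_eq_iff forall_3)

lemma emb_inner:
  assumes "x \<in> F" "y \<in> F"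
  shows "emb x \<bullet> emb y = Re (tr (x * y))"
proof -
  have Re_mult: "Re (u * v) = Re u * Re v" if "u \<in> F" "v \<in> F" for u v
  proof -
    have "Im u = 0" using F_real[OF that(1)] by (simp add: complex_is_Real_iff)
    thus ?thesis by simp
  qed
  have "Re (tr (x * y)) = Re (x * y) + Re (\<sigma> x * \<sigma> y) + Re (\<sigma> (\<sigma> x) * \<sigma> (\<sigma> y))"
    using assms by (simp add: tr_def)
  also have "\<dots> = Re x * Re y + Re (\<sigma> x) * Re (\<sigma> y) + Re (\<sigma> (\<sigma> x)) * Re (\<sigma> (\<sigma> y))"
    using assms by (simp only: Re_mult \<sigma>_F)
  finally show ?thesis by (simp add: field_embedding_def inner_vec_def sum_3)
qed

lemma emb_image:
  assumes "v1 \<in> F" "v2 \<in> F" "v3 \<in> F"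
    and Q: "\<And>x. x \<in> Q \<longleftrightarrow> (\<exists>i j k :: int. x = of_int i * v1 + of_int j * v2 + of_int k * v3)"
  shows "emb ` Q = lattice_of (emb v1) (emb v2) (emb v3)"
proof -
  have eq: "emb (of_int i * v1 + of_int j * v2 + of_int k * v3)
    = of_int i *\<^sub>R emb v1 + of_int j *\<^sub>R emb v2 + of_int k *\<^sub>R emb v3" for i j k
    using assms(1-3) by (simp add: emb_add emb_smult)
  show ?thesis
  proof (intro equalityI subsetI)
    fix y assume "y \<in> emb ` Q"
    then obtain x where x: "x \<in> Q" "y = emb x" by blast
    then obtain i j k :: int where "x = of_int i * v1 + of_int j * v2 + of_int k * v3" using Q by blast
    thus "y \<in> lattice_of (emb v1) (emb v2) (emb v3)" using x(2) eq lattice_ofI by simp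
  next
    fix y assume "y \<in> lattice_of (emb v1) (emb v2) (emb v3)"
    then obtain i j k :: int where "y = of_int i *\<^sub>R emb v1 + of_int j *\<^sub>R emb v2 + of_int k *\<^sub>R emb v3"
      by (auto simp: lattice_of_def)
    hence "y = emb (of_int i * v1 + of_int j * v2 + of_int k * v3)" by (simp only: eq)
    moreover have "of_int i * v1 + of_int j * v2 + of_int k * v3 \<in> Q" using Q by blast
    ultimately show "y \<in> emb ` Q" by blast
  qed
qed

text \<open>The Gram matrix of \<open>v\<close>, \<open>\<sigma> v\<close>, \<open>\<sigma>\<^sup>2 v\<close> has \<open>T(v\<^sup>2)\<close> on the diagonal and \<open>sy v = (T(v)\<^sup>2 - T(v\<^sup>2))/2\<close> elsewhere.\<close>

lemma well_rounded_conjugate_basis: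
  fixes m q :: nat
  assumes v: "v \<in> F" "tr v = of_nat q" "3 * tr (v\<^sup>2) = of_nat (q\<^sup>2 + 2 * m)"
    and q: "q > 0" "m > 0"
    and Q: "\<And>x. x \<in> Q \<longleftrightarrow> (\<exists>i j k :: int. x = of_int i * v + of_int j * \<sigma> v + of_int k * \<sigma> (\<sigma> v))"
  shows "well_rounded (emb ` Q) \<longleftrightarrow> real m / 4 \<le> (real q)\<^sup>2 \<and> (real q)\<^sup>2 \<le> 4 * real m"
proof -
  have img: "emb ` Q = lattice_of (emb v) (emb (\<sigma> v)) (emb (\<sigma> (\<sigma> v)))"
    using v(1) by (intro emb_image Q) simp_all
  have "3 * Re (tr (v\<^sup>2)) = (real q)\<^sup>2 + 2 * real m"
    using arg_cong[OF v(3), of Re] by simp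
  hence d: "Re (tr (v\<^sup>2)) = ((real q)\<^sup>2 + 2 * real m) / 3" by simp
  have "6 * sy v = 3 * (tr v)\<^sup>2 - 3 * tr (v\<^sup>2)" using symmetric_square(1)[OF v(1)] by simp
  also have "\<dots> = of_real (2 * ((real q)\<^sup>2 - real m))" unfolding v(2,3) by simp
  finally have "Re (6 * sy v) = Re (of_real (2 * ((real q)\<^sup>2 - real m)))" by (rule arg_cong)
  hence "6 * Re (sy v) = 2 * ((real q)\<^sup>2 - real m)" by simp
  hence s: "Re (sy v) = ((real q)\<^sup>2 - real m) / 3" by simp
  have t: "tr (v * v) = tr (v\<^sup>2)" "tr (\<sigma> v * \<sigma> v) = tr (v\<^sup>2)" "tr (\<sigma> (\<sigma> v) * \<sigma> (\<sigma> v)) = tr (v\<^sup>2)"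
    "tr (v * \<sigma> v) = sy v" "tr (\<sigma> v * \<sigma> (\<sigma> v)) = sy v" "tr (v * \<sigma> (\<sigma> v)) = sy v"
    using v(1) by (simp_all add: tr_def sy_def power2_eq_square mult_ac)
  show ?thesis
    unfolding img using v(1) q
    by (intro well_rounded_circulant) (simp_all add: emb_inner t d s)
qed

end

context trace_zero_basis
begin

lemma tr_l_square: "tr (l\<^sup>2) = 2 * of_int e"
  using symmetric_square(1)[OF L_F[OF l(1)]] L_tr[OF l(1)] sy_l by simp

lemma \<sigma>2_l: "\<sigma> (\<sigma> l) = - l - \<sigma> l"
  by (rule traceless_\<sigma>2[OF L_tr[OF l(1)]])

lemma span_in_ideal:
  assumes I: "ideal I RO" and v: "v1 \<in> I" "v2 \<in> I" "v3 \<in> I"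
  shows "of_int i * v1 + of_int j * v2 + of_int k * v3 \<in> I"
  by (rule ideal_facts(3)[OF I ideal_facts(3)[OF I ideal_facts(5)[OF I v(1)]
        ideal_facts(5)[OF I v(2)]] ideal_facts(5)[OF I v(3)]]) simp_all

text \<open>Write \<open>q = 3k + r\<close> with \<open>r = \<plusminus>1\<close>; the generator \<open>v = k + r \<eta>\<close> is an element of trace \<open>q\<close> closest to the rational
  line. It remains to see that \<open>v - \<sigma> v\<close> is \<open>\<plusminus> \<sigma> l\<close>, so that the conjugates of \<open>v\<close> span \<open>L\<close>.\<close>

lemma tame_ideal_basis:
  assumes tame: "\<not> wild" and q: "\<not> 3 dvd q" "q > (0 :: nat)"
    and I: "ideal I RO" and Q: "\<And>x. x \<in> I \<longleftrightarrow> x \<in> \<O> \<and> int q dvd Tr x"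
  obtains v where "v \<in> F" "tr v = of_nat q" "3 * tr (v\<^sup>2) = of_int (int q ^ 2 + 2 * e)"
    "\<And>x. x \<in> I \<longleftrightarrow> (\<exists>i j k :: int. x = of_int i * v + of_int j * \<sigma> v + of_int k * \<sigma> (\<sigma> v))"
proof -
  obtain \<eta> \<epsilon> where \<eta>: "\<eta> \<in> \<O>" "\<epsilon> = 1 \<or> \<epsilon> = (-1::int)" "3 * \<eta> = 1 + of_int \<epsilon> * (l - \<sigma> l)"
    using tame_generator[OF tame] by metis
  have lF: "l \<in> F" "l \<in> \<O>" using l by (simp_all add: L_F L_\<O>)
  have \<eta>F: "\<eta> \<in> F" using \<eta>(1) by (rule \<O>_F)
  have "int q mod 3 = 1 \<or> int q mod 3 = 2" using q(1) by presburger
  hence "int q = 3 * (int q div 3) + 1 \<or> int q = 3 * (int q div 3 + 1) + (-1)" by presburger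
  then obtain k r where kr: "int q = 3 * k + r" "r = 1 \<or> r = (-1::int)" by blast
  have sq: "\<epsilon> * \<epsilon> = 1" "r * r = 1" using \<eta>(2) kr(2) by auto
  define c where "c = r * \<epsilon>"
  have c: "c * c = 1" using sq by (simp add: c_def mult_ac)
  define v where "v = of_int k + of_int r * \<eta>"
  have vO: "v \<in> \<O>" using \<eta>(1) by (simp add: v_def)
  hence vF: "v \<in> F" by (rule \<O>_F)
  have v3: "3 * v = of_int (int q) + of_int c * (l - \<sigma> l)"
  proof -
    have "3 * v = 3 * of_int k + of_int r * (3 * \<eta>)" by (simp add: v_def algebra_simps)
    also have "\<dots> = of_int (3 * k + r) + of_int c * (l - \<sigma> l)"
      unfolding \<eta>(3) by (simp add: c_def algebra_simps)
    finally show ?thesis by (simp only: kr(1))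
  qed
  have w: "of_int c * (l - \<sigma> l) \<in> F" "tr (of_int c * (l - \<sigma> l)) = 0"
    using l lF by (simp_all add: symmetric_scale tr_diff tr_\<sigma> L_tr)
  have "3 * tr v = tr (3 * v)" using vF by (simp add: symmetric_scale)
  also have "\<dots> = 3 * of_int (int q)" unfolding v3 using w by (simp add: symmetric_shift)
  finally have trv: "tr v = of_nat q" by simp
  hence "of_int (Tr v) = (of_int (int q) :: complex)" using vO by (simp add: of_int_symmetric)
  hence Trv: "Tr v = int q" by (simp only: of_int_eq_iff)
  have "9 * sy v = sy (3 * v)" using vF by (simp add: symmetric_scale)
  also have "\<dots> = 3 * (of_int (int q))\<^sup>2 + sy (of_int c * (l - \<sigma> l))"
    unfolding v3 using w by (simp add: symmetric_shift)
  also have "of_int c * (l - \<sigma> l) = of_int c * l + of_int (- c) * \<sigma> l" by (simp add: algebra_simps)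
  also have "sy (of_int c * l + of_int (- c) * \<sigma> l) = ((of_int c)\<^sup>2 - of_int c * of_int (- c) + (of_int (- c))\<^sup>2) * sy l"
    using l lF by (intro traceless_sy_comb) (simp_all add: L_tr)
  also have "((of_int c)\<^sup>2 - of_int c * of_int (- c) + (of_int (- c))\<^sup>2) = (of_int (3 * (c * c)) :: complex)"
    by (simp add: power2_eq_square)
  finally have "9 * sy v = 3 * (of_nat q)\<^sup>2 - 3 * of_int e" by (simp add: c sy_l)
  hence "3 * (3 * sy v) = 3 * ((of_nat q)\<^sup>2 - of_int e)" by (simp add: right_diff_distrib)
  hence sv: "3 * sy v = (of_nat q)\<^sup>2 - of_int e" by (metis mult_left_cancel zero_neq_numeral)
  have "3 * tr (v\<^sup>2) = 3 * (tr v)\<^sup>2 - 2 * (3 * sy v)"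
    using symmetric_square(1)[OF vF] by simp
  also have "\<dots> = of_int (int q ^ 2 + 2 * e)" unfolding trv sv by simp
  finally have trv2: "3 * tr (v\<^sup>2) = of_int (int q ^ 2 + 2 * e)" .
  \<comment> \<open>Differences of conjugates of \<open>v\<close> give the whole trace zero lattice.\<close>
  have "3 * (v - \<sigma> v) = 3 * v - \<sigma> (3 * v)" using vF by simp
  also have "\<dots> = of_int c * (l - \<sigma> l) - of_int c * (\<sigma> l - \<sigma> (\<sigma> l))"
    unfolding v3 using lF by simp
  also have "\<dots> = 3 * (- of_int c * \<sigma> l)" by (simp add: \<sigma>2_l algebra_simps)
  finally have "3 * (v - \<sigma> v) = 3 * (- of_int c * \<sigma> l)" .
  hence d1: "v - \<sigma> v = - of_int c * \<sigma> l" by (metis mult_left_cancel zero_neq_numeral)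
  have "\<sigma> (\<sigma> (v - \<sigma> v)) = \<sigma> (\<sigma> (- of_int c * \<sigma> l))" by (simp only: d1)
  hence d2: "\<sigma> (\<sigma> v) - v = - of_int c * l" using vF lF by simp
  have cc: "of_int c * of_int c = (1::complex)" using c by (metis of_int_1 of_int_mult)
  have ll: "\<sigma> l = of_int (- c) * (v - \<sigma> v)" "l = of_int (- c) * (\<sigma> (\<sigma> v) - v)"
    unfolding d1 d2 using cc by (simp_all add: mult.assoc[symmetric])
  have vI: "v \<in> I" "\<sigma> v \<in> I" "\<sigma> (\<sigma> v) \<in> I"
    using vO Trv by (simp_all add: Q Tr_conj)
  show ?thesis
  proof (rule that[OF vF trv trv2])
    fix x
    show "x \<in> I \<longleftrightarrow> (\<exists>i j k :: int. x = of_int i * v + of_int j * \<sigma> v + of_int k * \<sigma> (\<sigma> v))"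
    proof
      assume "x \<in> I"
      hence x: "x \<in> \<O>" "int q dvd Tr x" by (auto simp: Q)
      obtain t where t: "Tr x = int q * t" using x(2) by (rule dvdE)
      have "x - of_int t * v \<in> L"
        using x(1) vO t Trv by (intro L_I) (simp_all add: Tr_diff Tr_smult)
      then obtain a b :: int where ab: "x - of_int t * v = of_int a * l + of_int b * \<sigma> l" using gen by blast
      have "x = of_int t * v + (of_int a * l + of_int b * \<sigma> l)" using ab by (simp add: algebra_simps)
      also have "\<dots> = of_int t * v + (of_int a * (of_int (- c) * (\<sigma> (\<sigma> v) - v)) + of_int b * (of_int (- c) * (v - \<sigma> v)))"
        by (simp only: ll[symmetric])
      also have "\<dots> = of_int (t + a * c - b * c) * v + of_int (b * c) * \<sigma> v + of_int (- (a * c)) * \<sigma> (\<sigma> v)"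
        by (simp add: algebra_simps)
      finally show "\<exists>i j k :: int. x = of_int i * v + of_int j * \<sigma> v + of_int k * \<sigma> (\<sigma> v)" by blast
    next
      assume "\<exists>i j k :: int. x = of_int i * v + of_int j * \<sigma> v + of_int k * \<sigma> (\<sigma> v)"
      thus "x \<in> I" using span_in_ideal[OF I vI] by blast
    qed
  qed
qed

text \<open>The ideal of norm \<open>3q\<close> contains \<open>v = q \<plusminus> l\<close> for the sign that makes the norm of \<open>v\<close> divisible by 3. An element
  \<open>q t + i l + j \<sigma> l\<close> of \<open>\<O>\<close> has norm congruent to \<open>q t + (i + j) N(l)\<close> modulo 3, and this vanishes exactly when the
  coordinates with respect to the conjugates of \<open>v\<close> are integers.\<close>

lemma wild_ideal_basis:
  assumes w: "wild" and q: "\<not> 3 dvd q" "q > (0 :: nat)"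
    and I: "ideal I RO" and Q: "\<And>x. x \<in> I \<longleftrightarrow> x \<in> \<O> \<and> int q dvd Tr x \<and> 3 dvd Nm x"
  obtains v where "v \<in> F" "tr v = of_nat (3 * q)" "3 * tr (v\<^sup>2) = of_int (int (3 * q) ^ 2 + 6 * e)"
    "\<And>x. x \<in> I \<longleftrightarrow> (\<exists>i j k :: int. x = of_int i * v + of_int j * \<sigma> v + of_int k * \<sigma> (\<sigma> v))"
proof -
  have lF: "l \<in> F" "l \<in> \<O>" using l by (simp_all add: L_F L_\<O>)
  have n3: "\<not> 3 dvd Nm l" by (rule wild_Nm_l[OF w wild_not_9_dvd_e[OF w]])
  have cube: "3 dvd (a::int) ^ 3 - a" for a
  proof -
    have "a ^ 3 - a = a * (a - 1) * (a + 1)" by (simp add: power3_eq_cube algebra_simps)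
    moreover have "3 dvd a \<or> 3 dvd a - 1 \<or> 3 dvd a + 1" by presburger
    ultimately show ?thesis by (metis dvd_mult dvd_mult2)
  qed
  have "\<exists>d. (d = 1 \<or> d = (-1::int)) \<and> 3 dvd int q + d * Nm l"
  proof -
    have "\<not> 3 dvd int q" using q(1) by presburger
    hence "3 dvd int q + Nm l \<or> 3 dvd int q - Nm l" using n3 by presburger
    thus ?thesis by (elim disjE) (rule exI[of _ 1], simp, rule exI[of _ "-1"], simp)
  qed
  then obtain d where d: "d = 1 \<or> d = (-1::int)" "3 dvd int q + d * Nm l" by blast
  have dd: "d * d = 1" using d(1) by auto
  define v where "v = of_nat q + of_int d * l"
  have vO: "v \<in> \<O>" using lF by (simp add: v_def)
  hence vF: "v \<in> F" by (rule \<O>_F)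
  have trl: "tr (of_int d * l) = 0" using lF l by (simp add: symmetric_scale L_tr)
  have trv: "tr v = of_nat (3 * q)"
    unfolding v_def using lF trl by (simp add: symmetric_shift)
  hence "of_int (Tr v) = (of_int (int (3 * q)) :: complex)" using vO by (simp add: of_int_symmetric)
  hence "Tr v = int (3 * q)" by (simp only: of_int_eq_iff)
  hence Trv: "Tr v = 3 * int q" by simp
  have "sy v = 3 * (of_nat q)\<^sup>2 + sy (of_int d * l)"
    unfolding v_def using lF trl by (simp add: symmetric_shift)
  also have "sy (of_int d * l) = of_int (d * d) * sy l"
    using lF by (simp add: symmetric_scale power2_eq_square)
  finally have sv: "sy v = 3 * (of_nat q)\<^sup>2 - of_int e" by (simp add: dd sy_l)
  have "3 * tr (v\<^sup>2) = 3 * (tr v)\<^sup>2 - 6 * sy v"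
    using symmetric_square(1)[OF vF] by simp
  also have "\<dots> = of_int (int (3 * q) ^ 2 + 6 * e)" unfolding trv sv by (simp add: power_mult_distrib)
  finally have trv2: "3 * tr (v\<^sup>2) = of_int (int (3 * q) ^ 2 + 6 * e)" .
  have Nmv: "3 dvd Nm v"
  proof -
    have "3 dvd Nm v - (Nm (of_int (int q)) + Nm (of_int d * l))"
      unfolding v_def using lF Nm_add_mod_3[OF w, of "of_nat q" "of_int d * l"] by simp
    hence 1: "3 dvd Nm v - (int q ^ 3 + d ^ 3 * Nm l)"
      using lF symmetric_of_int(2)[of "int q"] by (simp add: symmetric_of_int Nm_mult)
    have "d ^ 3 = d" using d(1) by auto
    with 1 have "3 dvd Nm v - (int q ^ 3 + d * Nm l)" by simp
    moreover have "3 dvd int q ^ 3 - int q" by (rule cube)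
    ultimately show ?thesis using d(2) by presburger
  qed
  have vI: "v \<in> I" "\<sigma> v \<in> I" "\<sigma> (\<sigma> v) \<in> I"
    using vO Trv Nmv by (simp_all add: Q Tr_conj Nm_conj)
  show ?thesis
  proof (rule that[OF vF trv trv2])
    fix x
    show "x \<in> I \<longleftrightarrow> (\<exists>i j k :: int. x = of_int i * v + of_int j * \<sigma> v + of_int k * \<sigma> (\<sigma> v))"
    proof
      assume "x \<in> I"
      hence x: "x \<in> \<O>" "int q dvd Tr x" "3 dvd Nm x" by (auto simp: Q)
      obtain a y where ay: "x = of_int a + y" "y \<in> L" "Tr x = 3 * a"
        using wild_decomposition[OF w x(1)] by blast
      have "coprime 3 q" using q(1) prime_3_nat by (intro prime_imp_coprime)
      hence "coprime (int q) 3" by (metis coprime_commute coprime_int_iff of_nat_numeral)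
      hence "int q dvd a" using x(2) ay(3) by (simp add: coprime_dvd_mult_right_iff)
      then obtain t where t: "a = int q * t" by (rule dvdE)
      obtain i j where ij: "y = of_int i * l + of_int j * \<sigma> l" "3 dvd Nm y - (i ^ 3 + j ^ 3) * Nm l"
        using wild_Nm_L[OF w ay(2)] by blast
      have "3 dvd Nm x - (Nm (of_int a) + Nm y)"
        unfolding ay(1) using ay(2) by (intro Nm_add_mod_3[OF w]) (simp_all add: L_\<O>)
      hence "3 dvd a ^ 3 + Nm y" using x(3) by (simp add: symmetric_of_int) presburger
      hence 1: "3 dvd a + Nm y" using cube[of a] by presburger
      have "3 dvd (i ^ 3 + j ^ 3) * Nm l - (i + j) * Nm l"
      proof -
        have "(i ^ 3 + j ^ 3) * Nm l - (i + j) * Nm l = ((i ^ 3 - i) + (j ^ 3 - j)) * Nm l"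
          by (simp add: algebra_simps)
        thus ?thesis using cube[of i] cube[of j] by simp
      qed
      hence 2: "3 dvd int q * t + (i + j) * Nm l" using 1 ij(2) t by presburger
      \<comment> \<open>Multiply by \<open>d\<close> and use \<open>d N(l) \<equiv> - q\<close> modulo 3 to see that 3 divides \<open>d t - (i + j)\<close>.\<close>
      have "3 dvd d * (int q * t + (i + j) * Nm l) - (i + j) * (int q + d * Nm l)"
        using 2 d(2) by (intro dvd_diff dvd_mult)
      moreover have "d * (int q * t + (i + j) * Nm l) - (i + j) * (int q + d * Nm l) = int q * (d * t - (i + j))"
        by (simp add: algebra_simps)
      ultimately have "3 dvd int q * (d * t - (i + j))" by simp
      hence "3 dvd d * t - (i + j)"
        using \<open>coprime (int q) 3\<close> by (simp add: coprime_dvd_mult_right_iff coprime_commute)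
      hence "3 dvd d * (d * t - (i + j))" by (rule dvd_mult)
      moreover have "d * (d * t - (i + j)) = t - d * (i + j)" by (simp add: right_diff_distrib dd mult.assoc[symmetric])
      ultimately obtain C where C: "t = 3 * C + d * (i + j)" by (metis diff_eq_eq dvdE)
      have d2: "of_int d * of_int d = (1::complex)" using dd by (metis of_int_1 of_int_mult)
      have "of_int (C + d * i) * v + of_int (C + d * j) * \<sigma> v + of_int C * \<sigma> (\<sigma> v)
        = of_int (3 * C + d * (i + j)) * of_nat q + of_int d * of_int d * (of_int i * l + of_int j * \<sigma> l)"
        using lF by (simp add: v_def \<sigma>2_l algebra_simps)
      also have "\<dots> = x" unfolding C[symmetric] d2 ay(1) t ij(1) by simp
      finally show "\<exists>i j k :: int. x = of_int i * v + of_int j * \<sigma> v + of_int k * \<sigma> (\<sigma> v)" by metis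
    next
      assume "\<exists>i j k :: int. x = of_int i * v + of_int j * \<sigma> v + of_int k * \<sigma> (\<sigma> v)"
      thus "x \<in> I" using span_in_ideal[OF I vI] by blast
    qed
  qed
qed

text \<open>Here the ideal contains all of \<open>L\<close>, and is the orthogonal sum of \<open>q\<int>\<close> and \<open>L\<close>.\<close>

lemma wild_ideal_orthogonal:
  assumes w: "wild" and q: "\<not> 3 dvd q" "q > (0 :: nat)" "3 * (int q)\<^sup>2 \<noteq> 2 * e"
    and Q: "\<And>x. x \<in> I \<longleftrightarrow> x \<in> \<O> \<and> int q dvd Tr x"
  shows "\<not> well_rounded (emb ` I)"
proof -
  have lF: "l \<in> F" "l \<in> \<O>" using l by (simp_all add: L_F L_\<O>)
  have basis: "x \<in> I \<longleftrightarrow> (\<exists>i j k :: int. x = of_int i * of_nat q + of_int j * l + of_int k * \<sigma> l)" for x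
  proof
    assume "x \<in> I"
    hence x: "x \<in> \<O>" "int q dvd Tr x" by (auto simp: Q)
    obtain a y where ay: "x = of_int a + y" "y \<in> L" "Tr x = 3 * a"
      using wild_decomposition[OF w x(1)] by blast
    have "coprime 3 q" using q(1) prime_3_nat by (intro prime_imp_coprime)
    hence "coprime (int q) 3" by (metis coprime_commute coprime_int_iff of_nat_numeral)
    hence "int q dvd a" using x(2) ay(3) by (simp add: coprime_dvd_mult_right_iff)
    then obtain t where t: "a = int q * t" by (rule dvdE)
    obtain i j :: int where ij: "y = of_int i * l + of_int j * \<sigma> l" using gen[OF ay(2)] by blast
    have "x = of_int t * of_nat q + of_int i * l + of_int j * \<sigma> l"
      by (simp add: ay(1) t ij algebra_simps)
    thus "\<exists>i j k :: int. x = of_int i * of_nat q + of_int j * l + of_int k * \<sigma> l" by blast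
  next
    assume "\<exists>i j k :: int. x = of_int i * of_nat q + of_int j * l + of_int k * \<sigma> l"
    then obtain i j k :: int where x: "x = of_int (i * int q) + (of_int j * l + of_int k * \<sigma> l)"
      by (auto simp: algebra_simps)
    have y: "of_int j * l + of_int k * \<sigma> l \<in> L" using l by simp
    hence "Tr x = 3 * (i * int q)"
      unfolding x using Tr_add[OF _ L_\<O>[OF y], of "of_int (i * int q)"] Tr_L[OF y]
      by (simp add: symmetric_of_int del: of_int_mult)
    moreover have "x \<in> \<O>" unfolding x using lF by simp
    ultimately show "x \<in> I" by (simp add: Q)
  qed
  have img: "emb ` I = lattice_of (emb (of_nat q)) (emb l) (emb (\<sigma> l))"
    using lF by (intro emb_image basis) simp_all
  have t: "tr (of_nat q * of_nat q) = of_nat (3 * q\<^sup>2)" "tr (of_nat q * l) = 0" "tr (of_nat q * \<sigma> l) = 0"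
    "tr (l * l) = 2 * of_int e" "tr (\<sigma> l * \<sigma> l) = 2 * of_int e" "tr (l * \<sigma> l) = - of_int e"
  proof -
    show "tr (of_nat q * of_nat q) = of_nat (3 * q\<^sup>2)" by (simp add: tr_def power2_eq_square)
    show "tr (of_nat q * l) = 0" "tr (of_nat q * \<sigma> l) = 0"
      using lF l by (simp_all add: symmetric_scale tr_\<sigma> L_tr)
    show "tr (l * l) = 2 * of_int e" using tr_l_square by (simp add: power2_eq_square)
    thus "tr (\<sigma> l * \<sigma> l) = 2 * of_int e" using lF tr_\<sigma>[of "l * l"] by simp
    show "tr (l * \<sigma> l) = - of_int e" using lF sy_l by (simp add: tr_def sy_def)
  qed
  have "real_of_int (3 * (int q)\<^sup>2) \<noteq> real_of_int (2 * e)" using q(3) by (metis of_int_eq_iff)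
  hence "real (3 * q\<^sup>2) \<noteq> 2 * real_of_int e" by simp
  thus ?thesis
    unfolding img using lF q(2) e_pos
    by (intro not_well_rounded_orthogonal[of "real (3 * q\<^sup>2)" "real_of_int e"]) (simp_all add: emb_inner t)
qed

end

section \<open>The Galois group of a cyclic cubic field\<close>

lemma subfield_CC_closed:
  assumes "subfield F CC"
  shows "\<And>x y. x \<in> F \<Longrightarrow> y \<in> F \<Longrightarrow> x + y \<in> F" "\<And>x y. x \<in> F \<Longrightarrow> y \<in> F \<Longrightarrow> x * y \<in> F"
    "\<And>x. x \<in> F \<Longrightarrow> inverse x \<in> F" "0 \<in> F" "1 \<in> F"
proof -
  interpret field CC by (rule field_CC)
  note sub = subringE[OF subfieldE(1)[OF assms]]
  show "x + y \<in> F" if "x \<in> F" "y \<in> F" for x y using sub(7)[OF that] by simp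
  show "x * y \<in> F" if "x \<in> F" "y \<in> F" for x y using sub(6)[OF that] by simp
  show "0 \<in> F" "1 \<in> F" using sub(2,3) by simp_all
  show "inverse x \<in> F" if "x \<in> F" for x
  proof (cases "x = 0")
    case False
    thus ?thesis using subfield_m_inv(1)[OF assms, of x] that by simp
  qed (use \<open>0 \<in> F\<close> in simp)
qed

lemma four_elements_dependent:
  assumes F: "subfield \<rat> CC" "ring.dimension CC 3 \<rat> F" and x: "{x1, x2, x3, x4} \<subseteq> F"
  obtains a b c d where "a \<in> \<rat>" "b \<in> \<rat>" "c \<in> \<rat>" "d \<in> \<rat>" "a * x1 + b * x2 + c * x3 + d * x4 = 0"
    "\<not> (a = 0 \<and> b = 0 \<and> c = 0 \<and> d = 0)"
proof -
  interpret field CC by (rule field_CC)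
  have "\<not> independent \<rat> [x1, x2, x3, x4]"
  proof
    assume "independent \<rat> [x1, x2, x3, x4]"
    from independent_length_le_dimension[OF F(1,2) this] x show False by simp
  qed
  then obtain Ks where Ks: "length Ks = length [x1, x2, x3, x4]" "combine Ks [x1, x2, x3, x4] = \<zero>\<^bsub>CC\<^esub>"
    "set Ks \<subseteq> \<rat>" "set Ks \<noteq> {\<zero>\<^bsub>CC\<^esub>}"
    using dependent_imp_non_trivial_combine[OF F(1), of "[x1, x2, x3, x4]"] by auto
  obtain a b c d where abcd: "Ks = [a, b, c, d]"
    using Ks(1) by (auto simp: length_Suc_conv)
  show ?thesis
  proof (rule that[of a b c d])
    show "a \<in> \<rat>" "b \<in> \<rat>" "c \<in> \<rat>" "d \<in> \<rat>" using Ks(3) abcd by simp_all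
    show "a * x1 + b * x2 + c * x3 + d * x4 = 0" using Ks(2) abcd by (simp add: add.assoc)
    show "\<not> (a = 0 \<and> b = 0 \<and> c = 0 \<and> d = 0)" using Ks(4) abcd by auto
  qed
qed

lemma galois_group_D:
  assumes "\<sigma> \<in> galois_group \<rat> F"
  shows "\<sigma> \<in> extensional F" "bij_betw \<sigma> F F" "\<And>x. x \<in> F \<Longrightarrow> \<sigma> x \<in> F"
    "\<And>x y. x \<in> F \<Longrightarrow> y \<in> F \<Longrightarrow> \<sigma> (x + y) = \<sigma> x + \<sigma> y"
    "\<And>x y. x \<in> F \<Longrightarrow> y \<in> F \<Longrightarrow> \<sigma> (x * y) = \<sigma> x * \<sigma> y"
    "\<sigma> 1 = 1" "\<And>x. x \<in> \<rat> \<Longrightarrow> \<sigma> x = x"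
  using assms by (auto simp: galois_group_def Bij_def ring_iso_def Ring.ring_hom_def bij_betw_def)

lemma galois_group_I:
  assumes "\<sigma> \<in> extensional F" "bij_betw \<sigma> F F"
    "\<And>x y. x \<in> F \<Longrightarrow> y \<in> F \<Longrightarrow> \<sigma> (x + y) = \<sigma> x + \<sigma> y"
    "\<And>x y. x \<in> F \<Longrightarrow> y \<in> F \<Longrightarrow> \<sigma> (x * y) = \<sigma> x * \<sigma> y"
    "\<And>x. x \<in> \<rat> \<Longrightarrow> \<sigma> x = x"
  shows "\<sigma> \<in> galois_group \<rat> F"
  using assms by (auto simp: galois_group_def Bij_def ring_iso_def Ring.ring_hom_def bij_betw_def)

lemma galois_group_compose:
  assumes F: "subfield F CC" "\<rat> \<subseteq> F" and s: "\<sigma> \<in> galois_group \<rat> F" and t: "\<tau> \<in> galois_group \<rat> F"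
  shows "compose F \<sigma> \<tau> \<in> galois_group \<rat> F"
proof (rule galois_group_I)
  note S = galois_group_D[OF s] and T = galois_group_D[OF t] and C = subfield_CC_closed[OF F(1)]
  show "compose F \<sigma> \<tau> \<in> extensional F" by (rule compose_extensional)
  show "bij_betw (compose F \<sigma> \<tau>) F F" by (rule bij_betw_compose[OF T(2) S(2)])
  show "compose F \<sigma> \<tau> (x + y) = compose F \<sigma> \<tau> x + compose F \<sigma> \<tau> y" if "x \<in> F" "y \<in> F" for x y
    using that C S T by (simp add: compose_eq)
  show "compose F \<sigma> \<tau> (x * y) = compose F \<sigma> \<tau> x * compose F \<sigma> \<tau> y" if "x \<in> F" "y \<in> F" for x y
    using that C S T by (simp add: compose_eq)
  show "compose F \<sigma> \<tau> x = x" if "x \<in> \<rat>" for x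
    using that F(2) S(7) T(7) by (auto simp: compose_eq)
qed

lemma cyclic_cubic_fieldD:
  assumes "cyclic_cubic_field F"
  shows "subfield \<rat> CC" "subfield F CC" "\<rat> \<subseteq> F" "ring.dimension CC 3 \<rat> F"
    "card (galois_group \<rat> F) = 3"
proof -
  interpret field CC by (rule field_CC)
  have 1: "galois_extension \<rat> F" "ring.dimension CC 3 \<rat> F"
    using assms by (simp_all add: cyclic_cubic_field_def)
  show 2: "subfield \<rat> CC" "subfield F CC" "\<rat> \<subseteq> F" "ring.dimension CC 3 \<rat> F"
    using 1 by (simp_all add: galois_extension_def)
  obtain n where "ring.dimension CC n \<rat> F" "card (galois_group \<rat> F) = n"
    using 1(1) by (auto simp: galois_extension_def)
  thus "card (galois_group \<rat> F) = 3" using dimension_is_inj[OF 2(1) _ 2(4)] by blast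
qed

text \<open>Composition with \<open>\<sigma>\<close> permutes the three automorphisms without fixed points, so it is a cycle of length 3.\<close>

lemma galois_group_cube:
  assumes F: "cyclic_cubic_field F" and s: "\<sigma> \<in> galois_group \<rat> F" and nt: "\<exists>x\<in>F. \<sigma> x \<noteq> x" and x: "x \<in> F"
  shows "\<sigma> (\<sigma> (\<sigma> x)) = x"
proof -
  note FD = cyclic_cubic_fieldD[OF F]
  let ?G = "galois_group \<rat> F"
  define \<iota> where "\<iota> = restrict (\<lambda>x::complex. x) F"
  have fin: "finite ?G" using FD(5) card_ge_0_finite by force
  note S = galois_group_D[OF s]
  have \<iota>: "\<iota> \<in> ?G"
    by (rule galois_group_I)
      (use FD(3) subfield_CC_closed[OF FD(2)] in \<open>auto simp: \<iota>_def bij_betw_def inj_on_def\<close>)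
  define f where "f = compose F \<sigma>"
  have f: "f \<tau> \<in> ?G" if "\<tau> \<in> ?G" for \<tau>
    unfolding f_def by (rule galois_group_compose[OF FD(2,3) s that])
  have ext_eq: "\<tau> = \<rho>" if "\<tau> \<in> ?G" "\<rho> \<in> ?G" "\<And>x. x \<in> F \<Longrightarrow> \<tau> x = \<rho> x" for \<tau> \<rho>
    using extensionalityI[OF galois_group_D(1)[OF that(1)] galois_group_D(1)[OF that(2)] that(3)] by blast
  have inj: "\<tau> = \<rho>" if "\<tau> \<in> ?G" "\<rho> \<in> ?G" "f \<tau> = f \<rho>" for \<tau> \<rho>
  proof (rule ext_eq[OF that(1,2)])
    fix x assume x: "x \<in> F"
    have "\<sigma> (\<tau> x) = \<sigma> (\<rho> x)" using fun_cong[OF that(3), of x] x by (simp add: f_def compose_eq)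
    thus "\<tau> x = \<rho> x"
      using S(2) galois_group_D(3)[OF that(1) x] galois_group_D(3)[OF that(2) x]
      by (auto simp: bij_betw_def inj_on_def)
  qed
  have no_fix: "f \<tau> \<noteq> \<tau>" if t: "\<tau> \<in> ?G" for \<tau>
  proof
    assume eq: "f \<tau> = \<tau>"
    obtain y where y: "y \<in> F" "\<sigma> y \<noteq> y" using nt by blast
    obtain z where z: "z \<in> F" "y = \<tau> z" using galois_group_D(2)[OF t] y(1) by (auto simp: bij_betw_def)
    have "\<sigma> (\<tau> z) = \<tau> z" using fun_cong[OF eq, of z] z(1) by (simp add: f_def compose_eq)
    thus False using y(2) z(2) by simp
  qed
  have G1: "f \<iota> \<in> ?G" "f (f \<iota>) \<in> ?G" "f (f (f \<iota>)) \<in> ?G" using \<iota> f by blast+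
  have "f (f \<iota>) \<noteq> \<iota>"
  proof
    assume eq: "f (f \<iota>) = \<iota>"
    have "card {\<iota>, f \<iota>} \<le> 2" by (cases "\<iota> = f \<iota>") simp_all
    hence "\<not> ?G \<subseteq> {\<iota>, f \<iota>}" using card_mono[of "{\<iota>, f \<iota>}" ?G] FD(5) by auto
    then obtain \<tau> where \<tau>: "\<tau> \<in> ?G" "\<tau> \<noteq> \<iota>" "\<tau> \<noteq> f \<iota>" by blast
    have d: "card {\<iota>, f \<iota>, \<tau>} = 3" using \<tau> no_fix[OF \<iota>] by auto
    have "{\<iota>, f \<iota>, \<tau>} = ?G"
      by (rule card_subset_eq[OF fin]) (use \<iota> G1 \<tau> d FD(5) in auto)
    hence "f \<tau> \<in> {\<iota>, f \<iota>, \<tau>}" using f[OF \<tau>(1)] by blast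
    hence "f \<tau> = f (f \<iota>) \<or> f \<tau> = f \<iota>" using no_fix[OF \<tau>(1)] eq by auto
    thus False using inj[OF \<tau>(1)] \<tau>(2,3) \<iota> G1(1) by blast
  qed
  have d: "card {\<iota>, f \<iota>, f (f \<iota>)} = 3"
    using no_fix[OF \<iota>] no_fix[OF G1(1)] \<open>f (f \<iota>) \<noteq> \<iota>\<close> by auto
  have "{\<iota>, f \<iota>, f (f \<iota>)} = ?G"
    by (rule card_subset_eq[OF fin]) (use \<iota> G1 d FD(5) in auto)
  hence "f (f (f \<iota>)) \<in> {\<iota>, f \<iota>, f (f \<iota>)}" using G1(3) by blast
  moreover have "f (f (f \<iota>)) \<noteq> f (f \<iota>)" using no_fix[OF G1(2)] .
  moreover have "f (f (f \<iota>)) \<noteq> f \<iota>" using inj[OF G1(2) \<iota>] \<open>f (f \<iota>) \<noteq> \<iota>\<close> by blast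
  ultimately have "f (f (f \<iota>)) = \<iota>" by blast
  from fun_cong[OF this, of x] show ?thesis using x S(3) by (simp add: f_def compose_eq \<iota>_def)
qed

text \<open>If \<open>x\<close> were fixed and irrational, then \<open>1, x, y, x y\<close> would be linearly independent for every \<open>y\<close> that is moved:
  a relation expresses \<open>y\<close> by \<open>x\<close>, or makes \<open>x\<close> rational. This contradicts that the degree is 3.\<close>

lemma cyclic_cubic_of_automorphism:
  assumes F: "cyclic_cubic_field F" and s: "\<sigma> \<in> galois_group \<rat> F" and nt: "\<exists>x\<in>F. \<sigma> x \<noteq> x"
  shows "cyclic_cubic F \<sigma>"
proof -
  note FD = cyclic_cubic_fieldD[OF F]
  note S = galois_group_D[OF s] and C = subfield_CC_closed[OF FD(2)]
  show ?thesis
  proof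
    show "x \<in> F" if "x \<in> \<rat>" for x using FD(3) that by blast
    show "\<sigma> (\<sigma> (\<sigma> x)) = x" if "x \<in> F" for x by (rule galois_group_cube[OF F s nt that])
    show "\<exists>x\<in>F. \<sigma> x \<noteq> x" by (rule nt)
    show "\<sigma> x = x \<longleftrightarrow> x \<in> \<rat>" if x: "x \<in> F" for x
    proof
      assume fixed: "\<sigma> x = x"
      show "x \<in> \<rat>"
      proof (rule ccontr)
        assume irr: "x \<notin> \<rat>"
        obtain y where y: "y \<in> F" "\<sigma> y \<noteq> y" using nt by blast
        have "{1, x, y, x * y} \<subseteq> F" using x y C by simp
        then obtain a b c d where abcd: "a \<in> \<rat>" "b \<in> \<rat>" "c \<in> \<rat>" "d \<in> \<rat>"
          "a * 1 + b * x + c * y + d * (x * y) = 0" "\<not> (a = 0 \<and> b = 0 \<and> c = 0 \<and> d = 0)"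
          by (rule four_elements_dependent[OF FD(1,4)])
        have F': "a \<in> F" "b \<in> F" "c \<in> F" "d \<in> F" using abcd FD(3) by auto
        have lin: "u = 0 \<and> v = 0" if "u \<in> \<rat>" "v \<in> \<rat>" "u + v * x = 0" for u v
        proof -
          have "v = 0"
          proof (rule ccontr)
            assume "v \<noteq> 0"
            hence "x = - u / v" using that(3) by (simp add: field_simps add_eq_0_iff)
            thus False using irr that by simp
          qed
          thus ?thesis using that(3) by simp
        qed
        have eq: "(a + b * x) + (c + d * x) * y = 0" using abcd(5) by (simp add: algebra_simps)
        have "\<sigma> ((a + b * x) + (c + d * x) * y) = (a + b * x) + (c + d * x) * \<sigma> y"
          using F' x y C S abcd fixed by simp
        moreover have "\<sigma> 0 = 0" by (rule S(7)) simp
        ultimately have eq': "(a + b * x) + (c + d * x) * \<sigma> y = 0" unfolding eq by simp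
        have "(c + d * x) * (y - \<sigma> y) = ((a + b * x) + (c + d * x) * y) - ((a + b * x) + (c + d * x) * \<sigma> y)"
          by (simp add: algebra_simps)
        hence "(c + d * x) * (y - \<sigma> y) = 0" unfolding eq eq' by simp
        hence cd: "c + d * x = 0" using y(2) by simp
        hence "c = 0 \<and> d = 0" using lin abcd by blast
        moreover have "a + b * x = 0" using eq cd by simp
        hence "a = 0 \<and> b = 0" using lin abcd by blast
        ultimately show False using abcd(6) by blast
      qed
    next
      assume "x \<in> \<rat>"
      thus "\<sigma> x = x" by (rule S(7))
    qed
  qed (use C S in auto)
qed

lemma nontrivial_automorphism_exists:
  assumes F: "cyclic_cubic_field F"
  obtains \<sigma> where "\<sigma> \<in> galois_group \<rat> F" "\<exists>x\<in>F. \<sigma> x \<noteq> x"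
proof -
  note FD = cyclic_cubic_fieldD[OF F]
  have "\<not> galois_group \<rat> F \<subseteq> {restrict (\<lambda>x. x) F}"
  proof
    assume "galois_group \<rat> F \<subseteq> {restrict (\<lambda>x. x) F}"
    hence "card (galois_group \<rat> F) \<le> card {restrict (\<lambda>x::complex. x) F}" by (intro card_mono) auto
    thus False using FD(5) by simp
  qed
  then obtain \<sigma> where s: "\<sigma> \<in> galois_group \<rat> F" "\<sigma> \<noteq> restrict (\<lambda>x. x) F" by blast
  have "\<exists>x\<in>F. \<sigma> x \<noteq> x"
  proof (rule ccontr)
    assume "\<not> (\<exists>x\<in>F. \<sigma> x \<noteq> x)"
    hence "\<sigma> = restrict (\<lambda>x. x) F"
      using galois_group_D(1)[OF s(1)] by (intro extensionalityI[of \<sigma> F]) auto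
    thus False using s(2) by blast
  qed
  thus ?thesis using that s(1) by blast
qed

text \<open>The identity generates a group of order 1.\<close>

lemma galois_generator_nontrivial:
  assumes F: "cyclic_cubic_field F" and s: "galois_generator F \<sigma>"
  shows "\<sigma> \<in> galois_group \<rat> F" "\<exists>x\<in>F. \<sigma> x \<noteq> x"
proof -
  note FD = cyclic_cubic_fieldD[OF F]
  show s1: "\<sigma> \<in> galois_group \<rat> F" using s by (simp add: galois_generator_def)
  show "\<exists>x\<in>F. \<sigma> x \<noteq> x"
  proof (rule ccontr)
    assume "\<not> (\<exists>x\<in>F. \<sigma> x \<noteq> x)"
    hence "\<sigma> = restrict (\<lambda>x. x) F"
      using galois_group_D(1)[OF s1] by (intro extensionalityI[of \<sigma> F]) auto
    hence "\<sigma> = \<one>\<^bsub>BijGroup F\<^esub>" by (simp add: BijGroup_def)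
    hence "generate (BijGroup F) {\<sigma>} = {\<sigma>}"
      using group.generate_one[OF group_BijGroup] by metis
    hence "galois_group \<rat> F = {\<sigma>}" using s unfolding galois_generator_def by blast
    hence "card {\<sigma>} = 3" using FD(5) by (simp only:)
    thus False by simp
  qed
qed

section \<open>Square-free divisors of the conductor\<close>

context conductor_field
begin

text \<open>Away from 3 the conductor divides \<open>e\<close>; the prime 3 divides a square-free \<open>q\<close> at most once.\<close>

lemma square_free_divisor:
  assumes q: "squarefree q" "q dvd m"
  shows "\<not> 3 dvd q \<Longrightarrow> coprime q 3 \<and> int q dvd e"
    "3 dvd q \<Longrightarrow> wild \<and> (\<exists>q'. q = 3 * q' \<and> \<not> 3 dvd q' \<and> squarefree q' \<and> coprime q' 3 \<and> int q' dvd e)"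
proof -
  have *: "coprime r 3 \<and> int r dvd e" if r: "\<not> 3 dvd r" "r dvd m" for r
  proof -
    have "coprime 3 r" using r(1) prime_3_nat by (intro prime_imp_coprime)
    hence c: "coprime r 3" by (simp add: coprime_commute)
    hence ci: "coprime (int r) 3" by (metis coprime_int_iff of_nat_numeral)
    have "int r dvd int m" using r(2) by simp
    hence "int r dvd e" using ci by (auto simp: conductor_eq coprime_dvd_mult_right_iff split: if_splits)
    thus ?thesis using c by simp
  qed
  show "\<not> 3 dvd q \<Longrightarrow> coprime q 3 \<and> int q dvd e" using * q(2) by blast
  assume q3: "3 dvd q"
  hence "3 dvd m" using q(2) by (rule dvd_trans)
  hence w: wild by (simp add: wild_iff)
  obtain q' where q': "q = 3 * q'" using q3 by (rule dvdE)
  have n3: "\<not> 3 dvd q'"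
  proof
    assume "3 dvd q'"
    hence "3\<^sup>2 dvd q" by (auto simp: q' power2_eq_square)
    hence "(3::nat) dvd 1" using q(1) squarefreeD by blast
    thus False by simp
  qed
  have "q' dvd m" using q(2) q' by (metis dvd_mult_right)
  moreover have "squarefree q'" using q(1) q' by (metis dvd_triv_right squarefree_mono)
  ultimately show "wild \<and> (\<exists>q'. q = 3 * q' \<and> \<not> 3 dvd q' \<and> squarefree q' \<and> coprime q' 3 \<and> int q' dvd e)"
    using w q' n3 *[OF n3] by blast
qed

text \<open>When 3 divides \<open>m\<close> but not \<open>q\<close>, equality of the two shortest lengths would mean \<open>9q\<^sup>2 = 2m\<close>, which
  fails modulo 4 because \<open>m\<close> is odd.\<close>

theorem square_free_norm_ideal:
  assumes q: "squarefree q" "q dvd m"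
  obtains Q where "\<And>I. nonzero_ideal F I \<and> ideal_norm F I = q \<longleftrightarrow> I = Q"
    "well_rounded (emb ` Q) \<longleftrightarrow>
        (\<not> 3 dvd m \<and> real m / 4 \<le> (real q)\<^sup>2 \<and> (real q)\<^sup>2 \<le> 4 * real m) \<or>
        (3 dvd m \<and> 3 dvd q \<and> real m / 4 \<le> (real q)\<^sup>2 \<and> (real q)\<^sup>2 \<le> 4 * real m)"
proof (cases "3 dvd q")
  case False
  have q0: "q > 0" by (rule squarefree_pos[OF q(1)])
  have qe: "coprime q 3" "int q dvd e" using square_free_divisor(1)[OF q False] by simp_all
  obtain \<psi> where \<psi>: "residue_map F \<sigma> \<psi> q" "\<And>x. x \<in> \<O> \<Longrightarrow> int q dvd \<psi> x \<longleftrightarrow> int q dvd Tr x"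
    using tame_residue[OF q(1) qe] by blast
  interpret R: residue_map F \<sigma> \<psi> q by (rule \<psi>(1))
  have Q: "x \<in> R.Q \<longleftrightarrow> x \<in> \<O> \<and> int q dvd Tr x" for x
    using \<psi>(2) by (auto simp: R.Q_def)
  show ?thesis
  proof (rule that[OF R.unique_ideal])
    show "well_rounded (emb ` R.Q) \<longleftrightarrow>
        (\<not> 3 dvd m \<and> real m / 4 \<le> (real q)\<^sup>2 \<and> (real q)\<^sup>2 \<le> 4 * real m) \<or>
        (3 dvd m \<and> 3 dvd q \<and> real m / 4 \<le> (real q)\<^sup>2 \<and> (real q)\<^sup>2 \<le> 4 * real m)"
    proof (cases wild)
      case w: True
      have m: "int m = 3 * e" using conductor_eq w by simp
      have "3 * (int q)\<^sup>2 \<noteq> 2 * e"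
      proof
        assume "3 * (int q)\<^sup>2 = 2 * e"
        hence eq: "9 * (int q)\<^sup>2 = 2 * int m" using m by simp
        hence "even (9 * (int q)\<^sup>2)" by simp
        hence "even (int q)" by simp
        then obtain t where "int q = 2 * t" by (rule evenE)
        hence "int m = 2 * (9 * t\<^sup>2)" using eq by (simp add: power2_eq_square)
        hence "even (int m)" by simp
        thus False using conductor_odd by simp
      qed
      hence "\<not> well_rounded (emb ` R.Q)" using w False q0 Q by (intro wild_ideal_orthogonal)
      thus ?thesis using w wild_iff False by simp
    next
      case tame: False
      have m: "int m = e" using conductor_eq tame by simp
      obtain v where v: "v \<in> F" "tr v = of_nat q" "3 * tr (v\<^sup>2) = of_int (int q ^ 2 + 2 * e)"
        "\<And>x. x \<in> R.Q \<longleftrightarrow> (\<exists>i j k :: int. x = of_int i * v + of_int j * \<sigma> v + of_int k * \<sigma> (\<sigma> v))"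
        using tame_ideal_basis[OF tame False q0 R.ideal_Q Q] by blast
      have "3 * tr (v\<^sup>2) = of_nat (q\<^sup>2 + 2 * m)" unfolding v(3) m[symmetric] by simp
      from well_rounded_conjugate_basis[OF v(1,2) this q0 m_pos v(4)]
      show ?thesis using tame wild_iff by simp
    qed
  qed
next
  case True
  obtain q' where w: wild and q': "q = 3 * q'" "\<not> 3 dvd q'" "squarefree q'" "coprime q' 3" "int q' dvd e"
    using square_free_divisor(2)[OF q True] by blast
  have q0: "q > 0" "q' > 0" using squarefree_pos[OF q(1)] squarefree_pos[OF q'(3)] by simp_all
  obtain \<psi> where \<psi>: "residue_map F \<sigma> \<psi> (3 * q')"
    "\<And>x. x \<in> \<O> \<Longrightarrow> int (3 * q') dvd \<psi> x \<longleftrightarrow> int q' dvd Tr x \<and> 3 dvd Nm x"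
    using wild_residue[OF w q'(3,4,5)] by blast
  interpret R: residue_map F \<sigma> \<psi> "3 * q'" by (rule \<psi>(1))
  have Q: "x \<in> R.Q \<longleftrightarrow> x \<in> \<O> \<and> int q' dvd Tr x \<and> 3 dvd Nm x" for x
    using \<psi>(2)[of x] unfolding R.Q_def by blast
  have m: "int m = 3 * e" using conductor_eq w by simp
  obtain v where v: "v \<in> F" "tr v = of_nat (3 * q')" "3 * tr (v\<^sup>2) = of_int (int (3 * q') ^ 2 + 6 * e)"
    "\<And>x. x \<in> R.Q \<longleftrightarrow> (\<exists>i j k :: int. x = of_int i * v + of_int j * \<sigma> v + of_int k * \<sigma> (\<sigma> v))"
    using wild_ideal_basis[OF w q'(2) q0(2) R.ideal_Q Q] by blast
  have "int (3 * q') ^ 2 + 6 * e = int ((3 * q')\<^sup>2 + 2 * m)" using m by simp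
  hence "3 * tr (v\<^sup>2) = of_nat ((3 * q')\<^sup>2 + 2 * m)" unfolding v(3) by (metis of_int_of_nat_eq)
  from well_rounded_conjugate_basis[OF v(1,2) this _ m_pos v(4)] q0
  have wr: "well_rounded (emb ` R.Q) \<longleftrightarrow> real m / 4 \<le> (real q)\<^sup>2 \<and> (real q)\<^sup>2 \<le> 4 * real m"
    by (simp only: q')
  show ?thesis
  proof (rule that[of R.Q])
    show "nonzero_ideal F I \<and> ideal_norm F I = q \<longleftrightarrow> I = R.Q" for I
      unfolding q'(1) by (rule R.unique_ideal)
  qed (use wr True w wild_iff in simp)
qed

end

lemma conductor_field_exists:
  assumes F: "cyclic_cubic_field F" "is_conductor F m" and s: "cyclic_cubic F \<sigma>"
  obtains l where "conductor_field F \<sigma> l m"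
proof -
  interpret cyclic_cubic F \<sigma> by (rule s)
  obtain l where l: "l \<in> L" "l \<noteq> 0" "\<forall>y\<in>L. \<exists>i j :: int. y = of_int i * l + of_int j * \<sigma> l"
    using trace_zero_generator_exists by blast
  have "conductor_field F \<sigma> l m"
    by unfold_locales (use l F(2) in \<open>auto simp: is_conductor_def\<close>)
  thus ?thesis by (rule that)
qed

theorem theorem1p2:
  fixes F :: "complex set" and m q :: nat
  assumes "cyclic_cubic_field F"
    and "is_conductor F m"
    and "squarefree q"
    and "q dvd m"
  shows "(\<exists>!Q. nonzero_ideal F Q \<and> ideal_norm F Q = q) \<and>
    (\<forall>Q \<sigma>. nonzero_ideal F Q \<and> ideal_norm F Q = q \<and> galois_generator F \<sigma> \<longrightarrow>
      (well_rounded (field_embedding \<sigma> ` Q) \<longleftrightarrow>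
        (\<not> 3 dvd m \<and> real m / 4 \<le> (real q)\<^sup>2 \<and> (real q)\<^sup>2 \<le> 4 * real m) \<or>
        (3 dvd m \<and> 3 dvd q \<and> real m / 4 \<le> (real q)\<^sup>2 \<and> (real q)\<^sup>2 \<le> 4 * real m)))"
proof (intro conjI allI impI)
  obtain \<sigma> where "\<sigma> \<in> galois_group \<rat> F" "\<exists>x\<in>F. \<sigma> x \<noteq> x"
    by (rule nontrivial_automorphism_exists[OF assms(1)])
  hence "cyclic_cubic F \<sigma>" by (rule cyclic_cubic_of_automorphism[OF assms(1)])
  then obtain l where "conductor_field F \<sigma> l m" by (rule conductor_field_exists[OF assms(1,2)])
  then interpret conductor_field F \<sigma> l m .
  show "\<exists>!Q. nonzero_ideal F Q \<and> ideal_norm F Q = q"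
  proof (rule square_free_norm_ideal[OF assms(3,4)])
    fix Q assume "\<And>I. nonzero_ideal F I \<and> ideal_norm F I = q \<longleftrightarrow> I = Q"
    thus ?thesis by simp
  qed
next
  fix Q \<sigma> assume Q: "nonzero_ideal F Q \<and> ideal_norm F Q = q \<and> galois_generator F \<sigma>"
  hence "cyclic_cubic F \<sigma>"
    using galois_generator_nontrivial[OF assms(1)] by (intro cyclic_cubic_of_automorphism[OF assms(1)]) blast+
  then obtain l where "conductor_field F \<sigma> l m" by (rule conductor_field_exists[OF assms(1,2)])
  then interpret conductor_field F \<sigma> l m .
  show "well_rounded (field_embedding \<sigma> ` Q) \<longleftrightarrow>
        (\<not> 3 dvd m \<and> real m / 4 \<le> (real q)\<^sup>2 \<and> (real q)\<^sup>2 \<le> 4 * real m) \<or>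
        (3 dvd m \<and> 3 dvd q \<and> real m / 4 \<le> (real q)\<^sup>2 \<and> (real q)\<^sup>2 \<le> 4 * real m)"
  proof (rule square_free_norm_ideal[OF assms(3,4)])
    fix P
    assume "\<And>I. nonzero_ideal F I \<and> ideal_norm F I = q \<longleftrightarrow> I = P"
    hence "Q = P" using Q by blast
    moreover assume "well_rounded (emb ` P) \<longleftrightarrow>
        (\<not> 3 dvd m \<and> real m / 4 \<le> (real q)\<^sup>2 \<and> (real q)\<^sup>2 \<le> 4 * real m) \<or>
        (3 dvd m \<and> 3 dvd q \<and> real m / 4 \<le> (real q)\<^sup>2 \<and> (real q)\<^sup>2 \<le> 4 * real m)"
    ultimately show ?thesis by (simp only:)
  qed
qed

end
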